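(* Let $A,B,D:[0,T]^2\times\Omega\to\mathbb R^{m\times m}$ be measurable and bounded, such that for almost all $t\in[0,T]$ the map $s\mapsto(A(t,s),B(t,s),D(t,s))$ is $\mathbb F$-adapted on $[0,T]$, and for almost all $s\in[0,T]$ the processes $A(s,\cdot)$, $B(s,\cdot)$, $D(\cdot,s)$ are continuous. Let $\Theta\in L^2_{\mathcal F_T}(\Omega;\mathbb R^m)$, $\psi\in L^2_{\mathcal F_T}(0,T;\mathbb R^m)$, $\widetilde\psi\in C_{\mathcal F_T}([0,T];L^2(\Omega;\mathbb R^m))$, and let $\widetilde A:[0,T]^2\times\Omega\to\mathbb R^{m\times m}$ be measurable and bounded, such that for almost all $t$ the map $s\mapsto\widetilde A(t,s)$ is $\mathbb F$-adapted on $[0,T]$ and for almost all $s$ the process $\widetilde A(\cdot,s)$ is continuous. Let $(\alpha,\beta)\in C_{\mathbb F}([0,T];L^2(\Omega;\mathbb R^m))\times C([0,T];L^2_{\mathbb F}(0,T;\mathbb R^m))$, and let $\xi\in C_{\mathcal F_T}([0,T];L^2(\Omega;\mathbb R^m))$ be the solution of $$\begin{aligned}\xi(t)={}&\alpha(t)+\int_0^t A(s,t)^\top\mathbb E_t[\xi(s)]ds+\int_0^t\mathbb E_s[B(s,t)^\top\xi(s)]dW(s)\\&+\int_0^T\beta(t,s)dW(s)+\int_t^T D(t,s)^\top\mathbb E_s[\xi(t)]dW(s).\end{aligned}$$ Let $(Y,Z)$, $(\mu,\nu)$, $(\widetilde Y,\widetilde Z)$ be the solutions (in the senses given in the context) of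 $$\begin{aligned} Y(t)&=\psi(t)+A(t,T)\Theta+B(t,T)\nu(t)\\&\quad+\int_t^T\big[A(t,s)Y(s)+B(t,s)Z(s,t)+D(t,s)Z(t,s)\big]ds-\int_t^T Z(t,s)dW(s),\quad\text{a.e. }t\in[0,T],\\ \mu(t)&=\Theta-\int_t^T\nu(s)dW(s),\quad t\in[0,T],\\ \widetilde Y(t)&=\widetilde\psi(t)+\int_t^T\big[\widetilde A(t,s)\widetilde Y(s)+D(t,s)\widetilde Z(t,s)\big]ds-\int_t^T\widetilde Z(t,s)dW(s),\quad t\in[0,T]. \end{aligned}$$ Then $$\begin{aligned}\mathbb E\langle\xi(T),\Theta\rangle+\mathbb E\int_0^T\langle\psi(t),\xi(t)\rangle dt={}&\mathbb E\langle\alpha(T),\Theta\rangle+\mathbb E\int_0^T\langle\beta(T,s),\nu(s)\rangle ds\\&+\mathbb E\int_0^T\langle Y(t),\alpha(t)\rangle dt+\mathbb E\int_0^T\!\!\int_0^T\langle Z(t,s),\beta(t,s)\rangle dsdt,\end{aligned}$$ and $$\mathbb E\langle\xi(0),\widetilde\psi(0)\rangle+\mathbb E\int_0^T\langle\mathbb E_s[\xi(0)],\widetilde A(0,s)\widetilde Y(s)\rangle ds=\langle\widetilde Y(0),\alpha(0)\rangle+\mathbb E\int_0^T\langle\widetilde Z(0,s),\beta(0,s)\rangle ds.$$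
   Context: $T>0$; $(\Omega,\mathcal F,\mathbb F,\mathbb P)$ is a complete filtered probability space, $W$ a one-dimensional standard Wiener process, $\mathbb F=\{\mathcal F_t\}_{0\le t\le T}$ the natural filtration of $W$ augmented by all null sets. $\mathbb E_s[\eta]:=\mathbb E[\eta|\mathcal F_s]$; $\top$ denotes transpose. Spaces (for a Euclidean space $H$). $L^2_{\mathcal F_T}(0,T;H)$: $\mathcal F_T\otimes\mathcal B([0,T])$-measurable processes with $\mathbb E\int_0^T|X|^2dr<\infty$ (not necessarily adapted); $L^2_{\mathbb F}(0,T;H)$: its $\mathbb F$-adapted elements. $L^2_{\mathbb F}(\Omega;C([0,T];H))$: adapted processes with continuous paths and $\mathbb E\sup_r|X(r)|^2<\infty$. $C_{\mathcal F_T}([0,T];L^2(\Omega;H))$: continuous maps $[0,T]\to L^2_{\mathcal F_T}(\Omega;H)$; $C_{\mathbb F}([0,T];L^2(\Omega;H))$: its $\mathbb F$-adapted elements. $C([0,T];L^2_{\mathbb F}(0,T;H))$: fields $Z(t,s)$ with $s\mapsto Z(t,s)$ adapted on $[0,T]$ for every $t$, and $t\mapsto Z(t,\cdot)$ continuous into $L^2_{\mathbb F}(0,T;H)$. $L^2(0,T;L^2_{\mathbb F}(0,T;H))$: fields $Z(t,s)$ with $s\mapsto Z(t,s)$ adapted for a.e. $t$ and $\mathbb E\int_0^T\int_0^T|Z(t,s)|^2dsdt<\infty$. Solutions. Under the stated assumptions the equation for $\xi$ has a unique solution in $C_{\mathcal F_T}([0,T];L^2(\Omega;\mathbb R^m))$,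 for which the equation holds a.s. for every $t\in[0,T]$. $(Y,Z)\in L^2_{\mathbb F}(0,T;\mathbb R^m)\times L^2(0,T;L^2_{\mathbb F}(0,T;\mathbb R^m))$ is the unique adapted M-solution of its equation, meaning that in addition to the equation, $Y(t)=\mathbb E Y(t)+\int_0^t Z(t,s)dW(s)$ for a.e. $t\in[0,T]$, a.s. $(\mu,\nu)$ is the adapted square-integrable solution of the BSDE (so $\mu(t)=\mathbb E_t\Theta$ and $\nu\in L^2_{\mathbb F}(0,T;\mathbb R^m)$ is its martingale-representation integrand). $(\widetilde Y,\widetilde Z)\in C_{\mathbb F}([0,T];L^2(\Omega;\mathbb R^m))\times C([0,T];L^2_{\mathbb F}(0,T;\mathbb R^m))$ is the unique C-adapted solution: for every $t$ the equation holds a.s., and the process $r\mapsto\widetilde\psi(t)+\int_r^T[\widetilde A(t,s)\widetilde Y(s)+D(t,s)\widetilde Z(t,s)]ds-\int_r^T\widetilde Z(t,s)dW(s)$ is in $L^2_{\mathbb F}(\Omega;C([0,T];\mathbb R^m))$. In particular $\widetilde Y(0)$ and $\alpha(0)$ are deterministic. *)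

theory Defs
  imports "HOL-Probability.Probability"
begin

section \<open>Brownian motion and its augmented filtration\<close>

definition past_events :: "'w measure \<Rightarrow> (real \<Rightarrow> 'w \<Rightarrow> real) \<Rightarrow> real \<Rightarrow> 'w set set" where
  "past_events M W t = {W r -` S \<inter> space M | r S. 0 \<le> r \<and> r \<le> t \<and> S \<in> sets borel}"

definition wiener_process :: "'w measure \<Rightarrow> real \<Rightarrow> (real \<Rightarrow> 'w \<Rightarrow> real) \<Rightarrow> bool" where
  "wiener_process M T W \<longleftrightarrow>
     (\<forall>t\<in>{0..T}. W t \<in> borel_measurable M) \<and>
     (AE \<omega> in M. W 0 \<omega> = 0) \<and>
     (AE \<omega> in M. continuous_on {0..T} (\<lambda>t. W t \<omega>)) \<and>
     (\<forall>s t. 0 \<le> s \<and> s < t \<and> t \<le> T \<longrightarrow>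
        distributed M lborel (\<lambda>\<omega>. W t \<omega> - W s \<omega>) (normal_density 0 (sqrt (t - s))) \<and>
        prob_space.indep_set M
          (sigma_sets (space M) (past_events M W s))
          {(\<lambda>\<omega>. W t \<omega> - W s \<omega>) -` S \<inter> space M | S. S \<in> sets borel})"

text \<open>Only the \<open>\<sigma>\<close>-algebra of the following measure is used.\<close>

definition augmented_filtration :: "'w measure \<Rightarrow> (real \<Rightarrow> 'w \<Rightarrow> real) \<Rightarrow> real \<Rightarrow> 'w measure" where
  "augmented_filtration M W t = sigma (space M) (past_events M W t \<union> null_sets M)"

section \<open>Spaces of processes\<close>

text \<open>
  A process is a function of time and scenario; its values at times outside \<open>[0,T]\<close> play no role.
  Elements of the spaces of continuous maps into an \<open>L\<^sup>2\<close> space are given by representatives that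
  are jointly measurable in time(s) and scenario (such a representative always exists), so
  that pathwise time integrals make sense.
\<close>

abbreviation leb :: "real \<Rightarrow> real \<Rightarrow> real measure" where
  "leb a b \<equiv> restrict_space lborel {a..b}"

definition L2_rv :: "'w measure \<Rightarrow> 'w measure \<Rightarrow> ('w \<Rightarrow> 'h::euclidean_space) set" where
  "L2_rv M G = {X \<in> borel_measurable G. integrable M (\<lambda>\<omega>. (norm (X \<omega>))\<^sup>2)}"

definition L2_meas ::
  "'w measure \<Rightarrow> (real \<Rightarrow> 'w measure) \<Rightarrow> real \<Rightarrow> (real \<Rightarrow> 'w \<Rightarrow> 'h::euclidean_space) set" where
  "L2_meas M F T = {X.
     (\<lambda>(r, \<omega>). X r \<omega>) \<in> borel_measurable (leb 0 T \<Otimes>\<^sub>M F T) \<and>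
     integrable (leb 0 T \<Otimes>\<^sub>M M) (\<lambda>(r, \<omega>). (norm (X r \<omega>))\<^sup>2)}"

definition adapted ::
  "(real \<Rightarrow> 'w measure) \<Rightarrow> real \<Rightarrow> (real \<Rightarrow> 'w \<Rightarrow> 'h::topological_space) \<Rightarrow> bool" where
  "adapted F T X \<longleftrightarrow> (\<forall>r\<in>{0..T}. X r \<in> borel_measurable (F r))"

definition L2_adapted ::
  "'w measure \<Rightarrow> (real \<Rightarrow> 'w measure) \<Rightarrow> real \<Rightarrow> (real \<Rightarrow> 'w \<Rightarrow> 'h::euclidean_space) set" where
  "L2_adapted M F T = {X \<in> L2_meas M F T. adapted F T X}"

text \<open>\<open>L\<^sup>2\<^sub>F(\<Omega>; C([0,T]; H))\<close>\<close>

definition L2_cont_paths ::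
  "'w measure \<Rightarrow> (real \<Rightarrow> 'w measure) \<Rightarrow> real \<Rightarrow> (real \<Rightarrow> 'w \<Rightarrow> 'h::euclidean_space) set" where
  "L2_cont_paths M F T = {X. adapted F T X \<and>
     (\<forall>\<omega>\<in>space M. continuous_on {0..T} (\<lambda>r. X r \<omega>)) \<and>
     (\<integral>\<^sup>+\<omega>. (SUP r\<in>{0..T}. ennreal ((norm (X r \<omega>))\<^sup>2)) \<partial>M) < \<infinity>}"

text \<open>\<open>C([0,T]; L\<^sup>2(\<Omega>; H))\<close> with values measurable at the terminal time, and its adapted elements\<close>

definition C_L2 ::
  "'w measure \<Rightarrow> (real \<Rightarrow> 'w measure) \<Rightarrow> real \<Rightarrow> (real \<Rightarrow> 'w \<Rightarrow> 'h::euclidean_space) set" where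
  "C_L2 M F T = {X.
     (\<lambda>(r, \<omega>). X r \<omega>) \<in> borel_measurable (leb 0 T \<Otimes>\<^sub>M F T) \<and>
     (\<forall>t\<in>{0..T}. X t \<in> L2_rv M (F T) \<and>
        ((\<lambda>r. LINT \<omega>|M. (norm (X r \<omega> - X t \<omega>))\<^sup>2) \<longlongrightarrow> 0) (at t within {0..T}))}"

definition C_L2_adapted ::
  "'w measure \<Rightarrow> (real \<Rightarrow> 'w measure) \<Rightarrow> real \<Rightarrow> (real \<Rightarrow> 'w \<Rightarrow> 'h::euclidean_space) set" where
  "C_L2_adapted M F T = {X \<in> C_L2 M F T. adapted F T X}"

text \<open>\<open>C([0,T]; L\<^sup>2\<^sub>F(0,T; H))\<close> and \<open>L\<^sup>2(0,T; L\<^sup>2\<^sub>F(0,T; H))\<close>\<close>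

definition C_L2_adapted_fields ::
  "'w measure \<Rightarrow> (real \<Rightarrow> 'w measure) \<Rightarrow> real \<Rightarrow> (real \<Rightarrow> real \<Rightarrow> 'w \<Rightarrow> 'h::euclidean_space) set" where
  "C_L2_adapted_fields M F T = {Z.
     (\<lambda>(t, s, \<omega>). Z t s \<omega>) \<in> borel_measurable (leb 0 T \<Otimes>\<^sub>M leb 0 T \<Otimes>\<^sub>M F T) \<and>
     (\<forall>t\<in>{0..T}. Z t \<in> L2_adapted M F T \<and>
        ((\<lambda>r. LINT (s, \<omega>)|(leb 0 T \<Otimes>\<^sub>M M). (norm (Z r s \<omega> - Z t s \<omega>))\<^sup>2) \<longlongrightarrow> 0)
          (at t within {0..T}))}"

definition L2_L2_adapted_fields ::
  "'w measure \<Rightarrow> (real \<Rightarrow> 'w measure) \<Rightarrow> real \<Rightarrow> (real \<Rightarrow> real \<Rightarrow> 'w \<Rightarrow> 'h::euclidean_space) set" where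
  "L2_L2_adapted_fields M F T = {Z.
     (\<lambda>(t, s, \<omega>). Z t s \<omega>) \<in> borel_measurable (leb 0 T \<Otimes>\<^sub>M leb 0 T \<Otimes>\<^sub>M F T) \<and>
     (AE t in leb 0 T. adapted F T (Z t)) \<and>
     integrable (leb 0 T \<Otimes>\<^sub>M leb 0 T \<Otimes>\<^sub>M M) (\<lambda>(t, s, \<omega>). (norm (Z t s \<omega>))\<^sup>2)}"

definition bounded_coefficient ::
  "'w measure \<Rightarrow> real \<Rightarrow> (real \<Rightarrow> real \<Rightarrow> 'w \<Rightarrow> 'h::euclidean_space) \<Rightarrow> bool" where
  "bounded_coefficient M T A \<longleftrightarrow>
     (\<lambda>(t, s, \<omega>). A t s \<omega>) \<in> borel_measurable (leb 0 T \<Otimes>\<^sub>M leb 0 T \<Otimes>\<^sub>M M) \<and>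
     (\<exists>K. \<forall>t\<in>{0..T}. \<forall>s\<in>{0..T}. \<forall>\<omega>\<in>space M. norm (A t s \<omega>) \<le> K)"

section \<open>Conditional expectation\<close>

definition vec_cond_exp ::
  "'w measure \<Rightarrow> 'w measure \<Rightarrow> ('w \<Rightarrow> real^'m) \<Rightarrow> 'w \<Rightarrow> real^'m" where
  "vec_cond_exp M G X \<omega> = (\<chi> i. real_cond_exp M G (\<lambda>\<omega>. X \<omega> $ i) \<omega>)"

text \<open>
  The conditional expectation of \<open>X s\<close> given \<open>G s\<close> is only determined up to a null set depending
  on \<open>s\<close>.  When it occurs as an integrand in \<open>s\<close>, it stands for any jointly measurable version
  \<open>P\<close>; the integrals do not depend on the version.
\<close>

definition cond_exp_process ::
  "'w measure \<Rightarrow> (real \<Rightarrow> 'w measure) \<Rightarrow> real \<Rightarrow> real \<Rightarrow>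
     (real \<Rightarrow> 'w \<Rightarrow> real^'m) \<Rightarrow> (real \<Rightarrow> 'w \<Rightarrow> real^'m) \<Rightarrow> bool" where
  "cond_exp_process M G a b X P \<longleftrightarrow>
     (\<lambda>(s, \<omega>). P s \<omega>) \<in> borel_measurable (leb a b \<Otimes>\<^sub>M M) \<and>
     (\<forall>s\<in>{a..b}. AE \<omega> in M. P s \<omega> = vec_cond_exp M (G s) (X s) \<omega>)"

section \<open>The Ito integral\<close>

text \<open>
  A simple process on \<open>[a,b]\<close> is given by a partition \<open>a = \<tau> 0 \<le> \<dots> \<le> \<tau> n = b\<close> and bounded
  values \<open>\<phi> i\<close> on \<open>(\<tau> i, \<tau> (i+1)]\<close> that are known at time \<open>\<tau> i\<close>.
\<close>

definition simple_data ::
  "'w measure \<Rightarrow> (real \<Rightarrow> 'w measure) \<Rightarrow> real \<Rightarrow> real \<Rightarrow>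
     nat \<Rightarrow> (nat \<Rightarrow> real) \<Rightarrow> (nat \<Rightarrow> 'w \<Rightarrow> 'h::euclidean_space) \<Rightarrow> bool" where
  "simple_data M F a b n \<tau> \<phi> \<longleftrightarrow> \<tau> 0 = a \<and> \<tau> n = b \<and>
     (\<forall>i<n. \<tau> i \<le> \<tau> (Suc i) \<and> \<phi> i \<in> borel_measurable (F (\<tau> i)) \<and> bounded (\<phi> i ` space M))"

definition simple_process ::
  "nat \<Rightarrow> (nat \<Rightarrow> real) \<Rightarrow> (nat \<Rightarrow> 'w \<Rightarrow> 'h::euclidean_space) \<Rightarrow> real \<Rightarrow> 'w \<Rightarrow> 'h" where
  "simple_process n \<tau> \<phi> s \<omega> = (\<Sum>i<n. indicat_real {\<tau> i<..\<tau> (Suc i)} s *\<^sub>R \<phi> i \<omega>)"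

definition simple_ito ::
  "(real \<Rightarrow> 'w \<Rightarrow> real) \<Rightarrow> nat \<Rightarrow> (nat \<Rightarrow> real) \<Rightarrow> (nat \<Rightarrow> 'w \<Rightarrow> 'h::euclidean_space) \<Rightarrow> 'w \<Rightarrow> 'h" where
  "simple_ito W n \<tau> \<phi> \<omega> = (\<Sum>i<n. (W (\<tau> (Suc i)) \<omega> - W (\<tau> i) \<omega>) *\<^sub>R \<phi> i \<omega>)"

text \<open>
  \<open>X\<close> is (a version of) the Ito integral of \<open>f\<close> with respect to \<open>W\<close> over \<open>[a,b]\<close>: the
  \<open>L\<^sup>2\<close>-limit of the integrals of simple processes that converge to \<open>f\<close> in \<open>L\<^sup>2\<close>.
\<close>

definition has_ito_integral ::
  "'w measure \<Rightarrow> (real \<Rightarrow> 'w measure) \<Rightarrow> (real \<Rightarrow> 'w \<Rightarrow> real) \<Rightarrow> real \<Rightarrow> real \<Rightarrow>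
     (real \<Rightarrow> 'w \<Rightarrow> 'h::euclidean_space) \<Rightarrow> ('w \<Rightarrow> 'h) \<Rightarrow> bool" where
  "has_ito_integral M F W a b f X \<longleftrightarrow>
     (\<lambda>(s, \<omega>). f s \<omega>) \<in> borel_measurable (leb a b \<Otimes>\<^sub>M M) \<and>
     X \<in> borel_measurable M \<and>
     (\<exists>n \<tau> \<phi>. (\<forall>k. simple_data M F a b (n k) (\<tau> k) (\<phi> k)) \<and>
        (\<lambda>k. \<integral>\<^sup>+(s, \<omega>). ennreal ((norm (simple_process (n k) (\<tau> k) (\<phi> k) s \<omega> - f s \<omega>))\<^sup>2)
               \<partial>(leb a b \<Otimes>\<^sub>M M)) \<longlonglongrightarrow> 0 \<and>
        (\<lambda>k. \<integral>\<^sup>+\<omega>. ennreal ((norm (simple_ito W (n k) (\<tau> k) (\<phi> k) \<omega> - X \<omega>))\<^sup>2) \<partial>M) \<longlonglongrightarrow> 0)"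

end

theory Submission
  imports Defs
begin

text \<open>
  Both identities come from testing the equation for \<open>\<xi>(t)\<close> with a random variable
  \<open>K = v\<^sub>0 + \<integral>\<^sub>0\<^sup>T g dW\<close>, where \<open>v\<^sub>0\<close> is known at time \<open>0\<close>.  Let \<open>V = v\<^sub>0 + \<integral>\<^sub>0\<^sup>t g dW\<close> be the part of \<open>K\<close> known
  at time \<open>t\<close>.  By the Ito isometry and the defining property of conditional expectations,

    \<open>E\<langle>\<xi>(t),K\<rangle> = E\<langle>\<alpha>(t),V\<rangle> + \<integral>\<^sub>0\<^sup>t E\<langle>\<xi>(s), A(s,t)V + B(s,t)g(s)\<rangle>ds + \<integral>\<^sub>0\<^sup>T E\<langle>\<beta>(t,s),g(s)\<rangle>ds + \<integral>\<^sub>t\<^sup>T E\<langle>\<xi>(t),D(t,s)g(s)\<rangle>ds\<close>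

  (lemma \<open>duality_at\<close>): the drift and \<open>\<alpha>(t)\<close> are known at time \<open>t\<close> and hence orthogonal to
  \<open>\<integral>\<^sub>t\<^sup>T g dW\<close>, and inside an isometry integral at time \<open>s\<close> the operator \<open>E\<^sub>s\<close> may be dropped because
  \<open>g(s)\<close>, and \<open>D(t,s)g(s)\<close>, are known at time \<open>s\<close>.

  For the first identity, \<open>K = \<Theta>\<close> at \<open>t = T\<close> turns \<open>E\<langle>\<xi>(T),\<Theta>\<rangle>\<close> into the required terms plus
  \<open>\<integral>\<^sub>0\<^sup>T E\<langle>\<xi>(t), A(t,T)\<Theta> + B(t,T)\<nu>(t)\<rangle>dt\<close>.  For almost every \<open>t\<close>, \<open>K = Y(t) + \<integral>\<^sub>t\<^sup>T Z(t,s)dW(s)\<close> is a constant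
  plus \<open>\<integral>\<^sub>0\<^sup>T Z(t,s)dW(s)\<close> because \<open>(Y,Z)\<close> is an M-solution, while the equation of \<open>Y\<close> expresses \<open>K\<close> through
  \<open>\<psi>(t)\<close>, \<open>\<Theta>\<close>, \<open>\<nu>\<close> and an integral over \<open>[t,T]\<close>.  Integrating over \<open>t\<close> and exchanging the order of
  integration on the triangle \<open>t \<le> s\<close> cancels everything else
  (\<open>integral_triangle_swap\<close>, \<open>duality_terminal_and_free_term\<close>).

  For the second identity, \<open>K = Y'(0) + \<integral>\<^sub>0\<^sup>T Z'(0,s)dW(s)\<close> at \<open>t = 0\<close> suffices (\<open>duality_initial\<close>).  Two
  points need care there: adaptedness of the coefficients at the single first time \<open>0\<close> follows from
  continuity in that time (\<open>coefficient_adapted_at_0\<close>), and \<open>\<langle>Y'(0),\<alpha>(0)\<rangle>\<close> equals its mean because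
  \<open>F 0\<close> is trivial (\<open>F_0_trivial\<close>).
\<close>

section \<open>Square-integrable functions\<close>

definition sq_integrable :: "'a measure \<Rightarrow> ('a \<Rightarrow> 'h::euclidean_space) \<Rightarrow> bool" where
  "sq_integrable N f \<longleftrightarrow> f \<in> borel_measurable N \<and> integrable N (\<lambda>x. (norm (f x))\<^sup>2)"

lemma sq_integrable_measurable: "sq_integrable N f \<Longrightarrow> f \<in> borel_measurable N"
  by (simp add: sq_integrable_def)

lemma sq_integrable_bound:
  assumes "f \<in> borel_measurable N" "integrable N g"
    "AE x in N. (norm (f x))\<^sup>2 \<le> g x"
  shows "sq_integrable N f"
  unfolding sq_integrable_def
proof (intro conjI assms(1))
  note [measurable] = assms(1)
  show "integrable N (\<lambda>x. (norm (f x))\<^sup>2)"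
  proof (rule Bochner_Integration.integrable_bound[OF assms(2)])
    show "(\<lambda>x. (norm (f x))\<^sup>2) \<in> borel_measurable N" by measurable
    show "AE x in N. norm ((norm (f x))\<^sup>2) \<le> norm (g x)"
      using assms(3) by eventually_elim auto
  qed
qed

lemma sq_integrable_iff_nn_integral:
  "sq_integrable N f \<longleftrightarrow>
     f \<in> borel_measurable N \<and> (\<integral>\<^sup>+x. ennreal ((norm (f x))\<^sup>2) \<partial>N) < \<infinity>"
  unfolding sq_integrable_def by (auto simp: integrable_iff_bounded)

lemma norm_add_sq_le: "(norm (a + b))\<^sup>2 \<le> 2 * (norm a)\<^sup>2 + 2 * (norm b)\<^sup>2"
  for a b :: "'h::real_inner"
proof -
  have "2 * (norm a)\<^sup>2 + 2 * (norm b)\<^sup>2 - (norm (a + b))\<^sup>2 = (norm (a - b))\<^sup>2"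
    unfolding power2_norm_eq_inner by (simp add: inner_simps inner_commute)
  then show ?thesis by (smt (verit) zero_le_power2)
qed

lemma sq_integrable_add:
  assumes "sq_integrable N f" "sq_integrable N g"
  shows "sq_integrable N (\<lambda>x. f x + g x)"
proof (rule sq_integrable_bound)
  note [measurable] = assms[THEN sq_integrable_measurable]
  show "(\<lambda>x. f x + g x) \<in> borel_measurable N" by measurable
  show "integrable N (\<lambda>x. 2 * (norm (f x))\<^sup>2 + 2 * (norm (g x))\<^sup>2)"
    using assms by (simp add: sq_integrable_def)
  have "(norm (f x + g x))\<^sup>2 \<le> 2 * (norm (f x))\<^sup>2 + 2 * (norm (g x))\<^sup>2" for x
    by (rule norm_add_sq_le)
  then show "AE x in N. (norm (f x + g x))\<^sup>2 \<le> 2 * (norm (f x))\<^sup>2 + 2 * (norm (g x))\<^sup>2"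
    by simp
qed

lemma sq_integrable_minus:
  "sq_integrable N f \<Longrightarrow> sq_integrable N (\<lambda>x. - f x)"
  unfolding sq_integrable_def by simp

lemma sq_integrable_diff:
  assumes "sq_integrable N f" "sq_integrable N g"
  shows "sq_integrable N (\<lambda>x. f x - g x)"
  using sq_integrable_add[OF assms(1) sq_integrable_minus[OF assms(2)]] by simp

lemma sq_integrable_cong_AE:
  assumes "AE x in N. f x = g x" "f \<in> borel_measurable N" "sq_integrable N g"
  shows "sq_integrable N f"
  using assms(3) by (intro sq_integrable_bound[OF assms(2)]) (use assms(1) in \<open>auto simp: sq_integrable_def\<close>)

lemma sq_integrable_inner:
  assumes "sq_integrable N f" "sq_integrable N g"
  shows "integrable N (\<lambda>x. f x \<bullet> g x)"
proof (rule Bochner_Integration.integrable_bound)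
  note [measurable] = assms[THEN sq_integrable_measurable]
  show "(\<lambda>x. f x \<bullet> g x) \<in> borel_measurable N" by measurable
  show "integrable N (\<lambda>x. (norm (f x))\<^sup>2 + (norm (g x))\<^sup>2)"
    using assms by (simp add: sq_integrable_def)
  have "\<bar>f x \<bullet> g x\<bar> \<le> (norm (f x))\<^sup>2 + (norm (g x))\<^sup>2" for x
  proof -
    have "2 * (norm (f x) * norm (g x)) \<le> (norm (f x))\<^sup>2 + (norm (g x))\<^sup>2"
      using sum_squares_bound[of "norm (f x)" "norm (g x)"] by (simp add: mult.assoc)
    moreover have "0 \<le> norm (f x) * norm (g x)" by simp
    ultimately show ?thesis using Cauchy_Schwarz_ineq2[of "f x" "g x"] by linarith
  qed
  then show "AE x in N. norm (f x \<bullet> g x) \<le> norm ((norm (f x))\<^sup>2 + (norm (g x))\<^sup>2)"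
    by (auto intro!: AE_I2)
qed

lemma (in finite_measure) sq_integrable_imp_integrable:
  fixes f :: "'a \<Rightarrow> 'h::euclidean_space"
  assumes "sq_integrable M f"
  shows "integrable M f"
proof (rule Bochner_Integration.integrable_bound)
  show "f \<in> borel_measurable M" using assms by (rule sq_integrable_measurable)
  show "integrable M (\<lambda>x. 1 + (norm (f x))\<^sup>2)"
    using assms by (simp add: sq_integrable_def)
  have "norm (f x) \<le> 1 + (norm (f x))\<^sup>2" for x
    using sum_squares_bound[of 1 "norm (f x)"] norm_ge_zero[of "f x"] by (simp del: norm_ge_zero)
  then show "AE x in M. norm (f x) \<le> norm (1 + (norm (f x))\<^sup>2)"
    by (auto intro!: AE_I2)
qed

lemma integral_inner_Cauchy_Schwarz:
  assumes f: "sq_integrable N f" and g: "sq_integrable N g"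
  shows "\<bar>LINT x|N. f x \<bullet> g x\<bar> \<le> sqrt (LINT x|N. (norm (f x))\<^sup>2) * sqrt (LINT x|N. (norm (g x))\<^sup>2)"
proof -
  note [measurable] = f[THEN sq_integrable_measurable] g[THEN sq_integrable_measurable]
  have fi: "integrable N (\<lambda>x. (norm (f x))\<^sup>2)" and gi: "integrable N (\<lambda>x. (norm (g x))\<^sup>2)"
    using f g by (auto simp: sq_integrable_def)
  have int: "integrable N (\<lambda>x. f x \<bullet> g x)" by (rule sq_integrable_inner[OF f g])
  have nn: "ennreal \<bar>LINT x|N. f x \<bullet> g x\<bar> \<le> (\<integral>\<^sup>+x. ennreal (norm (f x)) * ennreal (norm (g x)) \<partial>N)"
  proof -
    have "ennreal (norm (LINT x|N. f x \<bullet> g x)) \<le> (\<integral>\<^sup>+x. ennreal (norm (f x \<bullet> g x)) \<partial>N)"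
      using int by (rule integral_norm_bound_ennreal)
    also have "\<dots> \<le> (\<integral>\<^sup>+x. ennreal (norm (f x)) * ennreal (norm (g x)) \<partial>N)"
      by (intro nn_integral_mono) (simp add: ennreal_mult[symmetric] Cauchy_Schwarz_ineq2 ennreal_leI)
    finally show ?thesis by simp
  qed
  have "(ennreal \<bar>LINT x|N. f x \<bullet> g x\<bar>)\<^sup>2 \<le> (\<integral>\<^sup>+x. ennreal (norm (f x)) * ennreal (norm (g x)) \<partial>N)\<^sup>2"
    using nn by (rule power_mono) simp
  also have "\<dots> \<le> (\<integral>\<^sup>+x. (ennreal (norm (f x)))\<^sup>2 \<partial>N) * (\<integral>\<^sup>+x. (ennreal (norm (g x)))\<^sup>2 \<partial>N)"
    by (rule Cauchy_Schwarz_nn_integral) auto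
  also have "\<dots> = ennreal (LINT x|N. (norm (f x))\<^sup>2) * ennreal (LINT x|N. (norm (g x))\<^sup>2)"
    using nn_integral_eq_integral[OF fi] nn_integral_eq_integral[OF gi] by (simp add: ennreal_power)
  finally have "\<bar>LINT x|N. f x \<bullet> g x\<bar>\<^sup>2 \<le> (LINT x|N. (norm (f x))\<^sup>2) * (LINT x|N. (norm (g x))\<^sup>2)"
    by (simp add: ennreal_power ennreal_mult[symmetric])
  then have "sqrt (\<bar>LINT x|N. f x \<bullet> g x\<bar>\<^sup>2)
      \<le> sqrt ((LINT x|N. (norm (f x))\<^sup>2) * (LINT x|N. (norm (g x))\<^sup>2))"
    by (rule real_sqrt_le_mono)
  then show ?thesis by (simp add: real_sqrt_mult)
qed

lemma tendsto_sq_integrable: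
  assumes f: "\<And>k. sq_integrable N (f k)" and u: "u \<in> borel_measurable N"
    and lim: "(\<lambda>k. \<integral>\<^sup>+x. ennreal ((norm (f k x - u x))\<^sup>2) \<partial>N) \<longlonglongrightarrow> 0"
  shows "sq_integrable N u"
    and "(\<lambda>k. LINT x|N. (norm (f k x - u x))\<^sup>2) \<longlonglongrightarrow> 0"
proof -
  note [measurable] = f[THEN sq_integrable_measurable] u
  have "eventually (\<lambda>k. (\<integral>\<^sup>+x. ennreal ((norm (f k x - u x))\<^sup>2) \<partial>N) < 1) sequentially"
    using order_tendstoD(2)[OF lim, of 1] by simp
  then obtain k where k: "(\<integral>\<^sup>+x. ennreal ((norm (f k x - u x))\<^sup>2) \<partial>N) < 1"
    using eventually_happens'[OF sequentially_bot] by auto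
  have "sq_integrable N (\<lambda>x. f k x - u x)"
    unfolding sq_integrable_iff_nn_integral
    using less_trans[OF k ennreal_one_less_top] by (auto simp: infinity_ennreal_def)
  from sq_integrable_diff[OF f[of k] this] show u2: "sq_integrable N u" by simp
  have "(\<lambda>k. ennreal (LINT x|N. (norm (f k x - u x))\<^sup>2)) \<longlonglongrightarrow> ennreal 0"
    using lim sq_integrable_diff[OF f u2]
    by (simp add: nn_integral_eq_integral sq_integrable_def)
  then show "(\<lambda>k. LINT x|N. (norm (f k x - u x))\<^sup>2) \<longlonglongrightarrow> 0"
    by (subst (asm) tendsto_ennreal_iff) auto
qed

text \<open>
  The error of the inner product is \<open>(f\<^sub>k - u) \<bullet> (g\<^sub>k - v) + (f\<^sub>k - u) \<bullet> v + u \<bullet> (g\<^sub>k - v)\<close>, and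
  Cauchy-Schwarz bounds each summand by a product with a factor tending to \<open>0\<close>.
\<close>

lemma tendsto_integral_inner:
  assumes f: "\<And>k. sq_integrable N (f k)" and u: "u \<in> borel_measurable N"
    and fu: "(\<lambda>k. \<integral>\<^sup>+x. ennreal ((norm (f k x - u x))\<^sup>2) \<partial>N) \<longlonglongrightarrow> 0"
    and g: "\<And>k. sq_integrable N (g k)" and v: "v \<in> borel_measurable N"
    and gv: "(\<lambda>k. \<integral>\<^sup>+x. ennreal ((norm (g k x - v x))\<^sup>2) \<partial>N) \<longlonglongrightarrow> 0"
  shows "(\<lambda>k. LINT x|N. f k x \<bullet> g k x) \<longlonglongrightarrow> (LINT x|N. u x \<bullet> v x)"
proof -
  note u2 = tendsto_sq_integrable(1)[OF f u fu] and v2 = tendsto_sq_integrable(1)[OF g v gv]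
  note fl = tendsto_sq_integrable(2)[OF f u fu] and gl = tendsto_sq_integrable(2)[OF g v gv]
  let ?n = "\<lambda>h. sqrt (LINT x|N. (norm (h x))\<^sup>2)"
  have df: "sq_integrable N (\<lambda>x. f k x - u x)" and dg: "sq_integrable N (\<lambda>x. g k x - v x)" for k
    by (auto intro!: sq_integrable_diff f g u2 v2)
  have eq: "(LINT x|N. f k x \<bullet> g k x) - (LINT x|N. u x \<bullet> v x)
     = (LINT x|N. (f k x - u x) \<bullet> (g k x - v x)) + (LINT x|N. (f k x - u x) \<bullet> v x)
       + (LINT x|N. u x \<bullet> (g k x - v x))" for k
  proof -
    have "(LINT x|N. (f k x - u x) \<bullet> (g k x - v x)) + (LINT x|N. (f k x - u x) \<bullet> v x)
       + (LINT x|N. u x \<bullet> (g k x - v x))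
      = (LINT x|N. ((f k x - u x) \<bullet> (g k x - v x) + (f k x - u x) \<bullet> v x)
       + u x \<bullet> (g k x - v x))"
      using sq_integrable_inner[OF df dg] sq_integrable_inner[OF df v2] sq_integrable_inner[OF u2 dg]
      by simp
    also have "\<dots> = (LINT x|N. f k x \<bullet> g k x - u x \<bullet> v x)"
      by (intro Bochner_Integration.integral_cong refl) (simp add: inner_diff_left inner_diff_right)
    finally show ?thesis using sq_integrable_inner[OF f g] sq_integrable_inner[OF u2 v2] by simp
  qed
  have "(\<lambda>k. (LINT x|N. f k x \<bullet> g k x) - (LINT x|N. u x \<bullet> v x)) \<longlonglongrightarrow> 0"
  proof (rule Lim_null_comparison)
    show "eventually (\<lambda>k. norm ((LINT x|N. f k x \<bullet> g k x) - (LINT x|N. u x \<bullet> v x))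
      \<le> ?n (\<lambda>x. f k x - u x) * ?n (\<lambda>x. g k x - v x) + ?n (\<lambda>x. f k x - u x) * ?n v
        + ?n u * ?n (\<lambda>x. g k x - v x)) sequentially"
    proof (intro always_eventually allI)
      fix k
      show "norm ((LINT x|N. f k x \<bullet> g k x) - (LINT x|N. u x \<bullet> v x))
      \<le> ?n (\<lambda>x. f k x - u x) * ?n (\<lambda>x. g k x - v x) + ?n (\<lambda>x. f k x - u x) * ?n v
        + ?n u * ?n (\<lambda>x. g k x - v x)"
        unfolding eq real_norm_def
        using integral_inner_Cauchy_Schwarz[OF df dg, of k k] integral_inner_Cauchy_Schwarz[OF df v2, of k]
          integral_inner_Cauchy_Schwarz[OF u2 dg, of k]
        by linarith
    qed
    have "(\<lambda>k. ?n (\<lambda>x. f k x - u x)) \<longlonglongrightarrow> 0" "(\<lambda>k. ?n (\<lambda>x. g k x - v x)) \<longlonglongrightarrow> 0"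
      using tendsto_real_sqrt[OF fl] tendsto_real_sqrt[OF gl] by auto
    then have "(\<lambda>k. ?n (\<lambda>x. f k x - u x) * ?n (\<lambda>x. g k x - v x) + ?n (\<lambda>x. f k x - u x) * ?n v
        + ?n u * ?n (\<lambda>x. g k x - v x)) \<longlonglongrightarrow> 0 * 0 + 0 * ?n v + ?n u * 0"
      by (intro tendsto_intros)
    then show "(\<lambda>k. ?n (\<lambda>x. f k x - u x) * ?n (\<lambda>x. g k x - v x) + ?n (\<lambda>x. f k x - u x) * ?n v
        + ?n u * ?n (\<lambda>x. g k x - v x)) \<longlonglongrightarrow> 0" by simp
  qed
  then show ?thesis by (simp add: LIM_zero_iff)
qed

text \<open>
  Near each \<open>t\<close> the norm exceeds that of \<open>X t\<close> in a controlled way, so it is locally bounded and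
  compactness of the time interval gives a uniform bound.  This is what makes elements of
  \<open>C([0,T]; L\<^sup>2)\<close> square-integrable jointly in time and scenario.
\<close>

lemma bounded_C_L2_norm:
  fixes X :: "real \<Rightarrow> 'a \<Rightarrow> 'h::euclidean_space"
  assumes X: "\<And>t. t \<in> {0..T} \<Longrightarrow> sq_integrable N (X t)"
    and cont: "\<And>t. t \<in> {0..T} \<Longrightarrow>
      ((\<lambda>r. LINT w|N. (norm (X r w - X t w))\<^sup>2) \<longlongrightarrow> 0) (at t within {0..T})"
  obtains C where "\<And>t. t \<in> {0..T} \<Longrightarrow> (LINT w|N. (norm (X t w))\<^sup>2) \<le> C"
proof -
  let ?g = "\<lambda>r. LINT w|N. (norm (X r w))\<^sup>2"
  have loc: "\<exists>C. eventually (\<lambda>r. ?g r \<le> C) (at t within {0..T})" if t: "t \<in> {0..T}" for t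
  proof -
    have "eventually (\<lambda>r. (LINT w|N. (norm (X r w - X t w))\<^sup>2) < 1) (at t within {0..T})"
      using order_tendstoD(2)[OF cont[OF t], of 1] by simp
    moreover have "eventually (\<lambda>r. r \<in> {0..T}) (at t within {0..T})"
      by (simp add: eventually_at_filter)
    ultimately have "eventually (\<lambda>r. ?g r \<le> 2 + 2 * ?g t) (at t within {0..T})"
    proof eventually_elim
      case (elim r)
      note d = sq_integrable_diff[OF X[OF elim(2)] X[OF t]]
      have "?g r \<le> (LINT w|N. 2 * (norm (X r w - X t w))\<^sup>2 + 2 * (norm (X t w))\<^sup>2)"
      proof (rule integral_mono)
        show "integrable N (\<lambda>w. (norm (X r w))\<^sup>2)" using X[OF elim(2)] by (simp add: sq_integrable_def)
        show "integrable N (\<lambda>w. 2 * (norm (X r w - X t w))\<^sup>2 + 2 * (norm (X t w))\<^sup>2)"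
          using d X[OF t] by (simp add: sq_integrable_def)
        show "(norm (X r w))\<^sup>2 \<le> 2 * (norm (X r w - X t w))\<^sup>2 + 2 * (norm (X t w))\<^sup>2" for w
          using norm_add_sq_le[of "X r w - X t w" "X t w"] by simp
      qed
      also have "\<dots> = 2 * (LINT w|N. (norm (X r w - X t w))\<^sup>2) + 2 * ?g t"
        using d X[OF t] by (simp add: sq_integrable_def)
      finally show ?case using elim(1) by linarith
    qed
    then show ?thesis by blast
  qed
  have "\<exists>C. \<forall>t\<in>{0..T}. ?g t \<le> C"
  proof (rule ccontr)
    assume "\<nexists>C. \<forall>t\<in>{0..T}. ?g t \<le> C"
    then have "\<forall>n::nat. \<exists>t\<in>{0..T}. real n < ?g t" by (meson not_le)
    then obtain r where r: "\<And>n. r n \<in> {0..T}" "\<And>n::nat. real n < ?g (r n)" by metis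
    obtain t \<phi> where t: "t \<in> {0..T}" "strict_mono \<phi>" "(r \<circ> \<phi>) \<longlonglongrightarrow> t"
      using compact_Icc[of 0 T] r(1) unfolding compact_def by metis
    obtain C where "eventually (\<lambda>r. ?g r \<le> C) (at t within {0..T})" using loc[OF t(1)] by blast
    then have "eventually (\<lambda>s. s \<in> {0..T} \<longrightarrow> ?g s \<le> max C (?g t)) (nhds t)"
      unfolding eventually_at_filter by eventually_elim (auto simp: le_max_iff_disj)
    with t(3) have "eventually (\<lambda>n. r (\<phi> n) \<in> {0..T} \<longrightarrow> ?g (r (\<phi> n)) \<le> max C (?g t)) sequentially"
      unfolding filterlim_iff by fastforce
    moreover have "eventually (\<lambda>n. n \<ge> nat \<lceil>max C (?g t)\<rceil>) sequentially" by (rule eventually_ge_at_top)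
    ultimately have "eventually (\<lambda>n::nat. False) sequentially"
    proof eventually_elim
      case (elim n)
      have "real n \<le> real (\<phi> n)" using seq_suble[OF t(2)] by simp
      also have "\<dots> < ?g (r (\<phi> n))" by (rule r(2))
      also have "\<dots> \<le> max C (?g t)" using elim(1) r(1) by blast
      also have "\<dots> \<le> real n" using elim(2) by linarith
      finally show ?case by simp
    qed
    then show False by simp
  qed
  with that show thesis by blast
qed

lemma norm_matrix_vector_le: "norm (A *v x) \<le> norm A * norm x"
  for A :: "real^'n^'m"
proof -
  have "norm (A *v x) \<le> L2_set (\<lambda>i. norm (A $ i) * norm x) UNIV"
  proof -
    have "norm (A *v x) = L2_set (\<lambda>i. \<bar>A $ i \<bullet> x\<bar>) UNIV"
      by (simp add: norm_vec_def matrix_mult_dot)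
    also have "\<dots> \<le> L2_set (\<lambda>i. norm (A $ i) * norm x) UNIV"
      by (rule L2_set_mono) (auto simp: Cauchy_Schwarz_ineq2)
    finally show ?thesis .
  qed
  also have "\<dots> = norm A * norm x"
    unfolding norm_vec_def[of A] by (simp add: L2_set_left_distrib)
  finally show ?thesis .
qed

lemma norm_transpose: "norm (transpose A) = norm A" for A :: "real^'n^'m"
  unfolding norm_vec_def L2_set_def transpose_def
  by (simp add: sum_nonneg) (rule sum.swap)

lemma transpose_mult_inner: "(transpose A *v x) \<bullet> y = x \<bullet> (A *v y)" for A :: "real^'n^'m"
  by (metis dot_lmul_matrix transpose_matrix_vector)

lemma borel_measurable_matrix_vector_mult [measurable (raw)]:
  fixes A :: "'a \<Rightarrow> real^'n^'m"
  assumes [measurable]: "A \<in> borel_measurable N" "x \<in> borel_measurable N"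
  shows "(\<lambda>w. A w *v x w) \<in> borel_measurable N"
proof (subst borel_measurable_euclidean_space, intro ballI)
  fix b :: "real^'m" assume "b \<in> Basis"
  then obtain i where b: "b = axis i 1" by (auto simp: Basis_vec_def)
  have "(\<lambda>w. (A w *v x w) \<bullet> b) = (\<lambda>w. \<Sum>j\<in>UNIV. A w $ i $ j * x w $ j)"
    by (auto simp: b inner_axis matrix_vector_mult_def)
  also have "\<dots> \<in> borel_measurable N"
  proof (intro borel_measurable_sum borel_measurable_times)
    fix j
    have "(\<lambda>w. A w \<bullet> axis i (axis j 1)) \<in> borel_measurable N"
         "(\<lambda>w. x w \<bullet> axis j 1) \<in> borel_measurable N"
      by measurable
    then show "(\<lambda>w. A w $ i $ j) \<in> borel_measurable N" "(\<lambda>w. x w $ j) \<in> borel_measurable N"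
      by (simp_all add: inner_axis)
  qed
  finally show "(\<lambda>w. (A w *v x w) \<bullet> b) \<in> borel_measurable N" .
qed

lemma borel_measurable_transpose [measurable (raw)]:
  fixes A :: "'a \<Rightarrow> real^'n^'m"
  assumes [measurable]: "A \<in> borel_measurable N"
  shows "(\<lambda>w. transpose (A w)) \<in> borel_measurable N"
proof (subst borel_measurable_euclidean_space, intro ballI)
  fix b :: "real^'m^'n" assume "b \<in> Basis"
  then obtain i j where b: "b = axis i (axis j 1)" by (auto simp: Basis_vec_def)
  have "(\<lambda>w. transpose (A w) \<bullet> b) = (\<lambda>w. A w \<bullet> axis j (axis i 1))"
    by (auto simp: b inner_axis transpose_def)
  also have "\<dots> \<in> borel_measurable N" by measurable
  finally show "(\<lambda>w. transpose (A w) \<bullet> b) \<in> borel_measurable N" .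
qed

lemma sq_integrable_matrix_vector:
  fixes A :: "'a \<Rightarrow> real^'n^'m"
  assumes A: "A \<in> borel_measurable N" "AE x in N. norm (A x) \<le> K"
    and f: "sq_integrable N f"
  shows "sq_integrable N (\<lambda>x. A x *v f x)"
proof (rule sq_integrable_bound)
  note [measurable] = A(1) sq_integrable_measurable[OF f]
  show "(\<lambda>x. A x *v f x) \<in> borel_measurable N" by measurable
  show "integrable N (\<lambda>x. K\<^sup>2 * (norm (f x))\<^sup>2)"
    using f by (simp add: sq_integrable_def)
  show "AE x in N. (norm (A x *v f x))\<^sup>2 \<le> K\<^sup>2 * (norm (f x))\<^sup>2"
    using A(2)
  proof eventually_elim
    case (elim x)
    have "norm (A x *v f x) \<le> K * norm (f x)"
      using norm_matrix_vector_le[of "A x" "f x"] elim by (meson mult_right_mono norm_ge_zero order_trans)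
    then have "(norm (A x *v f x))\<^sup>2 \<le> (K * norm (f x))\<^sup>2" by (rule power_mono) simp
    then show ?case by (simp add: power_mult_distrib)
  qed
qed

section \<open>Brownian increments are independent of the augmented past\<close>

locale wiener_space = prob_space M + complete_measure M
  for M :: "'w measure" +
  fixes T :: real and W :: "real \<Rightarrow> 'w \<Rightarrow> real" and F :: "real \<Rightarrow> 'w measure"
  assumes T_pos: "T > 0"
    and wiener: "wiener_process M T W"
    and filtration: "F = augmented_filtration M W"
begin

lemma W_measurable: "0 \<le> r \<Longrightarrow> r \<le> T \<Longrightarrow> W r \<in> borel_measurable M"
  using wiener by (auto simp: wiener_process_def)

lemma generator_subset: "past_events M W t \<union> null_sets M \<subseteq> Pow (space M)"
  using sets.sets_into_space by (auto simp: past_events_def)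

lemma space_F [simp]: "space (F t) = space M"
  by (simp add: filtration augmented_filtration_def space_measure_of_conv)

lemma sets_F: "sets (F t) = sigma_sets (space M) (past_events M W t \<union> null_sets M)"
  using generator_subset by (simp add: filtration augmented_filtration_def)

lemma sets_F_mono: "s \<le> t \<Longrightarrow> sets (F s) \<subseteq> sets (F t)"
  unfolding sets_F
proof (rule sigma_sets_mono')
  assume "s \<le> t"
  then have "past_events M W s \<subseteq> past_events M W t"
    unfolding past_events_def by (blast intro: order_trans)
  then show "past_events M W s \<union> null_sets M \<subseteq> past_events M W t \<union> null_sets M" by blast
qed

lemma null_sets_in_F: "N \<in> null_sets M \<Longrightarrow> N \<in> sets (F t)"
  unfolding sets_F by auto

lemma past_events_events: "t \<le> T \<Longrightarrow> past_events M W t \<subseteq> events"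
  by (auto simp: past_events_def intro!: measurable_sets[OF W_measurable])

lemma sets_F_events: "t \<le> T \<Longrightarrow> sets (F t) \<subseteq> events"
  unfolding sets_F using past_events_events by (intro sets.sigma_sets_subset) auto

lemma subalgebra_F: "t \<le> T \<Longrightarrow> subalgebra M (F t)"
  by (simp add: subalgebra_def sets_F_events)

lemma measurable_F_mono: "f \<in> measurable (F s) N \<Longrightarrow> s \<le> t \<Longrightarrow> f \<in> measurable (F t) N"
  using sets_F_mono[of s t] by (auto simp: measurable_def)

lemma measurable_F_M: "f \<in> measurable (F t) N \<Longrightarrow> t \<le> T \<Longrightarrow> f \<in> measurable M N"
  using sets_F_events[of t] by (auto simp: measurable_def)

lemma W_F_measurable: "0 \<le> r \<Longrightarrow> r \<le> t \<Longrightarrow> W r \<in> borel_measurable (F t)"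
proof (rule measurableI)
  fix S :: "real set" assume "0 \<le> r" "r \<le> t" "S \<in> sets borel"
  then have "W r -` S \<inter> space M \<in> past_events M W t"
    by (auto simp: past_events_def)
  then show "W r -` S \<inter> space (F t) \<in> sets (F t)" by (auto simp: sets_F)
qed simp

text \<open>
  Versions may be exchanged freely: every set on which \<open>f\<close> and \<open>g\<close> differ is null and therefore
  belongs to each \<open>F t\<close>, by completeness and augmentation.
\<close>

lemma F_measurable_cong_AE:
  assumes f: "f \<in> measurable (F t) N" and g: "\<And>x. x \<in> space M \<Longrightarrow> g x \<in> space N"
    and eq: "AE x in M. g x = f x"
  shows "g \<in> measurable (F t) N"
proof (rule measurableI)
  from eq obtain Z where Z: "Z \<in> null_sets M" "{x \<in> space M. \<not> (g x = f x)} \<subseteq> Z"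
    by (auto elim!: AE_E simp: null_sets_def)
  fix S assume S: "S \<in> sets N"
  have eq: "g -` S \<inter> space M = (f -` S \<inter> space M - Z) \<union> (g -` S \<inter> space M \<inter> Z)"
    using Z(2) by auto
  have 1: "f -` S \<inter> space M - Z \<in> sets (F t)"
    using measurable_sets[OF f S] null_sets_in_F[OF Z(1)] by auto
  have 2: "g -` S \<inter> space M \<inter> Z \<in> sets (F t)"
    using complete2[OF _ Z(1)] by (intro null_sets_in_F) auto
  from sets.Un[OF 1 2] show "g -` S \<inter> space (F t) \<in> sets (F t)"
    unfolding eq[symmetric] space_F .
qed (use g in auto)

definition increment :: "real \<Rightarrow> real \<Rightarrow> 'w \<Rightarrow> real" where
  "increment s t w = W t w - W s w"

lemma increment_measurable:
  assumes "0 \<le> s" "s \<le> t" shows "increment s t \<in> borel_measurable (F t)"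
  unfolding increment_def[abs_def] using assms
  by (intro borel_measurable_diff W_F_measurable) auto

lemma increment_measurable_M:
  assumes "0 \<le> s" "s \<le> t" "t \<le> T" shows "increment s t \<in> borel_measurable M"
  using increment_measurable[of s t] measurable_F_M assms by blast

lemma increment_refl [simp]: "increment s s w = 0"
  by (simp add: increment_def)

text \<open>
  Augmentation changes an event only by a null set, so independence of the increments passes from
  the natural filtration, for which it is assumed, to \<open>F\<close>.
\<close>

lemma F_event_approx:
  assumes "A \<in> sets (F s)" "s \<le> T"
  shows "\<exists>A'\<in>sigma_sets (space M) (past_events M W s). AE x in M. x \<in> A \<longleftrightarrow> x \<in> A'"
  using assms(1) unfolding sets_F
proof (induction rule: sigma_sets.induct)
  case (Basic a)
  then show ?case
  proof
    assume "a \<in> past_events M W s"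
    then show ?thesis by (intro bexI[of _ a]) auto
  next
    assume "a \<in> null_sets M"
    then have "AE x in M. x \<in> a \<longleftrightarrow> x \<in> {}" using AE_not_in by auto
    then show ?thesis by (intro bexI[of _ "{}"]) (auto intro: sigma_sets.Empty)
  qed
next
  case Empty
  show ?case by (intro bexI[of _ "{}"]) (auto intro: sigma_sets.Empty)
next
  case (Compl a)
  then obtain A' where A': "A' \<in> sigma_sets (space M) (past_events M W s)" "AE x in M. x \<in> a \<longleftrightarrow> x \<in> A'"
    by blast
  have "AE x in M. x \<in> space M - a \<longleftrightarrow> x \<in> space M - A'"
    using A'(2) by eventually_elim auto
  then show ?case using A'(1) by (intro bexI[of _ "space M - A'"]) (auto intro: sigma_sets.Compl)
next
  case (Union a)
  then have "\<forall>i. \<exists>A'\<in>sigma_sets (space M) (past_events M W s). AE x in M. x \<in> a i \<longleftrightarrow> x \<in> A'" by blast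
  then obtain A' where A': "\<And>i::nat. A' i \<in> sigma_sets (space M) (past_events M W s)"
    "\<And>i. AE x in M. x \<in> a i \<longleftrightarrow> x \<in> A' i" by metis
  have "AE x in M. \<forall>i. x \<in> a i \<longleftrightarrow> x \<in> A' i" using A'(2) by (simp add: AE_all_countable)
  then have "AE x in M. x \<in> (\<Union>i. a i) \<longleftrightarrow> x \<in> (\<Union>i. A' i)" by eventually_elim auto
  then show ?case using A'(1) by (intro bexI[of _ "\<Union>i. A' i"]) (auto intro: sigma_sets.Union)
qed

lemma prob_F_event_increment:
  assumes st: "0 \<le> s" "s < t" "t \<le> T" and A: "A \<in> sets (F s)" and S: "S \<in> sets borel"
  shows "prob (A \<inter> (increment s t -` S \<inter> space M)) = prob A * prob (increment s t -` S \<inter> space M)"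
proof -
  let ?B = "increment s t -` S \<inter> space M"
  obtain A' where A': "A' \<in> sigma_sets (space M) (past_events M W s)" "AE x in M. x \<in> A \<longleftrightarrow> x \<in> A'"
    using F_event_approx[OF A] st by auto
  have AM: "A \<in> events" using sets_F_events[of s] A st by auto
  have A'M: "A' \<in> events"
    using A'(1) past_events_events[of s] st sets.sigma_sets_subset[of "past_events M W s" M] by auto
  have B: "?B \<in> events" using measurable_sets[OF increment_measurable_M[of s t] S] st by simp
  have "indep_set (sigma_sets (space M) (past_events M W s))
          {(\<lambda>w. W t w - W s w) -` S \<inter> space M | S. S \<in> sets borel}"
    using wiener st unfolding wiener_process_def by blast
  then have ind: "prob (A' \<inter> ?B) = prob A' * prob ?B"
    using indep_setD[OF _ A'(1), of _ ?B] S unfolding increment_def[abs_def] by blast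
  have "prob (A \<inter> ?B) = prob (A' \<inter> ?B)"
    using A'(2) AM A'M B by (intro finite_measure_eq_AE) auto
  moreover have "prob A = prob A'"
    using A'(2) AM A'M by (intro finite_measure_eq_AE) auto
  ultimately show ?thesis using ind by simp
qed

lemma indep_var_increment:
  fixes G :: "'w \<Rightarrow> real"
  assumes st: "0 \<le> s" "s < t" "t \<le> T" and G: "G \<in> borel_measurable (F s)"
  shows "indep_var borel G borel (increment s t)"
proof -
  have stable: "Int_stable {f -` A \<inter> space M | A. A \<in> sets borel}" for f :: "'w \<Rightarrow> real"
  proof (rule Int_stableI)
    fix a b assume "a \<in> {f -` A \<inter> space M | A. A \<in> sets borel}" "b \<in> {f -` A \<inter> space M | A. A \<in> sets borel}"
    then obtain A B where "A \<in> sets borel" "B \<in> sets borel"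
      "a = f -` A \<inter> space M" "b = f -` B \<inter> space M" by auto
    then have "a \<inter> b = f -` (A \<inter> B) \<inter> space M" "A \<inter> B \<in> sets borel" by auto
    then show "a \<inter> b \<in> {f -` A \<inter> space M | A. A \<in> sets borel}" by blast
  qed
  have GM: "G \<in> borel_measurable M" using measurable_F_M[OF G] st by simp
  have IM: "increment s t \<in> borel_measurable M" using increment_measurable_M st by simp
  show ?thesis
    unfolding indep_var_eq
  proof (intro conjI GM IM indep_set_sigma_sets stable)
    show "indep_set {G -` A \<inter> space M |A. A \<in> sets borel} {increment s t -` A \<inter> space M |A. A \<in> sets borel}"
    proof (rule indep_setI)
      fix a b assume "a \<in> {G -` A \<inter> space M |A. A \<in> sets borel}"
        and b: "b \<in> {increment s t -` A \<inter> space M |A. A \<in> sets borel}"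
      then have "a \<in> sets (F s)" using measurable_sets[OF G] by auto
      with b show "prob (a \<inter> b) = prob a * prob b"
        using prob_F_event_increment[OF st] by auto
    qed (use GM IM in auto)
  qed
qed

lemma increment_moments:
  assumes st: "0 \<le> s" "s \<le> t" "t \<le> T"
  shows "integrable M (increment s t)" "expectation (increment s t) = 0"
    "integrable M (\<lambda>w. (increment s t w)\<^sup>2)" "expectation (\<lambda>w. (increment s t w)\<^sup>2) = t - s"
proof -
  have "integrable M (increment s t) \<and> expectation (increment s t) = 0 \<and>
    integrable M (\<lambda>w. (increment s t w)\<^sup>2) \<and> expectation (\<lambda>w. (increment s t w)\<^sup>2) = t - s"
  proof (cases "s = t")
    case True
    then show ?thesis by (simp add: increment_def[abs_def])
  next
    case False
    with st have "s < t" by simp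
    define \<sigma> where "\<sigma> = sqrt (t - s)"
    have \<sigma>: "0 < \<sigma>" "\<sigma>\<^sup>2 = t - s" using \<open>s < t\<close> by (auto simp: \<sigma>_def)
    have D: "distributed M lborel (increment s t) (normal_density 0 \<sigma>)"
      using wiener st \<open>s < t\<close> unfolding wiener_process_def increment_def[abs_def] \<sigma>_def by blast
    have 1: "integrable M (increment s t)"
      using distributed_integrable[OF D, of "\<lambda>x. x"] integrable_normal_moment_nz_1[OF \<sigma>(1), of 0]
      by simp
    have 2: "integrable M (\<lambda>w. (increment s t w)\<^sup>2)"
      using distributed_integrable[OF D, of "\<lambda>x. x\<^sup>2"] integrable_normal_moment[OF \<sigma>(1), of 0 2]
      by simp
    have 3: "expectation (increment s t) = 0"
      by (rule normal_distributed_expectation[OF \<sigma>(1) D])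
    have 4: "expectation (\<lambda>w. (increment s t w)\<^sup>2) = t - s"
      using normal_distributed_variance[OF \<sigma>(1) D] 3 \<sigma>(2) by simp
    from 1 2 3 4 show ?thesis by simp
  qed
  then show "integrable M (increment s t)" "expectation (increment s t) = 0"
    "integrable M (\<lambda>w. (increment s t w)\<^sup>2)" "expectation (\<lambda>w. (increment s t w)\<^sup>2) = t - s" by auto
qed

lemma expectation_mult_increment:
  assumes st: "0 \<le> s" "s \<le> t" "t \<le> T" and G: "G \<in> borel_measurable (F s)" "integrable M G"
  shows "integrable M (\<lambda>w. G w * increment s t w)" "expectation (\<lambda>w. G w * increment s t w) = 0"
proof -
  have "integrable M (\<lambda>w. G w * increment s t w) \<and> expectation (\<lambda>w. G w * increment s t w) = 0"
  proof (cases "s = t")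
    case False
    then have "indep_var borel G borel (increment s t)" using indep_var_increment[OF _ _ _ G(1), of t] st by simp
    from indep_var_lebesgue_integral[OF this G(2)] indep_var_integrable[OF this G(2)]
    show ?thesis using increment_moments[OF st] by simp
  qed simp
  then show "integrable M (\<lambda>w. G w * increment s t w)" "expectation (\<lambda>w. G w * increment s t w) = 0" by auto
qed

lemma expectation_mult_increment_sq:
  assumes st: "0 \<le> s" "s \<le> t" "t \<le> T" and G: "G \<in> borel_measurable (F s)" "integrable M G"
  shows "integrable M (\<lambda>w. G w * (increment s t w)\<^sup>2)"
    "expectation (\<lambda>w. G w * (increment s t w)\<^sup>2) = (t - s) * expectation G"
proof -
  have "integrable M (\<lambda>w. G w * (increment s t w)\<^sup>2) \<and>
     expectation (\<lambda>w. G w * (increment s t w)\<^sup>2) = (t - s) * expectation G"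
  proof (cases "s = t")
    case False
    then have "indep_var borel G borel (increment s t)" using indep_var_increment[OF _ _ _ G(1), of t] st by simp
    from indep_var_compose[OF this, of "\<lambda>x. x" borel "\<lambda>x. x\<^sup>2" borel]
    have "indep_var borel G borel (\<lambda>w. (increment s t w)\<^sup>2)" by (simp add: comp_def)
    from indep_var_lebesgue_integral[OF this G(2)] indep_var_integrable[OF this G(2)]
    show ?thesis using increment_moments[OF st] by simp
  qed simp
  then show "integrable M (\<lambda>w. G w * (increment s t w)\<^sup>2)"
    "expectation (\<lambda>w. G w * (increment s t w)\<^sup>2) = (t - s) * expectation G" by auto
qed

text \<open>
  The weight times the earlier increment is known when the later increment starts, and the latter
  is independent of it with mean \<open>0\<close>.
\<close>

lemma expectation_disjoint_increments:
  assumes le: "0 \<le> a" "a \<le> b" "b \<le> c" "c \<le> d" "d \<le> T"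
    and G: "G \<in> borel_measurable (F c)" "\<And>w. w \<in> space M \<Longrightarrow> \<bar>G w\<bar> \<le> K"
  shows "integrable M (\<lambda>w. increment a b w * increment c d w * G w)"
    "expectation (\<lambda>w. increment a b w * increment c d w * G w) = 0"
proof -
  have GM[measurable]: "G \<in> borel_measurable M" using measurable_F_M[OF G(1)] le by simp
  have 1: "(\<lambda>w. increment a b w * G w) \<in> borel_measurable (F c)"
    using measurable_F_mono[OF increment_measurable[of a b], of c] G(1) le by simp
  have 2: "integrable M (\<lambda>w. increment a b w * G w)"
  proof (rule Bochner_Integration.integrable_bound)
    have i: "integrable M (increment a b)" using increment_moments(1)[of a b] le by simp
    then show "integrable M (\<lambda>w. K * increment a b w)" by simp
    show "(\<lambda>w. increment a b w * G w) \<in> borel_measurable M" using i by measurable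
    show "AE w in M. norm (increment a b w * G w) \<le> norm (K * increment a b w)"
    proof (rule AE_I2)
      fix w assume "w \<in> space M"
      from G(2)[OF this] have "\<bar>G w\<bar> \<le> \<bar>K\<bar>" by linarith
      then have "\<bar>G w\<bar> * \<bar>increment a b w\<bar> \<le> \<bar>K\<bar> * \<bar>increment a b w\<bar>"
        by (rule mult_right_mono) simp
      then show "norm (increment a b w * G w) \<le> norm (K * increment a b w)"
        by (simp add: abs_mult mult.commute)
    qed
  qed
  have "(\<lambda>w. increment a b w * increment c d w * G w) = (\<lambda>w. (increment a b w * G w) * increment c d w)"
    by (simp add: ac_simps)
  with expectation_mult_increment[OF _ _ _ 1 2, of d] le
  show "integrable M (\<lambda>w. increment a b w * increment c d w * G w)"
    "expectation (\<lambda>w. increment a b w * increment c d w * G w) = 0" by auto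
qed

text \<open>
  With \<open>e = min b d\<close>, cutting both increments at \<open>c\<close> and \<open>e\<close> leaves only products of increments over
  successive intervals, which vanish in mean, and the square of the increment over the overlap
  \<open>(c,e]\<close>.
\<close>

lemma expectation_increments_aux:
  assumes le: "0 \<le> a" "a \<le> b" "b \<le> T" "a \<le> c" "c \<le> d" "d \<le> T"
    and G: "G \<in> borel_measurable (F c)" "\<And>w. w \<in> space M \<Longrightarrow> \<bar>G w\<bar> \<le> K"
  shows "integrable M (\<lambda>w. increment a b w * increment c d w * G w) \<and>
    expectation (\<lambda>w. increment a b w * increment c d w * G w)
      = measure lborel ({a<..b} \<inter> {c<..d}) * expectation G"
proof (cases "b \<le> c")
  case True
  then have empty: "{a<..b} \<inter> {c<..d} = {}" by auto
  show ?thesis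
    unfolding empty using expectation_disjoint_increments[OF le(1,2) True le(5,6) G] by simp
next
  case False
  define e where "e = min b d"
  have e: "c \<le> e" "e \<le> b" "e \<le> d" "e = b \<or> e = d" using False le by (auto simp: e_def)
  have [measurable]: "G \<in> borel_measurable M" using measurable_F_M[OF G(1)] le by simp
  have Gi: "integrable M G"
    by (rule integrable_const_bound[where B=K]) (use G(2) in auto)
  have Ge: "G \<in> borel_measurable (F e)" using measurable_F_mono[OF G(1)] e by simp
  let ?X = "\<lambda>a b c d. \<lambda>w. increment a b w * increment c d w * G w"
  \<comment> \<open>One of the intervals \<open>(e,b]\<close> and \<open>(e,d]\<close> is empty.\<close>
  have z: "?X e b e d w = 0" for w using e(4) by auto
  have sq: "integrable M (?X c e c e)" "expectation (?X c e c e) = (e - c) * expectation G"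
    using expectation_mult_increment_sq[OF _ _ _ G(1) Gi, of e] le e by (auto simp: power2_eq_square ac_simps)
  have 1: "integrable M (?X a c c e)" "expectation (?X a c c e) = 0"
    using expectation_disjoint_increments[OF _ _ _ _ _ G, of a c e] le e by auto
  have 2: "integrable M (?X a c e d)" "expectation (?X a c e d) = 0"
    using expectation_disjoint_increments[OF _ _ _ _ _ Ge G(2), of a c d] le e by auto
  have 3: "integrable M (?X c e e d)" "expectation (?X c e e d) = 0"
    using expectation_disjoint_increments[OF _ _ _ _ _ Ge G(2), of c e d] le e by auto
  have 4: "integrable M (?X c e e b)" "expectation (?X c e e b) = 0"
    using expectation_disjoint_increments[OF _ _ _ _ _ Ge G(2), of c e b] le e by auto
  have eq: "?X a b c d = (\<lambda>w. (((?X a c c e w + ?X a c e d w) + ?X c e c e w) + ?X c e e d w) + ?X c e e b w)"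
  proof
    fix w
    have "increment a b w = increment a c w + increment c e w + increment e b w"
      "increment c d w = increment c e w + increment e d w" by (auto simp: increment_def)
    then have "?X a b c d w = (((?X a c c e w + ?X a c e d w) + ?X c e c e w) + ?X c e e d w) + ?X c e e b w + ?X e b e d w"
      by (simp add: algebra_simps)
    then show "?X a b c d w = (((?X a c c e w + ?X a c e d w) + ?X c e c e w) + ?X c e e d w) + ?X c e e b w"
      unfolding z by simp
  qed
  have "{a<..b} \<inter> {c<..d} = {c<..e}" using le e by (auto simp: e_def)
  then show ?thesis unfolding eq using 1 2 3 4 sq e by simp
qed

text \<open>
  Since the two intervals are arbitrary, the isometry for two simple processes follows term by term,
  and their partitions never have to be refined to a common one.
\<close>

lemma expectation_increments:
  assumes le: "0 \<le> a" "a \<le> b" "b \<le> T" "0 \<le> c" "c \<le> d" "d \<le> T"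
    and G: "G \<in> borel_measurable (F (max a c))" "\<And>w. w \<in> space M \<Longrightarrow> \<bar>G w\<bar> \<le> K"
  shows "integrable M (\<lambda>w. increment a b w * increment c d w * G w)"
    "expectation (\<lambda>w. increment a b w * increment c d w * G w)
      = measure lborel ({a<..b} \<inter> {c<..d}) * expectation G"
proof -
  have "integrable M (\<lambda>w. increment a b w * increment c d w * G w) \<and>
    expectation (\<lambda>w. increment a b w * increment c d w * G w)
      = measure lborel ({a<..b} \<inter> {c<..d}) * expectation G"
  proof (cases "a \<le> c")
    case True
    then show ?thesis using expectation_increments_aux[of a b c d G K] le G by simp
  next
    case False
    then show ?thesis using expectation_increments_aux[of c d a b G K] le G by (simp add: ac_simps Int_commute)
  qed
  then show "integrable M (\<lambda>w. increment a b w * increment c d w * G w)"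
    "expectation (\<lambda>w. increment a b w * increment c d w * G w)
      = measure lborel ({a<..b} \<inter> {c<..d}) * expectation G" by auto
qed

text \<open>
  Almost surely \<open>W 0 = 0\<close>, so every generator of \<open>F 0\<close> is null or has null complement, and these
  sets form a \<open>\<sigma>\<close>-algebra.  Hence \<open>X\<close> stays almost surely on one side of its mean, which forces
  equality.
\<close>

lemma F_0_trivial:
  fixes X :: "'w \<Rightarrow> real"
  assumes X: "X \<in> borel_measurable (F 0)" "integrable M X"
  shows "AE w in M. X w = expectation X"
proof -
  have W0: "AE w in M. W 0 w = 0" using wiener by (simp add: wiener_process_def)
  have 01: "(AE w in M. w \<in> A) \<or> (AE w in M. w \<notin> A)" if "A \<in> sets (F 0)" for A
    using that unfolding sets_F
  proof (induction rule: sigma_sets.induct)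
    case (Basic a)
    then show ?case
    proof
      assume "a \<in> past_events M W 0"
      then obtain S where a: "a = W 0 -` S \<inter> space M" by (auto simp: past_events_def)
      have "AE w in M. w \<in> a \<longleftrightarrow> 0 \<in> S" using W0 AE_space by eventually_elim (auto simp: a)
      then show ?thesis by (cases "0 \<in> S") auto
    next
      assume "a \<in> null_sets M"
      then show ?thesis using AE_not_in by auto
    qed
  next
    case (Compl a)
    from Compl.IH show ?case
    proof
      assume "AE w in M. w \<in> a"
      then have "AE w in M. w \<notin> space M - a" by eventually_elim auto
      then show ?thesis ..
    next
      assume "AE w in M. w \<notin> a"
      then have "AE w in M. w \<in> space M - a" using AE_space by eventually_elim auto
      then show ?thesis ..
    qed
  next
    case (Union a)
    show ?case
    proof (cases "\<exists>i. AE w in M. w \<in> a i")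
      case True
      then obtain i where "AE w in M. w \<in> a i" by blast
      then have "AE w in M. w \<in> (\<Union>i. a i)" by eventually_elim auto
      then show ?thesis ..
    next
      case False
      then have "\<And>i. AE w in M. w \<notin> a i" using Union by blast
      then have "AE w in M. \<forall>i. w \<notin> a i" by (simp add: AE_all_countable)
      then have "AE w in M. w \<notin> (\<Union>i. a i)" by eventually_elim auto
      then show ?thesis ..
    qed
  qed simp
  have int: "expectation (\<lambda>w. X w - expectation X) = 0" using X(2) by (simp add: prob_space)
  let ?A = "{w \<in> space (F 0). X w \<ge> expectation X}"
  note [measurable] = X(1)
  have "?A \<in> sets (F 0)" by measurable
  from 01[OF this] show ?thesis
  proof
    assume "AE w in M. w \<in> ?A"
    then have "AE w in M. 0 \<le> X w - expectation X" by eventually_elim auto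
    with int X(2) have "AE w in M. X w - expectation X = 0"
      by (subst (asm) integral_nonneg_eq_0_iff_AE) auto
    then show ?thesis by eventually_elim simp
  next
    assume "AE w in M. w \<notin> ?A"
    then have "AE w in M. X w < expectation X" using AE_space by eventually_elim auto
    then have "AE w in M. 0 \<le> expectation X - X w" by eventually_elim auto
    moreover have "expectation (\<lambda>w. expectation X - X w) = 0" using X(2) by (simp add: prob_space)
    ultimately have "AE w in M. expectation X - X w = 0"
      using X(2) by (subst (asm) integral_nonneg_eq_0_iff_AE) auto
    then show ?thesis by eventually_elim simp
  qed
qed

end

section \<open>The Ito isometry\<close>

lemma finite_measure_leb: "finite_measure (leb a b)"
  by (rule finite_measureI) (simp add: emeasure_restrict_space space_restrict_space emeasure_lborel_Icc_eq)

lemma space_leb [simp]: "space (leb a b) = {a..b}"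
  by (simp add: space_restrict_space)

lemma measurable_leb_pair_subinterval:
  assumes "c \<le> a" "b \<le> d" "f \<in> measurable (leb c d \<Otimes>\<^sub>M M) N"
  shows "f \<in> measurable (leb a b \<Otimes>\<^sub>M M) N"
proof -
  have [measurable]: "(\<lambda>x. x) \<in> measurable (leb a b) (leb c d)"
    by (rule measurable_restrict_space2) (use assms in \<open>auto simp: measurable_restrict_space1\<close>)
  have "(\<lambda>p. (fst p, snd p)) \<in> measurable (leb a b \<Otimes>\<^sub>M M) (leb c d \<Otimes>\<^sub>M M)"
    by measurable
  from measurable_compose[OF this assms(3)] show ?thesis by simp
qed

context prob_space
begin

abbreviation time_scenario :: "real \<Rightarrow> real \<Rightarrow> (real \<times> 'a) measure" where
  "time_scenario a b \<equiv> leb a b \<Otimes>\<^sub>M M"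

abbreviation time2_scenario :: "real \<Rightarrow> (real \<times> real \<times> 'a) measure" where
  "time2_scenario T \<equiv> leb 0 T \<Otimes>\<^sub>M leb 0 T \<Otimes>\<^sub>M M"

lemma pair_sigma_finite_leb: "pair_sigma_finite (leb a b) M"
  by (intro pair_sigma_finite.intro finite_measure.axioms(1)[OF finite_measure_leb] sigma_finite_measure_axioms)

lemma finite_measure_leb_pair: "finite_measure (time_scenario a b)"
  by (intro finite_measure_pair_measure finite_measure_leb finite_measure_axioms)

lemma sigma_finite_leb: "sigma_finite_measure (leb a b)"
  by (rule finite_measure.axioms(1)[OF finite_measure_leb])

text \<open>
  Processes on a subinterval live on a measure space of their own.  Seeing it as a restriction
  allows all integrals to be compared on the product over one common interval.
\<close>

lemma leb_pair_eq_restrict_space: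
  assumes "c \<le> a" "b \<le> d"
  shows "time_scenario a b = restrict_space (time_scenario c d) ({a..b} \<times> space M)" (is "?L = ?R")
proof (rule measure_eqI)
  have R: "{a..b} \<times> space M \<in> sets (time_scenario c d)"
    using assms by (intro pair_measureI) (auto simp: sets_restrict_space_iff)
  have spR: "space ?R = {a..b} \<times> space M"
    using assms by (auto simp: space_restrict_space space_pair_measure)
  have 1: "(\<lambda>p. p) \<in> measurable ?L ?R"
    by (rule measurable_restrict_space2)
       (use assms in \<open>auto simp: space_pair_measure intro: measurable_leb_pair_subinterval\<close>)
  have fst: "fst \<in> measurable ?R (leb a b)"
  proof (rule measurable_restrict_space2)
    show "fst \<in> space ?R \<rightarrow> {a..b}" unfolding spR by auto
    have "fst \<in> measurable (time_scenario c d) lborel"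
      by (rule measurable_compose[OF measurable_fst]) (simp add: measurable_restrict_space1)
    then show "fst \<in> measurable ?R lborel" by (rule measurable_restrict_space1)
  qed
  have "(\<lambda>p. (fst p, snd p)) \<in> measurable ?R ?L"
    by (intro measurable_Pair fst measurable_restrict_space1 measurable_snd)
  then have 2: "(\<lambda>p. p) \<in> measurable ?R ?L" by simp
  have sp: "space ?L = space ?R" unfolding spR by (simp add: space_pair_measure)
  show sets: "sets ?L = sets ?R"
  proof
    show "sets ?L \<subseteq> sets ?R"
    proof
      fix X assume "X \<in> sets ?L"
      from measurable_sets[OF 2 this] sets.sets_into_space[OF this]
      show "X \<in> sets ?R" unfolding sp by (simp add: Int_absorb2)
    qed
    show "sets ?R \<subseteq> sets ?L"
    proof
      fix X assume "X \<in> sets ?R"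
      from measurable_sets[OF 1 this] sets.sets_into_space[OF this]
      show "X \<in> sets ?L" unfolding sp by (simp add: Int_absorb2)
    qed
  qed
  fix X assume X: "X \<in> sets ?L"
  then have X': "X \<in> sets (time_scenario c d)" "X \<subseteq> {a..b} \<times> space M"
  proof -
    have "X \<in> sets ?R" using X sets by simp
    then show "X \<in> sets (time_scenario c d)"
      using R sets.sets_into_space[OF R] by (subst (asm) sets_restrict_space_iff) (auto simp: Int_absorb2)
    show "X \<subseteq> {a..b} \<times> space M" using sets.sets_into_space[OF X] by (simp add: space_pair_measure)
  qed
  have "emeasure ?L X = (\<integral>\<^sup>+s. emeasure M (Pair s -` X) \<partial>leb a b)"
    by (rule emeasure_pair_measure_alt[OF X])
  also have "\<dots> = (\<integral>\<^sup>+s. emeasure M (Pair s -` X) * indicator {a..b} s \<partial>lborel)"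
    by (subst nn_integral_restrict_space) auto
  also have "\<dots> = (\<integral>\<^sup>+s. emeasure M (Pair s -` X) * indicator {c..d} s \<partial>lborel)"
  proof (rule nn_integral_cong)
    fix s
    have "s \<notin> {a..b} \<Longrightarrow> Pair s -` X = {}" using X'(2) by auto
    then show "emeasure M (Pair s -` X) * indicator {a..b} s = emeasure M (Pair s -` X) * indicator {c..d} s"
      using assms by (cases "s \<in> {a..b}") (auto simp: indicator_def)
  qed
  also have "\<dots> = (\<integral>\<^sup>+s. emeasure M (Pair s -` X) \<partial>leb c d)"
    by (subst nn_integral_restrict_space) auto
  also have "\<dots> = emeasure (time_scenario c d) X"
    by (rule emeasure_pair_measure_alt[OF X'(1), symmetric])
  also have "\<dots> = emeasure ?R X"
    using R X' by (subst emeasure_restrict_space) (auto simp: Int_absorb2)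
  finally show "emeasure ?L X = emeasure ?R X" .
qed

lemma leb_rectangle_sets:
  "c \<le> a \<Longrightarrow> b \<le> d \<Longrightarrow> ({a..b} \<times> space M) \<inter> space (time_scenario c d) \<in> sets (time_scenario c d)"
proof (intro sets.Int sets.top pair_measureI)
  assume "c \<le> a" "b \<le> d"
  then show "{a..b} \<in> sets (leb c d)" by (auto simp: sets_restrict_space_iff)
qed

end

lemma integral_double_sum:
  fixes f :: "nat \<Rightarrow> nat \<Rightarrow> 'a \<Rightarrow> real"
  assumes "\<And>i j. i < n \<Longrightarrow> j < m \<Longrightarrow> integrable N (f i j)"
  shows "(LINT x|N. (\<Sum>i<n. \<Sum>j<m. f i j x)) = (\<Sum>i<n. \<Sum>j<m. LINT x|N. f i j x)"
proof -
  have "(LINT x|N. (\<Sum>i<n. \<Sum>j<m. f i j x)) = (\<Sum>i<n. LINT x|N. (\<Sum>j<m. f i j x))"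
    using assms by (intro Bochner_Integration.integral_sum Bochner_Integration.integrable_sum) auto
  also have "\<dots> = (\<Sum>i<n. \<Sum>j<m. LINT x|N. f i j x)"
    using assms by (intro sum.cong refl Bochner_Integration.integral_sum) auto
  finally show ?thesis .
qed

lemma simple_data_range:
  assumes "simple_data M F a b n \<tau> \<phi>" "i \<le> n"
  shows "a \<le> \<tau> i" "\<tau> i \<le> b"
proof -
  have \<tau>: "\<tau> 0 = a" "\<tau> n = b" "\<And>i. i < n \<Longrightarrow> \<tau> i \<le> \<tau> (Suc i)"
    using assms(1) by (auto simp: simple_data_def)
  show "a \<le> \<tau> i" using assms(2)
  proof (induction i)
    case (Suc i)
    then show ?case using \<tau>(3)[of i] by linarith
  qed (simp add: \<tau>)
  show "\<tau> i \<le> b" using assms(2)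
  proof (induction rule: inc_induct)
    case (step i)
    then show ?case using \<tau>(3)[of i] by linarith
  qed (simp add: \<tau>)
qed

context wiener_space
begin

lemma simple_dataD:
  fixes \<phi> :: "nat \<Rightarrow> 'w \<Rightarrow> 'h::euclidean_space"
  assumes "simple_data M F a b n \<tau> \<phi>" "i < n" "0 \<le> a" "b \<le> T"
  shows "0 \<le> \<tau> i" "\<tau> i \<le> \<tau> (Suc i)" "\<tau> (Suc i) \<le> T" "\<tau> i \<le> T"
    "\<phi> i \<in> borel_measurable (F (\<tau> i))" "\<phi> i \<in> borel_measurable M"
    "\<exists>K. \<forall>w\<in>space M. norm (\<phi> i w) \<le> K"
proof -
  note r = simple_data_range[OF assms(1)]
  show r': "0 \<le> \<tau> i" "\<tau> i \<le> \<tau> (Suc i)" "\<tau> (Suc i) \<le> T" "\<tau> i \<le> T"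
    using r[of i] r[of "Suc i"] assms by (auto simp: simple_data_def)
  show f: "\<phi> i \<in> borel_measurable (F (\<tau> i))"
    using assms by (auto simp: simple_data_def)
  then show "\<phi> i \<in> borel_measurable M" using measurable_F_M r' by blast
  show "\<exists>K. \<forall>w\<in>space M. norm (\<phi> i w) \<le> K"
    using assms by (auto simp: simple_data_def bounded_iff)
qed

lemma simple_ito_increment:
  "simple_ito W n \<tau> \<phi> w = (\<Sum>i<n. increment (\<tau> i) (\<tau> (Suc i)) w *\<^sub>R \<phi> i w)"
  by (simp add: simple_ito_def increment_def)

lemma simple_process_measurable:
  fixes \<phi> :: "nat \<Rightarrow> 'w \<Rightarrow> 'h::euclidean_space"
  assumes "\<And>i. i < n \<Longrightarrow> \<phi> i \<in> borel_measurable M"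
  shows "(\<lambda>(s, w). simple_process n \<tau> \<phi> s w) \<in> borel_measurable (time_scenario a b)"
proof -
  have ind: "(\<lambda>p. indicat_real {c<..d} (fst p)) \<in> borel_measurable (time_scenario a b)" for c d
    by (rule measurable_compose[OF measurable_fst]) (simp add: measurable_restrict_space1)
  show ?thesis
    unfolding simple_process_def case_prod_beta
    by (intro borel_measurable_sum borel_measurable_scaleR ind
        measurable_compose[OF measurable_snd assms]) simp
qed

lemma simple_process_sq_integrable:
  fixes \<phi> :: "nat \<Rightarrow> 'w \<Rightarrow> 'h::euclidean_space"
  assumes "\<And>i. i < n \<Longrightarrow> \<phi> i \<in> borel_measurable M"
    "\<And>i. i < n \<Longrightarrow> \<exists>K. \<forall>w\<in>space M. norm (\<phi> i w) \<le> K"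
  shows "sq_integrable (time_scenario a b) (\<lambda>(s, w). simple_process n \<tau> \<phi> s w)"
proof -
  interpret P: finite_measure "time_scenario a b" by (rule finite_measure_leb_pair)
  from assms(2) obtain K where K: "\<And>i w. i < n \<Longrightarrow> w \<in> space M \<Longrightarrow> norm (\<phi> i w) \<le> K i" by metis
  have bd: "norm (simple_process n \<tau> \<phi> s w) \<le> (\<Sum>i<n. K i)" if "w \<in> space M" for s w
    unfolding simple_process_def
  proof (rule sum_norm_le)
    fix i assume "i \<in> {..<n}"
    then have "norm (\<phi> i w) \<le> K i" using K that by simp
    moreover have "norm (indicat_real {\<tau> i<..\<tau> (Suc i)} s *\<^sub>R \<phi> i w) \<le> norm (\<phi> i w)"
      by (simp add: indicator_def)
    ultimately show "norm (indicat_real {\<tau> i<..\<tau> (Suc i)} s *\<^sub>R \<phi> i w) \<le> K i" by linarith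
  qed
  show ?thesis
  proof (rule sq_integrable_bound[OF simple_process_measurable[OF assms(1)]])
    show "integrable (time_scenario a b) (\<lambda>_. (\<Sum>i<n. K i)\<^sup>2)" by simp
    show "AE x in time_scenario a b. (norm (case x of (s, w) \<Rightarrow> simple_process n \<tau> \<phi> s w))\<^sup>2 \<le> (\<Sum>i<n. K i)\<^sup>2"
      by (rule AE_I2) (auto simp: space_pair_measure intro!: power_mono bd)
  qed simp
qed

lemma increment_scaleR_sq_integrable:
  fixes \<phi> :: "'w \<Rightarrow> 'h::euclidean_space"
  assumes st: "0 \<le> s" "s \<le> t" "t \<le> T" and \<phi>: "\<phi> \<in> borel_measurable M" "\<exists>K. \<forall>w\<in>space M. norm (\<phi> w) \<le> K"
  shows "sq_integrable M (\<lambda>w. increment s t w *\<^sub>R \<phi> w)"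
proof -
  obtain K where K: "\<And>w. w \<in> space M \<Longrightarrow> norm (\<phi> w) \<le> K" using \<phi>(2) by blast
  note [measurable] = increment_measurable_M[OF st] \<phi>(1)
  show ?thesis
  proof (rule sq_integrable_bound)
    show "integrable M (\<lambda>w. K\<^sup>2 * (increment s t w)\<^sup>2)" using increment_moments(3)[OF st] by simp
    show "AE w in M. (norm (increment s t w *\<^sub>R \<phi> w))\<^sup>2 \<le> K\<^sup>2 * (increment s t w)\<^sup>2"
    proof (rule AE_I2)
      fix w assume "w \<in> space M"
      from K[OF this] have "(norm (\<phi> w))\<^sup>2 \<le> K\<^sup>2" by (rule power_mono) simp
      then have "(norm (\<phi> w))\<^sup>2 * (increment s t w)\<^sup>2 \<le> K\<^sup>2 * (increment s t w)\<^sup>2"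
        by (rule mult_right_mono) simp
      then show "(norm (increment s t w *\<^sub>R \<phi> w))\<^sup>2 \<le> K\<^sup>2 * (increment s t w)\<^sup>2"
        by (simp add: power_mult_distrib mult.commute)
    qed
  qed measurable
qed

lemma sq_integrable_sum:
  assumes "\<And>i. i \<in> I \<Longrightarrow> sq_integrable N (f i)"
  shows "sq_integrable N (\<lambda>x. \<Sum>i\<in>I. f i x)"
  using assms
proof (induction I rule: infinite_finite_induct)
  case (insert i I)
  then show ?case by (simp add: sq_integrable_add)
qed (auto simp: sq_integrable_def)

lemma simple_ito_sq_integrable:
  fixes \<phi> :: "nat \<Rightarrow> 'w \<Rightarrow> 'h::euclidean_space"
  assumes d: "simple_data M F a b n \<tau> \<phi>" and ab: "0 \<le> a" "b \<le> T"
  shows "sq_integrable M (simple_ito W n \<tau> \<phi>)"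
proof -
  have "simple_ito W n \<tau> \<phi> = (\<lambda>w. \<Sum>i<n. increment (\<tau> i) (\<tau> (Suc i)) w *\<^sub>R \<phi> i w)"
    by (rule ext) (rule simple_ito_increment)
  then show ?thesis
    using simple_dataD[OF d _ ab] by (auto intro!: sq_integrable_sum increment_scaleR_sq_integrable)
qed

text \<open>
  Both sides are bilinear in the two families of values, and the coefficient of a pair of values is
  in both cases the length of the overlap of the two time intervals.
\<close>

lemma simple_ito_isometry:
  fixes \<phi> \<eta> :: "nat \<Rightarrow> 'w \<Rightarrow> 'h::euclidean_space"
  assumes d: "simple_data M F 0 T n \<tau> \<phi>" and e: "simple_data M F 0 T m \<sigma> \<eta>"
  shows "(LINT w|M. simple_ito W n \<tau> \<phi> w \<bullet> simple_ito W m \<sigma> \<eta> w)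
    = (LINT (s, w)|(time_scenario 0 T). simple_process n \<tau> \<phi> s w \<bullet> simple_process m \<sigma> \<eta> s w)"
proof -
  interpret P: pair_sigma_finite "leb 0 T" M by (rule pair_sigma_finite_leb)
  interpret L: finite_measure "leb 0 T" by (rule finite_measure_leb)
  note D = simple_dataD[OF d _ order_refl order_refl] and E = simple_dataD[OF e _ order_refl order_refl]
  let ?I = "\<lambda>i. {\<tau> i<..\<tau> (Suc i)}" and ?J = "\<lambda>j. {\<sigma> j<..\<sigma> (Suc j)}"
  let ?c = "\<lambda>i j. measure lborel (?I i \<inter> ?J j) * expectation (\<lambda>w. \<phi> i w \<bullet> \<eta> j w)"
  have bd: "\<exists>K. \<forall>w\<in>space M. \<bar>\<phi> i w \<bullet> \<eta> j w\<bar> \<le> K" if ij: "i < n" "j < m" for i j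
  proof -
    obtain K L where KL: "\<And>w. w \<in> space M \<Longrightarrow> norm (\<phi> i w) \<le> K" "\<And>w. w \<in> space M \<Longrightarrow> norm (\<eta> j w) \<le> L"
      using D(7)[OF ij(1)] E(7)[OF ij(2)] by blast
    have "\<bar>\<phi> i w \<bullet> \<eta> j w\<bar> \<le> K * L" if "w \<in> space M" for w
      using order_trans[OF Cauchy_Schwarz_ineq2 mult_mono[OF KL(1)[OF that] KL(2)[OF that]]]
        order_trans[OF norm_ge_zero KL(1)[OF that]] by simp
    then show ?thesis by blast
  qed
  have meas: "(\<lambda>w. \<phi> i w \<bullet> \<eta> j w) \<in> borel_measurable (F (max (\<tau> i) (\<sigma> j)))" if ij: "i < n" "j < m" for i j
    using measurable_F_mono[OF D(5)[OF ij(1)], of "max (\<tau> i) (\<sigma> j)"]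
      measurable_F_mono[OF E(5)[OF ij(2)], of "max (\<tau> i) (\<sigma> j)"] by simp
  have inc: "integrable M (\<lambda>w. increment (\<tau> i) (\<tau> (Suc i)) w * increment (\<sigma> j) (\<sigma> (Suc j)) w * (\<phi> i w \<bullet> \<eta> j w))"
    "(LINT w|M. increment (\<tau> i) (\<tau> (Suc i)) w * increment (\<sigma> j) (\<sigma> (Suc j)) w * (\<phi> i w \<bullet> \<eta> j w)) = ?c i j"
    if ij: "i < n" "j < m" for i j
  proof -
    obtain K where K: "\<And>w. w \<in> space M \<Longrightarrow> \<bar>\<phi> i w \<bullet> \<eta> j w\<bar> \<le> K" using bd[OF ij] by blast
    note * = expectation_increments[OF D(1)[OF ij(1)] D(2)[OF ij(1)] D(3)[OF ij(1)]
      E(1)[OF ij(2)] E(2)[OF ij(2)] E(3)[OF ij(2)] meas[OF ij] K]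
    show "integrable M (\<lambda>w. increment (\<tau> i) (\<tau> (Suc i)) w * increment (\<sigma> j) (\<sigma> (Suc j)) w * (\<phi> i w \<bullet> \<eta> j w))"
      using *(1) .
    show "(LINT w|M. increment (\<tau> i) (\<tau> (Suc i)) w * increment (\<sigma> j) (\<sigma> (Suc j)) w * (\<phi> i w \<bullet> \<eta> j w)) = ?c i j"
      using *(2) .
  qed
  have "(LINT w|M. simple_ito W n \<tau> \<phi> w \<bullet> simple_ito W m \<sigma> \<eta> w)
    = (LINT w|M. (\<Sum>i<n. \<Sum>j<m. increment (\<tau> i) (\<tau> (Suc i)) w * increment (\<sigma> j) (\<sigma> (Suc j)) w * (\<phi> i w \<bullet> \<eta> j w)))"
    unfolding simple_ito_increment inner_sum_left inner_sum_right
    by (subst sum.swap) (simp add: mult.assoc mult.left_commute)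
  also have "\<dots> = (\<Sum>i<n. \<Sum>j<m. ?c i j)"
    by (subst integral_double_sum) (auto intro!: sum.cong inc simp del: Int_greaterThanAtMost)
  finally have lhs: "(LINT w|M. simple_ito W n \<tau> \<phi> w \<bullet> simple_ito W m \<sigma> \<eta> w) = (\<Sum>i<n. \<Sum>j<m. ?c i j)" .
  let ?f = "\<lambda>i j p. indicat_real (?I i \<inter> ?J j) (fst p) * (\<phi> i (snd p) \<bullet> \<eta> j (snd p))"
  have pr: "integrable (time_scenario 0 T) (?f i j)" "integral\<^sup>L (time_scenario 0 T) (?f i j) = ?c i j"
    if ij: "i < n" "j < m" for i j
  proof -
    obtain K where K: "\<And>w. w \<in> space M \<Longrightarrow> \<bar>\<phi> i w \<bullet> \<eta> j w\<bar> \<le> K" using bd[OF ij] by blast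
    interpret LM: finite_measure "time_scenario 0 T" by (rule finite_measure_leb_pair)
    have ind: "(\<lambda>p. indicat_real (?I i \<inter> ?J j) (fst p)) \<in> borel_measurable (time_scenario 0 T)"
      by (rule measurable_compose[OF measurable_fst]) (simp add: measurable_restrict_space1)
    have inn: "(\<lambda>p. \<phi> i (snd p) \<bullet> \<eta> j (snd p)) \<in> borel_measurable (time_scenario 0 T)"
      using D(6)[OF ij(1)] E(6)[OF ij(2)] by measurable
    show int: "integrable (time_scenario 0 T) (?f i j)"
    proof (rule LM.integrable_const_bound[where B=K])
      show "AE p in time_scenario 0 T. norm (?f i j p) \<le> K"
      proof (rule AE_I2)
        fix p assume "p \<in> space (time_scenario 0 T)"
        then have "snd p \<in> space M" by (auto simp: space_pair_measure)
        from K[OF this] show "norm (?f i j p) \<le> K"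
          by (auto simp: indicator_def)
      qed
      show "?f i j \<in> borel_measurable (time_scenario 0 T)" using ind inn by (rule borel_measurable_times)
    qed
    have sub: "?I i \<inter> ?J j \<subseteq> {0..T}" using D(1)[OF ij(1)] D(3)[OF ij(1)] by auto
    have "integral\<^sup>L (time_scenario 0 T) (?f i j) = (LINT s|leb 0 T. LINT w|M. ?f i j (s, w))"
      by (rule P.integral_fst'[OF int, symmetric])
    also have "\<dots> = (LINT s|leb 0 T. indicat_real (?I i \<inter> ?J j) s) * expectation (\<lambda>w. \<phi> i w \<bullet> \<eta> j w)"
      by simp
    also have "(LINT s|leb 0 T. indicat_real (?I i \<inter> ?J j) s) = measure (leb 0 T) (?I i \<inter> ?J j)"
      using sub by (simp add: Int_absorb2)
    also have "\<dots> = measure lborel (?I i \<inter> ?J j)"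
      using sub by (intro measure_restrict_space) auto
    finally show "integral\<^sup>L (time_scenario 0 T) (?f i j) = ?c i j" .
  qed
  have "(LINT (s, w)|(time_scenario 0 T). simple_process n \<tau> \<phi> s w \<bullet> simple_process m \<sigma> \<eta> s w)
    = (LINT p|(time_scenario 0 T). (\<Sum>i<n. \<Sum>j<m. ?f i j p))"
    unfolding simple_process_def case_prod_unfold inner_sum_left inner_sum_right
    by (subst sum.swap) (simp add: indicator_inter_arith mult.assoc mult.left_commute
          del: sum.inter_filter Int_greaterThanAtMost sum_mult_of_bool_eq sum_of_bool_mult_eq)
  also have "\<dots> = (\<Sum>i<n. \<Sum>j<m. ?c i j)"
    by (subst integral_double_sum) (auto intro!: sum.cong pr simp del: Int_greaterThanAtMost)
  finally show ?thesis using lhs by simp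
qed

text \<open>The approximating sequences that witness an Ito integral, named for use in limit arguments.\<close>

definition ito_approximation ::
  "real \<Rightarrow> real \<Rightarrow> (real \<Rightarrow> 'w \<Rightarrow> 'h::euclidean_space) \<Rightarrow> ('w \<Rightarrow> 'h) \<Rightarrow>
    (nat \<Rightarrow> nat) \<Rightarrow> (nat \<Rightarrow> nat \<Rightarrow> real) \<Rightarrow> (nat \<Rightarrow> nat \<Rightarrow> 'w \<Rightarrow> 'h) \<Rightarrow> bool" where
  "ito_approximation a b f X n \<tau> \<phi> \<longleftrightarrow>
     (\<lambda>(s, w). f s w) \<in> borel_measurable (time_scenario a b) \<and> X \<in> borel_measurable M \<and>
     (\<forall>k. simple_data M F a b (n k) (\<tau> k) (\<phi> k)) \<and>
     (\<lambda>k. \<integral>\<^sup>+(s, w). ennreal ((norm (simple_process (n k) (\<tau> k) (\<phi> k) s w - f s w))\<^sup>2)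
               \<partial>(time_scenario a b)) \<longlonglongrightarrow> 0 \<and>
     (\<lambda>k. \<integral>\<^sup>+w. ennreal ((norm (simple_ito W (n k) (\<tau> k) (\<phi> k) w - X w))\<^sup>2) \<partial>M) \<longlonglongrightarrow> 0"

lemma has_ito_integral_iff:
  "has_ito_integral M F W a b f X \<longleftrightarrow> (\<exists>n \<tau> \<phi>. ito_approximation a b f X n \<tau> \<phi>)"
  unfolding has_ito_integral_def ito_approximation_def by blast

lemma ito_approximationD:
  fixes f :: "real \<Rightarrow> 'w \<Rightarrow> 'h::euclidean_space"
  assumes ab: "0 \<le> a" "b \<le> T" and h: "ito_approximation a b f X n \<tau> \<phi>"
  shows "simple_data M F a b (n k) (\<tau> k) (\<phi> k)"
    "sq_integrable (time_scenario a b) (\<lambda>(s, w). simple_process (n k) (\<tau> k) (\<phi> k) s w)"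
    "(\<lambda>(s, w). f s w) \<in> borel_measurable (time_scenario a b)"
    "(\<lambda>k. \<integral>\<^sup>+p. ennreal ((norm ((case p of (s, w) \<Rightarrow> simple_process (n k) (\<tau> k) (\<phi> k) s w)
        - (case p of (s, w) \<Rightarrow> f s w)))\<^sup>2) \<partial>(time_scenario a b)) \<longlonglongrightarrow> 0"
    "sq_integrable M (simple_ito W (n k) (\<tau> k) (\<phi> k))"
    "X \<in> borel_measurable M"
    "(\<lambda>k. \<integral>\<^sup>+w. ennreal ((norm (simple_ito W (n k) (\<tau> k) (\<phi> k) w - X w))\<^sup>2) \<partial>M) \<longlonglongrightarrow> 0"
proof -
  have *: "simple_data M F a b (n k) (\<tau> k) (\<phi> k)" for k
    using h by (simp add: ito_approximation_def)
  show "simple_data M F a b (n k) (\<tau> k) (\<phi> k)" by (rule *)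
  show "sq_integrable (time_scenario a b) (\<lambda>(s, w). simple_process (n k) (\<tau> k) (\<phi> k) s w)"
    by (rule simple_process_sq_integrable) (use simple_dataD[OF * _ ab] in auto)
  show "sq_integrable M (simple_ito W (n k) (\<tau> k) (\<phi> k))"
    by (rule simple_ito_sq_integrable[OF * ab])
  show "(\<lambda>k. \<integral>\<^sup>+p. ennreal ((norm ((case p of (s, w) \<Rightarrow> simple_process (n k) (\<tau> k) (\<phi> k) s w)
        - (case p of (s, w) \<Rightarrow> f s w)))\<^sup>2) \<partial>(time_scenario a b)) \<longlonglongrightarrow> 0"
    using h unfolding ito_approximation_def by (simp add: case_prod_unfold)
qed (use h in \<open>auto simp: ito_approximation_def\<close>)

lemma has_ito_integral_sq_integrable:
  fixes f :: "real \<Rightarrow> 'w \<Rightarrow> 'h::euclidean_space"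
  assumes ab: "0 \<le> a" "b \<le> T" and h: "has_ito_integral M F W a b f X"
  shows "sq_integrable (time_scenario a b) (\<lambda>(s, w). f s w)" "sq_integrable M X"
proof -
  obtain n \<tau> \<phi> where app: "ito_approximation a b f X n \<tau> \<phi>"
    using h unfolding has_ito_integral_iff by blast
  note 1 = ito_approximationD[OF ab app]
  show "sq_integrable (time_scenario a b) (\<lambda>(s, w). f s w)" by (rule tendsto_sq_integrable(1)[OF 1(2-4)])
  show "sq_integrable M X" by (rule tendsto_sq_integrable(1)[OF 1(5-7)])
qed

lemma ito_isometry:
  fixes f g :: "real \<Rightarrow> 'w \<Rightarrow> 'h::euclidean_space"
  assumes f: "has_ito_integral M F W 0 T f X" and g: "has_ito_integral M F W 0 T g Y"
  shows "(LINT w|M. X w \<bullet> Y w) = (LINT p|(time_scenario 0 T). (case p of (s, w) \<Rightarrow> f s w) \<bullet> (case p of (s, w) \<Rightarrow> g s w))"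
proof -
  obtain n \<tau> \<phi> where app1: "ito_approximation 0 T f X n \<tau> \<phi>"
    using f unfolding has_ito_integral_iff by blast
  note 1 = ito_approximationD[OF order_refl order_refl app1]
  obtain m \<sigma> \<eta> where app2: "ito_approximation 0 T g Y m \<sigma> \<eta>"
    using g unfolding has_ito_integral_iff by blast
  note 2 = ito_approximationD[OF order_refl order_refl app2]
  have lim1: "(\<lambda>k. LINT w|M. simple_ito W (n k) (\<tau> k) (\<phi> k) w \<bullet> simple_ito W (m k) (\<sigma> k) (\<eta> k) w)
    \<longlonglongrightarrow> (LINT w|M. X w \<bullet> Y w)"
    by (rule tendsto_integral_inner[OF 1(5-7) 2(5-7)])
  have lim2: "(\<lambda>k. LINT p|(time_scenario 0 T). (case p of (s, w) \<Rightarrow> simple_process (n k) (\<tau> k) (\<phi> k) s w)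
      \<bullet> (case p of (s, w) \<Rightarrow> simple_process (m k) (\<sigma> k) (\<eta> k) s w))
    \<longlonglongrightarrow> (LINT p|(time_scenario 0 T). (case p of (s, w) \<Rightarrow> f s w) \<bullet> (case p of (s, w) \<Rightarrow> g s w))"
    by (rule tendsto_integral_inner[OF 1(2-4) 2(2-4)])
  have eq: "(LINT w|M. simple_ito W (n k) (\<tau> k) (\<phi> k) w \<bullet> simple_ito W (m k) (\<sigma> k) (\<eta> k) w)
    = (LINT p|(time_scenario 0 T). (case p of (s, w) \<Rightarrow> simple_process (n k) (\<tau> k) (\<phi> k) s w)
      \<bullet> (case p of (s, w) \<Rightarrow> simple_process (m k) (\<sigma> k) (\<eta> k) s w))" for k
    using simple_ito_isometry[OF 1(1) 2(1), of k k] unfolding case_prod_unfold .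
  show ?thesis by (rule LIMSEQ_unique[OF lim1 lim2[folded eq]])
qed

text \<open>
  For simple integrands, each summand is an increment after time \<open>a\<close> with a weight known at its
  start, also after multiplication by the \<open>F a\<close>-measurable \<open>G\<close>.
\<close>

lemma ito_integral_orthogonal_past:
  fixes f :: "real \<Rightarrow> 'w \<Rightarrow> 'h::euclidean_space"
  assumes ab: "0 \<le> a" "b \<le> T" and f: "has_ito_integral M F W a b f X"
    and G: "G \<in> borel_measurable (F a)" "sq_integrable M G"
  shows "(LINT w|M. G w \<bullet> X w) = 0"
proof -
  obtain n \<tau> \<phi> where app1: "ito_approximation a b f X n \<tau> \<phi>"
    using f unfolding has_ito_integral_iff by blast
  note 1 = ito_approximationD[OF ab app1]
  have "(\<lambda>k. LINT w|M. G w \<bullet> simple_ito W (n k) (\<tau> k) (\<phi> k) w) \<longlonglongrightarrow> (LINT w|M. G w \<bullet> X w)"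
    by (rule tendsto_integral_inner[OF G(2) sq_integrable_measurable[OF G(2)] _ 1(5-7)]) simp
  moreover have "(LINT w|M. G w \<bullet> simple_ito W (n k) (\<tau> k) (\<phi> k) w) = 0" for k
  proof -
    note D = simple_dataD[OF 1(1)[of k] _ ab]
    have z: "integrable M (\<lambda>w. (G w \<bullet> \<phi> k i w) * increment (\<tau> k i) (\<tau> k (Suc i)) w)"
      "(LINT w|M. (G w \<bullet> \<phi> k i w) * increment (\<tau> k i) (\<tau> k (Suc i)) w) = 0" if i: "i < n k" for i
    proof -
      have "a \<le> \<tau> k i" using simple_data_range(1)[OF 1(1)[of k]] i by simp
      then have m: "(\<lambda>w. G w \<bullet> \<phi> k i w) \<in> borel_measurable (F (\<tau> k i))"
        using measurable_F_mono[OF G(1)] D(5)[OF i] by simp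
      obtain K where "\<And>w. w \<in> space M \<Longrightarrow> norm (\<phi> k i w) \<le> K" using D(7)[OF i] by blast
      then have "sq_integrable M (\<phi> k i)"
        using D(6)[OF i] by (intro sq_integrable_bound[where g="\<lambda>_. K\<^sup>2"]) (auto intro!: AE_I2 power_mono)
      from sq_integrable_inner[OF G(2) this] have "integrable M (\<lambda>w. G w \<bullet> \<phi> k i w)" .
      from expectation_mult_increment[OF D(1-3)[OF i] m this]
      show "integrable M (\<lambda>w. (G w \<bullet> \<phi> k i w) * increment (\<tau> k i) (\<tau> k (Suc i)) w)"
        "(LINT w|M. (G w \<bullet> \<phi> k i w) * increment (\<tau> k i) (\<tau> k (Suc i)) w) = 0" by auto
    qed
    have "(LINT w|M. G w \<bullet> simple_ito W (n k) (\<tau> k) (\<phi> k) w)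
      = (LINT w|M. (\<Sum>i<n k. (G w \<bullet> \<phi> k i w) * increment (\<tau> k i) (\<tau> k (Suc i)) w))"
      unfolding simple_ito_increment inner_sum_right by (simp add: mult.commute)
    also have "\<dots> = 0" using z by (simp add: Bochner_Integration.integral_sum)
    finally show ?thesis .
  qed
  ultimately show ?thesis by (simp add: LIMSEQ_const_iff)
qed

text \<open>
  The approximating partitions are padded with \<open>[0,a]\<close> and \<open>[b,T]\<close>, on which the values are \<open>0\<close>.
  Integrals over different intervals thereby become integrals over \<open>[0,T]\<close>, to which the isometry
  applies.
\<close>

lemma has_ito_integral_extend:
  fixes f :: "real \<Rightarrow> 'w \<Rightarrow> 'h::euclidean_space"
  assumes ab: "0 \<le> a" "a \<le> b" "b \<le> T" and f: "has_ito_integral M F W a b f X"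
  shows "has_ito_integral M F W 0 T (\<lambda>s w. indicat_real {a..b} s *\<^sub>R f s w) X"
proof -
  let ?E = "{a..b} \<times> space M"
  note R = leb_rectangle_sets[OF ab(1,3)]
  note eqR = leb_pair_eq_restrict_space[OF ab(1,3)]
  from f obtain n \<tau> \<phi> where *: "\<And>k. simple_data M F a b (n k) (\<tau> k) (\<phi> k)"
    "(\<lambda>(s, w). f s w) \<in> borel_measurable (time_scenario a b)"
    "X \<in> borel_measurable M"
    "(\<lambda>k. \<integral>\<^sup>+(s, w). ennreal ((norm (simple_process (n k) (\<tau> k) (\<phi> k) s w - f s w))\<^sup>2)
               \<partial>(time_scenario a b)) \<longlonglongrightarrow> 0"
    "(\<lambda>k. \<integral>\<^sup>+w. ennreal ((norm (simple_ito W (n k) (\<tau> k) (\<phi> k) w - X w))\<^sup>2) \<partial>M) \<longlonglongrightarrow> 0"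
    unfolding has_ito_integral_def by blast
  \<comment> \<open>Index \<open>0\<close> is the padding on \<open>[0,a]\<close> and index \<open>n k + 1\<close> the one on \<open>[b,T]\<close>.\<close>
  define n' where "n' k = Suc (Suc (n k))" for k
  define \<tau>' where "\<tau>' k i = (case i of 0 \<Rightarrow> 0 | Suc j \<Rightarrow> if j \<le> n k then \<tau> k j else T)" for k i
  define \<phi>' where "\<phi>' k i = (case i of 0 \<Rightarrow> (\<lambda>_. 0) | Suc j \<Rightarrow> if j < n k then \<phi> k j else (\<lambda>_. 0))" for k i
  have sum': "(\<Sum>i<n' k. h (\<tau>' k i) (\<tau>' k (Suc i)) (\<phi>' k i)) = (\<Sum>i<n k. h (\<tau> k i) (\<tau> k (Suc i)) (\<phi> k i))"
    if h: "\<And>s t. h s t (\<lambda>_. 0) = 0" for k and h :: "real \<Rightarrow> real \<Rightarrow> ('w \<Rightarrow> 'h) \<Rightarrow> 'h"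
    unfolding n'_def by (subst sum.lessThan_Suc_shift) (simp add: \<tau>'_def \<phi>'_def h)
  have data: "simple_data M F 0 T (n' k) (\<tau>' k) (\<phi>' k)" for k
  proof -
    have d: "\<tau> k 0 = a" "\<tau> k (n k) = b" "\<And>i. i < n k \<Longrightarrow> \<tau> k i \<le> \<tau> k (Suc i)"
      "\<And>i. i < n k \<Longrightarrow> \<phi> k i \<in> borel_measurable (F (\<tau> k i))" "\<And>i. i < n k \<Longrightarrow> bounded (\<phi> k i ` space M)"
      using *(1)[of k] by (auto simp: simple_data_def)
    have bz: "bounded ((\<lambda>_. 0::'h) ` space M)"
      by (rule bounded_subset[of "{0}"]) auto
    show ?thesis
      unfolding simple_data_def
    proof (intro conjI allI impI)
      fix i assume "i < n' k"
      then consider "i = 0" | j where "i = Suc j" "j < n k" | "i = Suc (n k)"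
        unfolding n'_def by (cases i) (auto simp: less_Suc_eq)
      note cases = this
      show "\<tau>' k i \<le> \<tau>' k (Suc i)"
        using cases by cases (use d ab in \<open>auto simp: \<tau>'_def\<close>)
      show "\<phi>' k i \<in> borel_measurable (F (\<tau>' k i))"
        using cases by cases (use d in \<open>auto simp: \<tau>'_def \<phi>'_def\<close>)
      show "bounded (\<phi>' k i ` space M)"
        using cases by cases (use d bz in \<open>auto simp: \<phi>'_def\<close>)
    qed (auto simp: \<tau>'_def n'_def)
  qed
  have ito: "simple_ito W (n' k) (\<tau>' k) (\<phi>' k) w = simple_ito W (n k) (\<tau> k) (\<phi> k) w" for k w
    unfolding simple_ito_def using sum'[of "\<lambda>s t \<phi>. (W t w - W s w) *\<^sub>R \<phi> w" k] by simp
  have proc: "simple_process (n' k) (\<tau>' k) (\<phi>' k) s w = simple_process (n k) (\<tau> k) (\<phi> k) s w" for k s w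
    unfolding simple_process_def using sum'[of "\<lambda>r t \<phi>. indicat_real {r<..t} s *\<^sub>R \<phi> w" k] by simp
  have out: "simple_process (n k) (\<tau> k) (\<phi> k) s w = 0" if "s \<notin> {a..b}" for k s w
  proof -
    have "s \<notin> {\<tau> k i<..\<tau> k (Suc i)}" if "i < n k" for i
      using simple_data_range(1)[OF *(1), of i k] simple_data_range(2)[OF *(1), of "Suc i" k] that \<open>s \<notin> {a..b}\<close>
      by auto
    then show ?thesis by (simp add: simple_process_def)
  qed
  have fm: "(\<lambda>(s, w). indicat_real {a..b} s *\<^sub>R f s w) \<in> borel_measurable (time_scenario 0 T)"
  proof -
    have "(\<lambda>p. indicat_real ?E p *\<^sub>R (case p of (s, w) \<Rightarrow> f s w)) \<in> borel_measurable (time_scenario 0 T)"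
      using *(2) unfolding eqR borel_measurable_restrict_space_iff[OF R] .
    then show ?thesis
      by (rule measurable_cong[THEN iffD1, rotated]) (auto simp: space_pair_measure indicator_def)
  qed
  have "(\<integral>\<^sup>+(s, w). ennreal ((norm (simple_process (n k) (\<tau> k) (\<phi> k) s w - f s w))\<^sup>2) \<partial>(time_scenario a b))
    = (\<integral>\<^sup>+(s, w). ennreal ((norm (simple_process (n' k) (\<tau>' k) (\<phi>' k) s w - indicat_real {a..b} s *\<^sub>R f s w))\<^sup>2)
        \<partial>(time_scenario 0 T))" for k
    unfolding eqR
  proof (subst nn_integral_restrict_space[OF R], rule nn_integral_cong)
    fix p assume "p \<in> space (time_scenario 0 T)"
    then obtain s w where p: "p = (s, w)" "w \<in> space M" by (auto simp: space_pair_measure)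
    show "(case p of (s, w) \<Rightarrow> ennreal ((norm (simple_process (n k) (\<tau> k) (\<phi> k) s w - f s w))\<^sup>2)) * indicator ?E p
      = (case p of (s, w) \<Rightarrow> ennreal ((norm (simple_process (n' k) (\<tau>' k) (\<phi>' k) s w
          - indicat_real {a..b} s *\<^sub>R f s w))\<^sup>2))"
      using p(2) out[of s k w] by (cases "s \<in> {a..b}") (simp_all add: p(1) proc del: atLeastAtMost_iff)
  qed
  then show ?thesis
    unfolding has_ito_integral_def using fm *(3,4,5) data
    by (intro conjI exI[of _ n'] exI[of _ \<tau>'] exI[of _ \<phi>']) (simp_all add: ito)
qed

end

section \<open>Conditional expectations and processes in mean square\<close>

lemma borel_measurable_vecI:
  fixes f :: "'a \<Rightarrow> real^'m"
  assumes "\<And>i. (\<lambda>x. f x $ i) \<in> borel_measurable N"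
  shows "f \<in> borel_measurable N"
proof (subst borel_measurable_euclidean_space, intro ballI)
  fix b :: "real^'m" assume "b \<in> Basis"
  then obtain i where "b = axis i 1" by (auto simp: Basis_vec_def)
  then show "(\<lambda>x. f x \<bullet> b) \<in> borel_measurable N" using assms by (simp add: inner_axis)
qed

lemma borel_measurable_vec_nth:
  fixes f :: "'a \<Rightarrow> real^'m"
  assumes [measurable]: "f \<in> borel_measurable N"
  shows "(\<lambda>x. f x $ i) \<in> borel_measurable N"
proof -
  have "(\<lambda>x. f x \<bullet> axis i 1) \<in> borel_measurable N" by measurable
  then show ?thesis by (simp add: inner_axis)
qed

lemma norm_vec_sq: "(norm x)\<^sup>2 = (\<Sum>i\<in>UNIV. (x $ i)\<^sup>2)" for x :: "real^'m"
  unfolding power2_norm_eq_inner inner_vec_def by (simp add: power2_eq_square)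

lemma sq_integrable_vec_nth:
  fixes f :: "'a \<Rightarrow> real^'m"
  assumes "sq_integrable N f"
  shows "sq_integrable N (\<lambda>x. f x $ i)"
proof (rule sq_integrable_bound)
  show "integrable N (\<lambda>x. (norm (f x))\<^sup>2)" using assms by (simp add: sq_integrable_def)
  show "AE x in N. (norm (f x $ i))\<^sup>2 \<le> (norm (f x))\<^sup>2"
    by (intro AE_I2 power_mono) (use component_le_norm_cart in auto)
qed (rule borel_measurable_vec_nth[OF sq_integrable_measurable[OF assms]])

text \<open>
  The second factor is kept general because it is used both for scenarios and for pairs of a time
  and a scenario.
\<close>

lemma (in sigma_finite_measure) sq_integrable_pairI:
  assumes L: "finite_measure L" and f: "(\<lambda>(s, w). f s w) \<in> borel_measurable (L \<Otimes>\<^sub>M M)"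
    and sq: "\<And>s. s \<in> space L \<Longrightarrow> sq_integrable M (f s)"
    and bd: "\<And>s. s \<in> space L \<Longrightarrow> (LINT w|M. (norm (f s w))\<^sup>2) \<le> C"
  shows "sq_integrable (L \<Otimes>\<^sub>M M) (\<lambda>(s, w). f s w)"
proof -
  interpret L: finite_measure L by (rule L)
  have fin: "emeasure L (space L) < top" by (simp add: less_top[symmetric])
  have m: "(\<lambda>p. ennreal ((norm (case p of (s, w) \<Rightarrow> f s w))\<^sup>2)) \<in> borel_measurable (L \<Otimes>\<^sub>M M)"
    using f by measurable
  have "(\<integral>\<^sup>+p. ennreal ((norm (case p of (s, w) \<Rightarrow> f s w))\<^sup>2) \<partial>(L \<Otimes>\<^sub>M M))
    = (\<integral>\<^sup>+s. \<integral>\<^sup>+w. ennreal ((norm (f s w))\<^sup>2) \<partial>M \<partial>L)"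
    by (subst nn_integral_fst[OF m, symmetric]) simp
  also have "\<dots> \<le> (\<integral>\<^sup>+s. ennreal C \<partial>L)"
  proof (rule nn_integral_mono)
    fix s assume s: "s \<in> space L"
    have "(\<integral>\<^sup>+w. ennreal ((norm (f s w))\<^sup>2) \<partial>M) = ennreal (LINT w|M. (norm (f s w))\<^sup>2)"
      using sq[OF s] by (intro nn_integral_eq_integral) (auto simp: sq_integrable_def)
    then show "(\<integral>\<^sup>+w. ennreal ((norm (f s w))\<^sup>2) \<partial>M) \<le> ennreal C"
      using bd[OF s] by (simp add: ennreal_leI)
  qed
  also have "\<dots> < \<infinity>"
    using fin by (auto simp: ennreal_mult_less_top)
  finally show ?thesis unfolding sq_integrable_iff_nn_integral using f by simp
qed

lemma (in sigma_finite_measure) sq_integrable_lift: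
  assumes L: "finite_measure L" and U: "sq_integrable M U"
  shows "sq_integrable (L \<Otimes>\<^sub>M M) (\<lambda>(s, w). U w)"
  by (rule sq_integrable_pairI[OF L _ U order_refl])
     (simp add: case_prod_unfold measurable_compose[OF measurable_snd sq_integrable_measurable[OF U]])

context prob_space
begin

lemma vec_cond_exp_measurable:
  "vec_cond_exp M G X \<in> borel_measurable G"
  by (rule borel_measurable_vecI) (simp add: vec_cond_exp_def)

text \<open>
  Jensen's inequality for the square, in each component.
\<close>

lemma vec_cond_exp_sq_integrable:
  fixes X :: "'a \<Rightarrow> real^'m"
  assumes "subalgebra M G" and X: "sq_integrable M X"
  shows "sq_integrable M (vec_cond_exp M G X)"
    "(LINT w|M. (norm (vec_cond_exp M G X w))\<^sup>2) \<le> (LINT w|M. (norm (X w))\<^sup>2)"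
proof -
  interpret G: sigma_finite_subalgebra M G
    by (intro finite_measure_subalgebra_is_sigma_finite finite_measure_subalgebra.intro
      finite_measure_subalgebra_axioms.intro assms(1)) (rule finite_measure_axioms)
  have Xi: "sq_integrable M (\<lambda>w. X w $ i)" for i by (rule sq_integrable_vec_nth[OF X])
  have i1: "integrable M (\<lambda>w. X w $ i)" for i by (rule sq_integrable_imp_integrable[OF Xi])
  have i2: "integrable M (\<lambda>w. (X w $ i)\<^sup>2)" for i using Xi[of i] by (simp add: sq_integrable_def)
  have conv: "convex_on UNIV (\<lambda>x::real. x\<^sup>2)" using convex_power2 by simp
  have J: "AE w in M. (real_cond_exp M G (\<lambda>w. X w $ i) w)\<^sup>2 \<le> real_cond_exp M G (\<lambda>w. (X w $ i)\<^sup>2) w" for i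
    by (rule G.real_cond_exp_jensens_inequality(2)[OF i1 _ _ i2 conv]) auto
  have i3: "integrable M (\<lambda>w. (real_cond_exp M G (\<lambda>w. X w $ i) w)\<^sup>2)" for i
    by (rule G.integrable_convex_cond_exp[OF i1 _ _ i2 conv]) auto
  have i4: "(LINT w|M. (real_cond_exp M G (\<lambda>w. X w $ i) w)\<^sup>2) \<le> (LINT w|M. (X w $ i)\<^sup>2)" for i
  proof -
    have "(LINT w|M. (real_cond_exp M G (\<lambda>w. X w $ i) w)\<^sup>2)
        \<le> (LINT w|M. real_cond_exp M G (\<lambda>w. (X w $ i)\<^sup>2) w)"
      using J[of i] G.real_cond_exp_int(1)[OF i2[of i]] by (intro integral_mono_AE i3) auto
    then show ?thesis using G.real_cond_exp_int(2)[OF i2[of i]] by simp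
  qed
  have eq: "(norm (vec_cond_exp M G X w))\<^sup>2 = (\<Sum>i\<in>UNIV. (real_cond_exp M G (\<lambda>w. X w $ i) w)\<^sup>2)" for w
    by (simp add: norm_vec_sq vec_cond_exp_def)
  have "vec_cond_exp M G X \<in> borel_measurable M"
    using measurable_from_subalg[OF assms(1) vec_cond_exp_measurable] .
  then show "sq_integrable M (vec_cond_exp M G X)"
    unfolding sq_integrable_def eq using i3 by auto
  show "(LINT w|M. (norm (vec_cond_exp M G X w))\<^sup>2) \<le> (LINT w|M. (norm (X w))\<^sup>2)"
    unfolding eq norm_vec_sq[of "X _"] using i2 i3 i4
    by (simp add: Bochner_Integration.integral_sum sum_mono)
qed

lemma vec_cond_exp_inner:
  fixes X V :: "'a \<Rightarrow> real^'m"
  assumes "subalgebra M G" and X: "sq_integrable M X" and V: "V \<in> borel_measurable G" "sq_integrable M V"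
  shows "(LINT w|M. vec_cond_exp M G X w \<bullet> V w) = (LINT w|M. X w \<bullet> V w)"
proof -
  interpret G: sigma_finite_subalgebra M G
    by (intro finite_measure_subalgebra_is_sigma_finite finite_measure_subalgebra.intro
      finite_measure_subalgebra_axioms.intro assms(1)) (rule finite_measure_axioms)
  have int: "integrable M (\<lambda>w. V w $ i * X w $ i)" for i
    using sq_integrable_inner[OF sq_integrable_vec_nth[OF V(2)] sq_integrable_vec_nth[OF X]] by simp
  have 1: "integrable M (\<lambda>w. V w $ i * real_cond_exp M G (\<lambda>w. X w $ i) w)"
    "(LINT w|M. V w $ i * real_cond_exp M G (\<lambda>w. X w $ i) w) = (LINT w|M. V w $ i * X w $ i)" for i
    using G.real_cond_exp_intg[OF int borel_measurable_vec_nth[OF V(1)]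
        borel_measurable_vec_nth[OF sq_integrable_measurable[OF X]]] by auto
  have "(LINT w|M. vec_cond_exp M G X w \<bullet> V w)
    = (LINT w|M. (\<Sum>i\<in>UNIV. V w $ i * real_cond_exp M G (\<lambda>w. X w $ i) w))"
    by (simp add: inner_vec_def vec_cond_exp_def mult.commute)
  also have "\<dots> = (\<Sum>i\<in>UNIV. LINT w|M. V w $ i * real_cond_exp M G (\<lambda>w. X w $ i) w)"
    using 1 by (intro Bochner_Integration.integral_sum) auto
  also have "\<dots> = (\<Sum>i\<in>UNIV. LINT w|M. V w $ i * X w $ i)" using 1 by simp
  also have "\<dots> = (LINT w|M. (\<Sum>i\<in>UNIV. V w $ i * X w $ i))"
    using int by (intro Bochner_Integration.integral_sum[symmetric]) auto
  also have "\<dots> = (LINT w|M. X w \<bullet> V w)" by (simp add: inner_vec_def mult.commute)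
  finally show ?thesis .
qed

lemma AE_sq_integrable_section:
  assumes "sq_integrable (time_scenario a b) (\<lambda>(s, w). f s w)"
  shows "AE s in leb a b. sq_integrable M (f s)"
proof -
  interpret P: pair_sigma_finite "leb a b" M by (rule pair_sigma_finite_leb)
  have "integrable (time_scenario a b) (\<lambda>(s, w). (norm (f s w))\<^sup>2)"
    using assms by (simp add: sq_integrable_def case_prod_unfold)
  from P.AE_integrable_fst'[OF this] AE_space show ?thesis
  proof eventually_elim
    case (elim s)
    have "f s \<in> borel_measurable M"
      using measurable_compose_Pair1[OF elim(2) sq_integrable_measurable[OF assms]] by simp
    with elim(1) show ?case by (simp add: sq_integrable_def)
  qed
qed

text \<open>
  The factor \<open>U\<close> passes under the pathwise time integral for almost every scenario, namely where
  the path of \<open>h\<close> is integrable; the rest is Fubini.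
\<close>

lemma integral_time_inner:
  assumes h: "sq_integrable (time_scenario a b) (\<lambda>(s, w). h s w)" and U: "sq_integrable M U"
  shows "integrable M (\<lambda>w. (LINT s|leb a b. h s w) \<bullet> U w)"
    "(LINT w|M. (LINT s|leb a b. h s w) \<bullet> U w) = (LINT s|leb a b. LINT w|M. h s w \<bullet> U w)"
proof -
  interpret P: pair_sigma_finite "leb a b" M by (rule pair_sigma_finite_leb)
  interpret LM: finite_measure "time_scenario a b" by (rule finite_measure_leb_pair)
  have hU: "integrable (time_scenario a b) (\<lambda>(s, w). h s w \<bullet> U w)"
    using sq_integrable_inner[OF h sq_integrable_lift[OF finite_measure_leb U]] by (simp add: case_prod_unfold)
  have hi: "integrable (time_scenario a b) (\<lambda>(s, w). h s w)"
    by (rule LM.sq_integrable_imp_integrable[OF h])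
  have eq: "AE w in M. (LINT s|leb a b. h s w \<bullet> U w) = (LINT s|leb a b. h s w) \<bullet> U w"
    using P.AE_integrable_snd[OF hi] by eventually_elim (rule integral_inner_left)
  have m: "(\<lambda>w. (LINT s|leb a b. h s w) \<bullet> U w) \<in> borel_measurable M"
    using borel_measurable_integrable[OF P.integrable_snd[OF hi]] sq_integrable_measurable[OF U] by measurable
  note i = P.integrable_snd[OF hU]
  show "integrable M (\<lambda>w. (LINT s|leb a b. h s w) \<bullet> U w)"
    using integrable_cong_AE[OF borel_measurable_integrable[OF i] m eq] i by simp
  have "(LINT w|M. (LINT s|leb a b. h s w) \<bullet> U w) = (LINT w|M. LINT s|leb a b. h s w \<bullet> U w)"
    using eq by (intro integral_cong_AE m borel_measurable_integrable[OF i]) auto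
  also have "\<dots> = (LINT s|leb a b. LINT w|M. h s w \<bullet> U w)"
    by (rule P.Fubini_integral[OF hU])
  finally show "(LINT w|M. (LINT s|leb a b. h s w) \<bullet> U w) = (LINT s|leb a b. LINT w|M. h s w \<bullet> U w)" .
qed

text \<open>
  Fubini for inner products of square-integrable processes, in the two forms that occur: with the
  time integral outside or inside the mean.
\<close>

lemma integrable_time_expectation:
  assumes f: "sq_integrable (time_scenario a b) (\<lambda>(s, w). f s w)"
    and g: "sq_integrable (time_scenario a b) (\<lambda>(s, w). g s w)"
  shows "integrable (leb a b) (\<lambda>s. LINT w|M. f s w \<bullet> g s w)"
    "(LINT s|leb a b. LINT w|M. f s w \<bullet> g s w)
      = (LINT p|(time_scenario a b). (case p of (s, w) \<Rightarrow> f s w) \<bullet> (case p of (s, w) \<Rightarrow> g s w))"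
    "(LINT w|M. LINT s|leb a b. f s w \<bullet> g s w) = (LINT s|leb a b. LINT w|M. f s w \<bullet> g s w)"
proof -
  interpret P: pair_sigma_finite "leb a b" M by (rule pair_sigma_finite_leb)
  note i = sq_integrable_inner[OF f g]
  show "integrable (leb a b) (\<lambda>s. LINT w|M. f s w \<bullet> g s w)"
    using P.integrable_fst'[OF i] by simp
  show "(LINT s|leb a b. LINT w|M. f s w \<bullet> g s w)
      = (LINT p|(time_scenario a b). (case p of (s, w) \<Rightarrow> f s w) \<bullet> (case p of (s, w) \<Rightarrow> g s w))"
    using P.integral_fst'[OF i] by simp
  have "integrable (time_scenario a b) (\<lambda>(s, w). f s w \<bullet> g s w)"
    using i by (simp add: case_prod_unfold)
  from P.Fubini_integral[OF this]
  show "(LINT w|M. LINT s|leb a b. f s w \<bullet> g s w) = (LINT s|leb a b. LINT w|M. f s w \<bullet> g s w)" .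
qed

lemma integral_time_expectation_add:
  assumes f: "sq_integrable (time_scenario a b) (\<lambda>(s, w). f s w)"
    and u: "sq_integrable (time_scenario a b) (\<lambda>(s, w). u s w)"
    and v: "sq_integrable (time_scenario a b) (\<lambda>(s, w). v s w)"
  shows "(LINT s|leb a b. LINT w|M. f s w \<bullet> (u s w + v s w))
    = (LINT s|leb a b. LINT w|M. f s w \<bullet> u s w) + (LINT s|leb a b. LINT w|M. f s w \<bullet> v s w)"
proof -
  have uv: "sq_integrable (time_scenario a b) (\<lambda>(s, w). u s w + v s w)"
    using sq_integrable_add[OF u v] by (simp add: case_prod_unfold)
  show ?thesis
    unfolding integrable_time_expectation(2)[OF f uv] integrable_time_expectation(2)[OF f u]
      integrable_time_expectation(2)[OF f v]
    using Bochner_Integration.integral_add[OF sq_integrable_inner[OF f u] sq_integrable_inner[OF f v]]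
    by (simp add: case_prod_unfold inner_add_right)
qed

text \<open>
  The pairing with the right-hand side of a backward equation, whose stochastic integral \<open>I\<close> has been
  moved to the side of \<open>Y\<close>.
\<close>

lemma backward_pairing:
  assumes X: "sq_integrable M X" and f: "sq_integrable M f" and YI: "sq_integrable M (\<lambda>w. Y w + I w)"
    and u: "sq_integrable (time_scenario a b) (\<lambda>(s, w). u s w)"
    and v: "sq_integrable (time_scenario a b) (\<lambda>(s, w). v s w)"
    and eq: "AE w in M. Y w = f w + (LINT s|leb a b. u s w + v s w) - I w"
  shows "(LINT w|M. X w \<bullet> (Y w + I w)) = (LINT w|M. X w \<bullet> f w)
    + (LINT s|leb a b. LINT w|M. X w \<bullet> u s w) + (LINT s|leb a b. LINT w|M. X w \<bullet> v s w)"
proof -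
  have uv: "sq_integrable (time_scenario a b) (\<lambda>(s, w). u s w + v s w)"
    using sq_integrable_add[OF u v] by (simp add: case_prod_unfold)
  let ?h = "\<lambda>w. LINT s|leb a b. u s w + v s w"
  note h = integral_time_inner[OF uv X] and Xf = sq_integrable_inner[OF X f]
  have "(LINT w|M. X w \<bullet> (Y w + I w)) = (LINT w|M. X w \<bullet> f w + ?h w \<bullet> X w)"
  proof (intro integral_cong_AE borel_measurable_add borel_measurable_integrable h(1) Xf sq_integrable_inner[OF X YI])
    show "AE w in M. X w \<bullet> (Y w + I w) = X w \<bullet> f w + ?h w \<bullet> X w"
      using eq by eventually_elim (simp add: inner_add_right inner_commute)
  qed
  also have "\<dots> = (LINT w|M. X w \<bullet> f w) + (LINT w|M. ?h w \<bullet> X w)"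
    using Xf h(1) by simp
  finally show ?thesis
    unfolding h(2) using integral_time_expectation_add[OF sq_integrable_lift[OF finite_measure_leb X] u v]
    by (simp add: inner_commute)
qed

end

lemma bounded_coefficientD:
  fixes A :: "real \<Rightarrow> real \<Rightarrow> 'w \<Rightarrow> 'h::euclidean_space"
  assumes A: "bounded_coefficient M T A" and t: "t \<in> {0..T}"
  shows "(\<lambda>(s, w). A t s w) \<in> borel_measurable (leb 0 T \<Otimes>\<^sub>M M)"
    "(\<lambda>(s, w). A s t w) \<in> borel_measurable (leb 0 T \<Otimes>\<^sub>M M)"
    "s \<in> {0..T} \<Longrightarrow> A t s \<in> borel_measurable M"
proof -
  have m: "(\<lambda>(t, s, w). A t s w) \<in> borel_measurable (leb 0 T \<Otimes>\<^sub>M leb 0 T \<Otimes>\<^sub>M M)"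
    using A by (simp add: bounded_coefficient_def)
  show 1: "(\<lambda>(s, w). A t s w) \<in> borel_measurable (leb 0 T \<Otimes>\<^sub>M M)"
    using measurable_compose_Pair1[OF _ m, of t] t
    by (simp only: case_prod_unfold fst_conv snd_conv space_leb)
  have "(\<lambda>p. (fst p, t, snd p)) \<in> measurable (leb 0 T \<Otimes>\<^sub>M M) (leb 0 T \<Otimes>\<^sub>M leb 0 T \<Otimes>\<^sub>M M)"
    using t by (intro measurable_Pair measurable_fst measurable_snd measurable_const) simp
  from measurable_compose[OF this m]
  show "(\<lambda>(s, w). A s t w) \<in> borel_measurable (leb 0 T \<Otimes>\<^sub>M M)"
    by (simp only: case_prod_unfold fst_conv snd_conv)
  show "A t s \<in> borel_measurable M" if "s \<in> {0..T}"
    using measurable_compose_Pair1[OF _ 1, of s] that by simp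
qed

lemma bounded_coefficient_bound:
  assumes "bounded_coefficient M T A"
  obtains K where "\<And>t s w. t \<in> {0..T} \<Longrightarrow> s \<in> {0..T} \<Longrightarrow> w \<in> space M \<Longrightarrow> norm (A t s w) \<le> K"
  using assms unfolding bounded_coefficient_def by blast

context wiener_space
begin

lemma measurable_leb_F_M:
  assumes "f \<in> measurable (leb 0 T \<Otimes>\<^sub>M F T) N"
  shows "f \<in> measurable (time_scenario 0 T) N"
proof -
  have "(\<lambda>x. x) \<in> measurable M (F T)"
    using sets_F_events[of T] by (intro measurableI) (auto simp: sets.Int_space_eq2 subset_iff)
  then have "(\<lambda>p. (fst p, snd p)) \<in> measurable (time_scenario 0 T) (leb 0 T \<Otimes>\<^sub>M F T)"
    by (intro measurable_Pair measurable_fst measurable_compose[OF measurable_snd])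
  from measurable_compose[OF this assms] show ?thesis by simp
qed

lemma L2_rv_sq_integrable: "X \<in> L2_rv M (F T) \<Longrightarrow> sq_integrable M X"
  unfolding L2_rv_def sq_integrable_def mem_Collect_eq by (blast intro: measurable_F_M)

lemma L2_meas_sq_integrable:
  "X \<in> L2_meas M F T \<Longrightarrow> sq_integrable (time_scenario 0 T) (\<lambda>(r, w). X r w)"
  unfolding L2_meas_def sq_integrable_def mem_Collect_eq case_prod_unfold
  by (blast intro: measurable_leb_F_M)

lemma C_L2D:
  fixes X :: "real \<Rightarrow> 'w \<Rightarrow> 'h::euclidean_space"
  assumes X: "X \<in> C_L2 M F T"
  shows "\<And>t. t \<in> {0..T} \<Longrightarrow> sq_integrable M (X t)"
    "\<exists>C. \<forall>t\<in>{0..T}. (LINT w|M. (norm (X t w))\<^sup>2) \<le> C"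
    "sq_integrable (time_scenario 0 T) (\<lambda>(r, w). X r w)"
proof -
  show 1: "\<And>t. t \<in> {0..T} \<Longrightarrow> sq_integrable M (X t)"
    using X by (auto simp: C_L2_def intro: L2_rv_sq_integrable)
  obtain C where C: "\<And>t. t \<in> {0..T} \<Longrightarrow> (LINT w|M. (norm (X t w))\<^sup>2) \<le> C"
    using bounded_C_L2_norm[of T M X] 1 X by (auto simp: C_L2_def)
  then show "\<exists>C. \<forall>t\<in>{0..T}. (LINT w|M. (norm (X t w))\<^sup>2) \<le> C" by blast
  have "(\<lambda>(r, w). X r w) \<in> borel_measurable (time_scenario 0 T)"
    using X by (intro measurable_leb_F_M) (simp add: C_L2_def)
  from sq_integrable_pairI[OF finite_measure_leb this 1 C]
  show "sq_integrable (time_scenario 0 T) (\<lambda>(r, w). X r w)" by simp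
qed

text \<open>
  A jointly measurable version of the conditional expectations inherits the uniform bound in
  \<open>L\<^sup>2\<close>, so Fubini applies to it.
\<close>

lemma cond_exp_process_sq_integrable:
  fixes X P :: "real \<Rightarrow> 'w \<Rightarrow> real^'m"
  assumes P: "cond_exp_process M G a b X P"
    and G: "\<And>s. s \<in> {a..b} \<Longrightarrow> subalgebra M (G s)"
    and X: "\<And>s. s \<in> {a..b} \<Longrightarrow> sq_integrable M (X s)"
      "\<And>s. s \<in> {a..b} \<Longrightarrow> (LINT w|M. (norm (X s w))\<^sup>2) \<le> C"
  shows "sq_integrable (time_scenario a b) (\<lambda>(s, w). P s w)"
proof (rule sq_integrable_pairI[OF finite_measure_leb])
  show m: "(\<lambda>(s, w). P s w) \<in> borel_measurable (time_scenario a b)"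
    using P by (simp add: cond_exp_process_def)
  fix s assume "s \<in> space (leb a b)"
  then have s: "s \<in> {a..b}" by simp
  have eq: "AE w in M. P s w = vec_cond_exp M (G s) (X s) w"
    using P s by (simp add: cond_exp_process_def)
  have Pm: "P s \<in> borel_measurable M"
    using measurable_compose_Pair1[OF _ m, of s] s by simp
  note V = vec_cond_exp_sq_integrable[OF G[OF s] X(1)[OF s]]
  show "sq_integrable M (P s)" by (rule sq_integrable_cong_AE[OF eq Pm V(1)])
  have "(LINT w|M. (norm (P s w))\<^sup>2) = (LINT w|M. (norm (vec_cond_exp M (G s) (X s) w))\<^sup>2)"
    using eq Pm sq_integrable_measurable[OF V(1)] by (intro integral_cong_AE) auto
  also have "\<dots> \<le> (LINT w|M. (norm (X s w))\<^sup>2)" by (rule V(2))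
  also have "\<dots> \<le> C" by (rule X(2)[OF s])
  finally show "(LINT w|M. (norm (P s w))\<^sup>2) \<le> C" .
qed

lemma cond_exp_process_inner:
  fixes X P :: "real \<Rightarrow> 'w \<Rightarrow> real^'m"
  assumes P: "cond_exp_process M G a b X P" and s: "s \<in> {a..b}"
    and G: "subalgebra M (G s)" and X: "sq_integrable M (X s)"
    and V: "V \<in> borel_measurable (G s)" "sq_integrable M V"
  shows "(LINT w|M. P s w \<bullet> V w) = (LINT w|M. X s w \<bullet> V w)"
proof -
  have m: "(\<lambda>(s, w). P s w) \<in> borel_measurable (time_scenario a b)"
    and eq: "AE w in M. P s w = vec_cond_exp M (G s) (X s) w"
    using P s by (simp_all add: cond_exp_process_def)
  have [measurable]: "P s \<in> borel_measurable M"
    using measurable_compose_Pair1[OF _ m, of s] s by simp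
  note [measurable] = sq_integrable_measurable[OF V(2)]
    sq_integrable_measurable[OF vec_cond_exp_sq_integrable(1)[OF G X]]
  have "(LINT w|M. P s w \<bullet> V w) = (LINT w|M. vec_cond_exp M (G s) (X s) w \<bullet> V w)"
    using eq by (intro integral_cong_AE) auto
  with vec_cond_exp_inner[OF G X V] show ?thesis by simp
qed

section \<open>Pairing Ito integrals over different intervals\<close>

lemma ito_isometry_subintervals:
  fixes f g :: "real \<Rightarrow> 'w \<Rightarrow> 'h::euclidean_space"
  assumes ab: "0 \<le> a" "a \<le> b" "b \<le> T" and cd: "0 \<le> c" "c \<le> d" "d \<le> T"
    and f: "has_ito_integral M F W a b f X" and g: "has_ito_integral M F W c d g Y"
  shows "(LINT w|M. X w \<bullet> Y w) = (LINT p|(time_scenario 0 T).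
    indicat_real {a..b} (fst p) * indicat_real {c..d} (fst p) * (f (fst p) (snd p) \<bullet> g (fst p) (snd p)))"
  using ito_isometry[OF has_ito_integral_extend[OF ab f] has_ito_integral_extend[OF cd g]]
  by (simp add: case_prod_unfold mult.assoc mult.left_commute)

lemma integral_leb_pair_subinterval:
  fixes h :: "real \<times> 'w \<Rightarrow> real"
  assumes "c \<le> a" "b \<le> d"
  shows "(LINT p|(time_scenario c d). indicat_real {a..b} (fst p) * h p) = (LINT p|(time_scenario a b). h p)"
  unfolding leb_pair_eq_restrict_space[OF assms]
  by (subst integral_restrict_space[OF leb_rectangle_sets[OF assms]])
     (auto intro!: Bochner_Integration.integral_cong simp: space_pair_measure indicator_def)

lemma ito_isometry_interval:
  fixes f g :: "real \<Rightarrow> 'w \<Rightarrow> 'h::euclidean_space"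
  assumes ab: "0 \<le> a" "a \<le> b" "b \<le> T"
    and f: "has_ito_integral M F W a b f X" and g: "has_ito_integral M F W a b g Y"
  shows "(LINT w|M. X w \<bullet> Y w) = (LINT s|leb a b. LINT w|M. f s w \<bullet> g s w)"
proof -
  have ab': "0 \<le> a" "b \<le> T" using ab by auto
  have idem: "indicat_real {a..b} x * indicat_real {a..b} x = indicat_real {a..b} x" for x
    by (simp add: indicator_def)
  show ?thesis
    unfolding ito_isometry_subintervals[OF ab ab f g] idem integral_leb_pair_subinterval[OF ab']
      integrable_time_expectation(2)[OF has_ito_integral_sq_integrable(1)[OF ab' f]
        has_ito_integral_sq_integrable(1)[OF ab' g]]
    by (simp add: case_prod_unfold)
qed

lemma AE_time_neq: "AE p in time_scenario 0 T. fst p \<noteq> t"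
proof -
  interpret P: pair_sigma_finite "leb 0 T" M by (rule pair_sigma_finite_leb)
  have [measurable]: "fst \<in> borel_measurable (time_scenario 0 T)"
    by (rule measurable_compose[OF measurable_fst]) (simp add: measurable_restrict_space1)
  have "AE s in leb 0 T. s \<noteq> t"
    using AE_lborel_singleton[of t] by (subst AE_restrict_space_iff) auto
  then show ?thesis
    by (intro P.AE_pair_measure) auto
qed

text \<open>
  Extended to \<open>[0,T]\<close>, the integrands overlap at most at time \<open>t\<close>.
\<close>

lemma ito_integral_adjacent_orthogonal:
  fixes f g :: "real \<Rightarrow> 'w \<Rightarrow> 'h::euclidean_space"
  assumes t: "0 \<le> t" "t \<le> T"
    and f: "has_ito_integral M F W 0 t f X" and g: "has_ito_integral M F W t T g Y"
  shows "(LINT w|M. X w \<bullet> Y w) = 0"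
proof -
  have "AE p in time_scenario 0 T.
    indicat_real {0..t} (fst p) * indicat_real {t..T} (fst p) * (f (fst p) (snd p) \<bullet> g (fst p) (snd p)) = 0"
    using AE_time_neq[of t] by eventually_elim (auto simp: indicator_def)
  then show ?thesis
    unfolding ito_isometry_subintervals[OF order_refl t t order_refl f g] by (rule integral_eq_zero_AE)
qed

text \<open>
  The sum of the integrals of \<open>g\<close> over \<open>[0,t]\<close> and \<open>[t,T]\<close> acts like its integral over
  \<open>[0,T]\<close>: the two indicators add up to \<open>1\<close> except at \<open>t\<close>.
\<close>

lemma ito_isometry_split:
  fixes f g :: "real \<Rightarrow> 'w \<Rightarrow> 'h::euclidean_space"
  assumes t: "0 \<le> t" "t \<le> T"
    and f: "has_ito_integral M F W 0 T f X"
    and g: "has_ito_integral M F W 0 t g Y\<^sub>1" "has_ito_integral M F W t T g Y\<^sub>2"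
    and g2: "sq_integrable (time_scenario 0 T) (\<lambda>(s, w). g s w)"
  shows "(LINT w|M. X w \<bullet> Y\<^sub>1 w) + (LINT w|M. X w \<bullet> Y\<^sub>2 w) = (LINT s|leb 0 T. LINT w|M. f s w \<bullet> g s w)"
proof -
  have T: "0 \<le> T" using T_pos by simp
  note f2 = has_ito_integral_sq_integrable(1)[OF order_refl order_refl f]
  let ?h = "\<lambda>p. f (fst p) (snd p) \<bullet> g (fst p) (snd p)"
  have h: "integrable (time_scenario 0 T) ?h"
    using sq_integrable_inner[OF f2 g2] by (simp add: case_prod_unfold)
  have hi: "integrable (time_scenario 0 T)
    (\<lambda>p. indicat_real {0..T} (fst p) * indicat_real {c..d} (fst p) * ?h p)" for c d
  proof (rule Bochner_Integration.integrable_bound[OF h])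
    have [measurable]: "fst \<in> borel_measurable (time_scenario 0 T)"
      by (rule measurable_compose[OF measurable_fst]) (simp add: measurable_restrict_space1)
    note [measurable] = borel_measurable_integrable[OF h]
    show "(\<lambda>p. indicat_real {0..T} (fst p) * indicat_real {c..d} (fst p) * ?h p) \<in> borel_measurable (time_scenario 0 T)"
      by measurable
  qed (auto simp: indicator_def)
  have "(LINT w|M. X w \<bullet> Y\<^sub>1 w) + (LINT w|M. X w \<bullet> Y\<^sub>2 w)
    = (LINT p|(time_scenario 0 T). indicat_real {0..T} (fst p) * indicat_real {0..t} (fst p) * ?h p
        + indicat_real {0..T} (fst p) * indicat_real {t..T} (fst p) * ?h p)"
    unfolding ito_isometry_subintervals[OF order_refl T order_refl order_refl t f g(1)]
      ito_isometry_subintervals[OF order_refl T order_refl t order_refl f g(2)]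
    using hi by (intro Bochner_Integration.integral_add[symmetric])
  also have "\<dots> = (LINT p|(time_scenario 0 T). ?h p)"
  proof (rule integral_cong_AE)
    show "(\<lambda>p. indicat_real {0..T} (fst p) * indicat_real {0..t} (fst p) * ?h p
        + indicat_real {0..T} (fst p) * indicat_real {t..T} (fst p) * ?h p) \<in> borel_measurable (time_scenario 0 T)"
      using hi[THEN borel_measurable_integrable] by (intro borel_measurable_add)
    show "?h \<in> borel_measurable (time_scenario 0 T)" by (rule borel_measurable_integrable[OF h])
    show "AE p in time_scenario 0 T. indicat_real {0..T} (fst p) * indicat_real {0..t} (fst p) * ?h p
        + indicat_real {0..T} (fst p) * indicat_real {t..T} (fst p) * ?h p = ?h p"
      using AE_time_neq[of t] AE_space
      by eventually_elim (use t in \<open>auto simp: indicator_def space_pair_measure\<close>)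
  qed
  also have "\<dots> = (LINT s|leb 0 T. LINT w|M. f s w \<bullet> g s w)"
    unfolding integrable_time_expectation(2)[OF f2 g2] by (simp add: case_prod_unfold)
  finally show ?thesis .
qed

end

section \<open>The duality at a fixed time\<close>

lemma set_integral_leb:
  fixes f :: "real \<Rightarrow> 'b::{banach, second_countable_topology}"
  shows "(LINT s:{a..b}|lborel. f s) = (LINT s|leb a b. f s)"
  unfolding set_lebesgue_integral_def by (subst integral_restrict_space) auto

lemma AE_leb_subinterval:
  assumes "AE s in leb c d. P s" "c \<le> a" "b \<le> d"
  shows "AE s in leb a b. P s"
proof -
  have "AE s in lborel. s \<in> {c..d} \<longrightarrow> P s"
    using assms(1) by (subst (asm) AE_restrict_space_iff) auto
  then have "AE s in lborel. s \<in> {a..b} \<longrightarrow> P s"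
    by eventually_elim (use assms in auto)
  then show ?thesis by (subst AE_restrict_space_iff) auto
qed

lemma AE_leb_singleton: "AE s in leb t t. P s"
proof -
  have "AE s in lborel. s \<in> {t..t} \<longrightarrow> P s"
    using AE_lborel_singleton[of t] by eventually_elim simp
  then show ?thesis by (subst AE_restrict_space_iff) auto
qed

lemma integral_leb_singleton: "(LINT s|leb t t. f s) = 0"
  by (rule integral_eq_zero_AE) (rule AE_leb_singleton)

lemma sq_integrable_leb_subinterval:
  assumes "prob_space M" and f: "sq_integrable (leb c d \<Otimes>\<^sub>M M) f" and "c \<le> a" "b \<le> d"
  shows "sq_integrable (leb a b \<Otimes>\<^sub>M M) f"
proof -
  interpret prob_space M by fact
  have m: "f \<in> borel_measurable (leb a b \<Otimes>\<^sub>M M)"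
    by (rule measurable_leb_pair_subinterval[OF assms(3,4) sq_integrable_measurable[OF f]])
  have "(\<integral>\<^sup>+p. ennreal ((norm (f p))\<^sup>2) \<partial>(leb a b \<Otimes>\<^sub>M M))
    = (\<integral>\<^sup>+p. ennreal ((norm (f p))\<^sup>2) * indicator ({a..b} \<times> space M) p \<partial>(leb c d \<Otimes>\<^sub>M M))"
    unfolding leb_pair_eq_restrict_space[OF assms(3,4)]
    by (rule nn_integral_restrict_space[OF leb_rectangle_sets[OF assms(3,4)]])
  also have "\<dots> \<le> (\<integral>\<^sup>+p. ennreal ((norm (f p))\<^sup>2) \<partial>(leb c d \<Otimes>\<^sub>M M))"
    by (intro nn_integral_mono) (simp add: indicator_def)
  also have "\<dots> < \<infinity>" using f by (simp add: sq_integrable_iff_nn_integral)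
  finally show ?thesis unfolding sq_integrable_iff_nn_integral using m by simp
qed

lemma sq_integrable_pair_matrix_vector:
  fixes A :: "real \<Rightarrow> 'w \<Rightarrow> real^'n^'m"
  assumes A: "(\<lambda>(s, w). A s w) \<in> borel_measurable (leb a b \<Otimes>\<^sub>M M)"
    and K: "\<And>s w. s \<in> {a..b} \<Longrightarrow> w \<in> space M \<Longrightarrow> norm (A s w) \<le> K"
    and f: "sq_integrable (leb a b \<Otimes>\<^sub>M M) (\<lambda>(s, w). f s w)"
  shows "sq_integrable (leb a b \<Otimes>\<^sub>M M) (\<lambda>(s, w). A s w *v f s w)"
proof -
  have "sq_integrable (leb a b \<Otimes>\<^sub>M M)
    (\<lambda>p. (case p of (s, w) \<Rightarrow> A s w) *v (case p of (s, w) \<Rightarrow> f s w))"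
    by (rule sq_integrable_matrix_vector[where K=K, OF A _ f])
       (use K in \<open>auto intro!: AE_I2 simp: space_pair_measure\<close>)
  then show ?thesis by (simp add: case_prod_unfold)
qed

context wiener_space
begin

lemma adaptedD: "adapted F T X \<Longrightarrow> 0 \<le> s \<Longrightarrow> s \<le> T \<Longrightarrow> X s \<in> borel_measurable (F s)"
  by (simp add: adapted_def)

lemma sq_integrable_coefficient_pair:
  fixes A :: "real \<Rightarrow> real \<Rightarrow> 'w \<Rightarrow> real^'n^'k"
  assumes A: "bounded_coefficient M T A" and t: "t \<in> {0..T}" and ab: "0 \<le> a" "b \<le> T"
    and f: "sq_integrable (time_scenario a b) (\<lambda>(s, w). f s w)"
  shows "sq_integrable (time_scenario a b) (\<lambda>(s, w). A s t w *v f s w)"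
    "sq_integrable (time_scenario a b) (\<lambda>(s, w). A t s w *v f s w)"
proof -
  obtain K where K: "\<And>s r w. s \<in> {0..T} \<Longrightarrow> r \<in> {0..T} \<Longrightarrow> w \<in> space M \<Longrightarrow> norm (A s r w) \<le> K"
    using bounded_coefficient_bound[OF A] by blast
  note m = bounded_coefficientD(1,2)[OF A t, THEN measurable_leb_pair_subinterval[OF ab]]
  show "sq_integrable (time_scenario a b) (\<lambda>(s, w). A s t w *v f s w)"
    by (rule sq_integrable_pair_matrix_vector[where K=K, OF m(2) _ f]) (use K t ab in auto)
  show "sq_integrable (time_scenario a b) (\<lambda>(s, w). A t s w *v f s w)"
    by (rule sq_integrable_pair_matrix_vector[where K=K, OF m(1) _ f]) (use K t ab in auto)
qed

text \<open>
  For almost every \<open>s\<close> the integrand \<open>A(s,t)\<^sup>T E\<^sub>t[\<xi>(s)]\<close> is known at time \<open>t\<close>.  Therefore it is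
  orthogonal to the stochastic integral \<open>I\<close> over \<open>[t,T]\<close>, and in the pairing with \<open>V\<close> the conditional
  expectation may be dropped after moving \<open>A(s,t)\<close> to the side of \<open>V\<close>.
\<close>

lemma drift_pairing:
  fixes \<xi> P g :: "real \<Rightarrow> 'w \<Rightarrow> real^'m" and A :: "real \<Rightarrow> real \<Rightarrow> 'w \<Rightarrow> real^'m^'m"
  assumes t: "0 \<le> t" "t \<le> T" and \<xi>: "\<xi> \<in> C_L2 M F T"
    and A: "bounded_coefficient M T A" "AE s in leb 0 t. A s t \<in> borel_measurable (F t)"
    and P: "cond_exp_process M (\<lambda>_. F t) 0 t \<xi> P"
    and V: "V \<in> borel_measurable (F t)" "sq_integrable M V"
    and Ito: "has_ito_integral M F W t T g I"
  shows "integrable M (\<lambda>w. (LINT s|leb 0 t. transpose (A s t w) *v P s w) \<bullet> (V w + I w))"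
    "(LINT w|M. (LINT s|leb 0 t. transpose (A s t w) *v P s w) \<bullet> (V w + I w))
      = (LINT s|leb 0 t. LINT w|M. \<xi> s w \<bullet> (A s t w *v V w))"
    "integrable (leb 0 t) (\<lambda>s. LINT w|M. \<xi> s w \<bullet> (A s t w *v V w))"
proof -
  note I = has_ito_integral_sq_integrable(2)[OF t(1) order_refl Ito]
  note orth = ito_integral_orthogonal_past[OF t(1) order_refl Ito]
  note F = subalgebra_F[OF t(2)]
  obtain K where K: "\<And>s r w. s \<in> {0..T} \<Longrightarrow> r \<in> {0..T} \<Longrightarrow> w \<in> space M \<Longrightarrow> norm (A s r w) \<le> K"
    using bounded_coefficient_bound[OF A(1)] by blast
  obtain C where C: "\<And>t. t \<in> {0..T} \<Longrightarrow> (LINT w|M. (norm (\<xi> t w))\<^sup>2) \<le> C"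
    using C_L2D(2)[OF \<xi>] by blast
  have tT: "t \<in> {0..T}" using t by simp
  have Am: "(\<lambda>(s, w). A s t w) \<in> borel_measurable (time_scenario 0 t)"
    by (rule measurable_leb_pair_subinterval[OF order_refl t(2) bounded_coefficientD(2)[OF A(1) tT]])
  have ATm: "(\<lambda>(s, w). transpose (A s t w)) \<in> borel_measurable (time_scenario 0 t)"
    using borel_measurable_transpose[OF Am] by (simp add: case_prod_unfold)
  have Ps: "sq_integrable (time_scenario 0 t) (\<lambda>(s, w). P s w)"
    by (rule cond_exp_process_sq_integrable[where C=C, OF P F]) (use C_L2D(1)[OF \<xi>] C t in auto)
  have h: "sq_integrable (time_scenario 0 t) (\<lambda>(s, w). transpose (A s t w) *v P s w)"
    by (rule sq_integrable_pair_matrix_vector[where K=K, OF ATm _ Ps]) (use K t in \<open>auto simp: norm_transpose\<close>)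
  have U: "sq_integrable M (\<lambda>w. V w + I w)" by (rule sq_integrable_add[OF V(2) I])
  note 1 = integral_time_inner[OF h U]
  show "integrable M (\<lambda>w. (LINT s|leb 0 t. transpose (A s t w) *v P s w) \<bullet> (V w + I w))"
    by (rule 1(1))
  have \<xi>t: "sq_integrable (time_scenario 0 t) (\<lambda>(s, w). \<xi> s w)"
    by (rule sq_integrable_leb_subinterval[OF prob_space_axioms C_L2D(3)[OF \<xi>] order_refl t(2)])
  note AV = sq_integrable_coefficient_pair(1)[OF A(1) tT order_refl t(2) sq_integrable_lift[OF finite_measure_leb V(2)]]
  note i2 = integrable_time_expectation(1)[OF \<xi>t AV]
  show "integrable (leb 0 t) (\<lambda>s. LINT w|M. \<xi> s w \<bullet> (A s t w *v V w))" by (rule i2)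
  note i1 = integrable_time_expectation(1)[OF h sq_integrable_lift[OF finite_measure_leb U]]
  have "AE s in leb 0 t. (LINT w|M. (transpose (A s t w) *v P s w) \<bullet> (V w + I w))
      = (LINT w|M. \<xi> s w \<bullet> (A s t w *v V w))"
    using A(2) AE_space
  proof eventually_elim
    case (elim s)
    then have s: "s \<in> {0..t}" "s \<in> {0..T}" using t by auto
    note [measurable] = elim(1) V(1)
    have bA: "AE w in M. norm (A s t w) \<le> K" "AE w in M. norm (transpose (A s t w)) \<le> K"
      using K s tT by (auto intro!: AE_I2 simp: norm_transpose)
    have AM[measurable]: "A s t \<in> borel_measurable M" by (rule bounded_coefficientD(3)[OF A(1) s(2) tT])
    have ATM: "(\<lambda>w. transpose (A s t w)) \<in> borel_measurable M" by measurable
    have \<xi>s: "sq_integrable M (\<xi> s)" by (rule C_L2D(1)[OF \<xi> s(2)])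
    let ?E = "vec_cond_exp M (F t) (\<xi> s)"
    have eq: "AE w in M. P s w = ?E w" using P s by (simp add: cond_exp_process_def)
    have E: "sq_integrable M ?E" by (rule vec_cond_exp_sq_integrable(1)[OF F \<xi>s])
    have EF[measurable]: "?E \<in> borel_measurable (F t)" by (rule vec_cond_exp_measurable)
    have ATE: "sq_integrable M (\<lambda>w. transpose (A s t w) *v ?E w)"
      by (rule sq_integrable_matrix_vector[OF ATM bA(2) E])
    have AVs: "sq_integrable M (\<lambda>w. A s t w *v V w)"
      by (rule sq_integrable_matrix_vector[OF AM bA(1) V(2)])
    have ATEF: "(\<lambda>w. transpose (A s t w) *v ?E w) \<in> borel_measurable (F t)"
      by measurable
    have AVF: "(\<lambda>w. A s t w *v V w) \<in> borel_measurable (F t)" by measurable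
    have [measurable]: "P s \<in> borel_measurable M"
      using measurable_compose_Pair1[OF _ sq_integrable_measurable[OF Ps], of s] s by simp
    note [measurable] = sq_integrable_measurable[OF U] sq_integrable_measurable[OF E]
    have "(LINT w|M. (transpose (A s t w) *v P s w) \<bullet> (V w + I w))
      = (LINT w|M. (transpose (A s t w) *v ?E w) \<bullet> (V w + I w))"
    proof (rule integral_cong_AE)
      show "AE w in M. (transpose (A s t w) *v P s w) \<bullet> (V w + I w)
        = (transpose (A s t w) *v ?E w) \<bullet> (V w + I w)"
        using eq by eventually_elim simp
    qed measurable
    also have "\<dots> = (LINT w|M. (transpose (A s t w) *v ?E w) \<bullet> V w)
        + (LINT w|M. (transpose (A s t w) *v ?E w) \<bullet> I w)"
      unfolding inner_add_right
      by (rule Bochner_Integration.integral_add[OF sq_integrable_inner[OF ATE V(2)] sq_integrable_inner[OF ATE I]])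
    also have "\<dots> = (LINT w|M. ?E w \<bullet> (A s t w *v V w))"
      by (subst orth[OF ATEF ATE]) (simp only: add_0_right transpose_mult_inner)
    also have "\<dots> = (LINT w|M. \<xi> s w \<bullet> (A s t w *v V w))"
      by (rule vec_cond_exp_inner[OF F \<xi>s AVF AVs])
    finally show ?case .
  qed
  then have "(LINT s|leb 0 t. LINT w|M. (transpose (A s t w) *v P s w) \<bullet> (V w + I w))
    = (LINT s|leb 0 t. LINT w|M. \<xi> s w \<bullet> (A s t w *v V w))"
    using borel_measurable_integrable[OF i1] borel_measurable_integrable[OF i2]
    by (intro integral_cong_AE) auto
  with 1(2) show "(LINT w|M. (LINT s|leb 0 t. transpose (A s t w) *v P s w) \<bullet> (V w + I w))
      = (LINT s|leb 0 t. LINT w|M. \<xi> s w \<bullet> (A s t w *v V w))" by simp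
qed

text \<open>
  By the isometry the two integrands are paired at each time \<open>s\<close>.  There \<open>g s\<close> is known, so the
  conditional expectation in \<open>Q s\<close> may be dropped.
\<close>

lemma cond_exp_before_pairing:
  fixes \<xi> Q g :: "real \<Rightarrow> 'w \<Rightarrow> real^'m" and B :: "real \<Rightarrow> real \<Rightarrow> 'w \<Rightarrow> real^'m^'m"
  assumes t: "0 \<le> t" "t \<le> T" and \<xi>: "\<xi> \<in> C_L2 M F T" and B: "bounded_coefficient M T B"
    and Q: "cond_exp_process M F 0 t (\<lambda>s w. transpose (B s t w) *v \<xi> s w) Q"
    and I: "has_ito_integral M F W 0 t Q I\<^sub>1" "has_ito_integral M F W 0 t g I\<^sub>0"
    and g: "adapted F T g"
  shows "(LINT w|M. I\<^sub>1 w \<bullet> I\<^sub>0 w) = (LINT s|leb 0 t. LINT w|M. \<xi> s w \<bullet> (B s t w *v g s w))"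
    "integrable (leb 0 t) (\<lambda>s. LINT w|M. \<xi> s w \<bullet> (B s t w *v g s w))"
proof -
  obtain K where K: "\<And>s r w. s \<in> {0..T} \<Longrightarrow> r \<in> {0..T} \<Longrightarrow> w \<in> space M \<Longrightarrow> norm (B s r w) \<le> K"
    using bounded_coefficient_bound[OF B(1)] by blast
  have tT: "t \<in> {0..T}" using t by simp
  note Q2 = has_ito_integral_sq_integrable(1)[OF order_refl t(2) I(1)]
  note g2 = has_ito_integral_sq_integrable(1)[OF order_refl t(2) I(2)]
  have \<xi>t: "sq_integrable (time_scenario 0 t) (\<lambda>(s, w). \<xi> s w)"
    by (rule sq_integrable_leb_subinterval[OF prob_space_axioms C_L2D(3)[OF \<xi>] order_refl t(2)])
  note Bg = sq_integrable_coefficient_pair(1)[OF B tT order_refl t(2) g2]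
  note i1 = integrable_time_expectation(1)[OF Q2 g2] and i2 = integrable_time_expectation(1)[OF \<xi>t Bg]
  show "integrable (leb 0 t) (\<lambda>s. LINT w|M. \<xi> s w \<bullet> (B s t w *v g s w))" by (rule i2)
  have "AE s in leb 0 t. (LINT w|M. Q s w \<bullet> g s w) = (LINT w|M. \<xi> s w \<bullet> (B s t w *v g s w))"
    using AE_sq_integrable_section[OF g2] AE_space
  proof eventually_elim
    case (elim s)
    then have s: "s \<in> {0..t}" "s \<in> {0..T}" using t by auto
    have BM[measurable]: "B s t \<in> borel_measurable M" by (rule bounded_coefficientD(3)[OF B s(2) tT])
    have "sq_integrable M (\<lambda>w. transpose (B s t w) *v \<xi> s w)"
      by (rule sq_integrable_matrix_vector[where K=K, OF _ _ C_L2D(1)[OF \<xi> s(2)]], measurable)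
         (use K s tT in \<open>auto simp: norm_transpose\<close>)
    from cond_exp_process_inner[OF Q s(1) subalgebra_F this adaptedD[OF g] elim(1)] s
    show ?case unfolding transpose_mult_inner by simp
  qed
  then show "(LINT w|M. I\<^sub>1 w \<bullet> I\<^sub>0 w) = (LINT s|leb 0 t. LINT w|M. \<xi> s w \<bullet> (B s t w *v g s w))"
    unfolding ito_isometry_interval[OF order_refl t I]
    using borel_measurable_integrable[OF i1] borel_measurable_integrable[OF i2]
    by (intro integral_cong_AE) auto
qed

text \<open>
  As before, except that the coefficient stands outside the conditional expectation.  It has to be
  known at time \<open>s\<close> for \<open>D t s *v g s\<close> to be a test variable.
\<close>

lemma cond_exp_after_pairing:
  fixes \<xi> R g :: "real \<Rightarrow> 'w \<Rightarrow> real^'m" and D :: "real \<Rightarrow> real \<Rightarrow> 'w \<Rightarrow> real^'m^'m"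
  assumes t: "0 \<le> t" "t \<le> T" and \<xi>: "sq_integrable M (\<xi> t)"
    and D: "bounded_coefficient M T D" "AE s in leb t T. D t s \<in> borel_measurable (F s)"
    and R: "cond_exp_process M F t T (\<lambda>_. \<xi> t) R"
    and I: "has_ito_integral M F W t T (\<lambda>s w. transpose (D t s w) *v R s w) I\<^sub>3" "has_ito_integral M F W t T g I"
    and g: "adapted F T g"
  shows "(LINT w|M. I\<^sub>3 w \<bullet> I w) = (LINT s|leb t T. LINT w|M. \<xi> t w \<bullet> (D t s w *v g s w))"
proof -
  have tT: "t \<in> {0..T}" using t by simp
  note R2 = has_ito_integral_sq_integrable(1)[OF t(1) order_refl I(1)]
  note g2 = has_ito_integral_sq_integrable(1)[OF t(1) order_refl I(2)]
  note Dg = sq_integrable_coefficient_pair(2)[OF D(1) tT t(1) order_refl g2]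
  note i1 = integrable_time_expectation(1)[OF R2 g2]
  note i2 = integrable_time_expectation(1)[OF sq_integrable_lift[OF finite_measure_leb \<xi>] Dg]
  have "AE s in leb t T. (LINT w|M. (transpose (D t s w) *v R s w) \<bullet> g s w)
      = (LINT w|M. \<xi> t w \<bullet> (D t s w *v g s w))"
    using AE_sq_integrable_section[OF Dg] AE_space D(2)
  proof eventually_elim
    case (elim s)
    then have s: "s \<in> {t..T}" "0 \<le> s" "s \<le> T" using t by auto
    note [measurable] = elim(3) adaptedD[OF g s(2,3)]
    have "(\<lambda>w. D t s w *v g s w) \<in> borel_measurable (F s)" by measurable
    from cond_exp_process_inner[OF R s(1) subalgebra_F[OF s(3)] \<xi> this elim(1)]
    show ?case unfolding transpose_mult_inner .
  qed
  then show ?thesis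
    unfolding ito_isometry_interval[OF t order_refl I]
    using borel_measurable_integrable[OF i1] borel_measurable_integrable[OF i2]
    by (intro integral_cong_AE) auto
qed

definition forward_equation ::
  "(real \<Rightarrow> real \<Rightarrow> 'w \<Rightarrow> real^'m^'m) \<Rightarrow> (real \<Rightarrow> real \<Rightarrow> 'w \<Rightarrow> real^'m^'m) \<Rightarrow> (real \<Rightarrow> real \<Rightarrow> 'w \<Rightarrow> real^'m^'m) \<Rightarrow>
    (real \<Rightarrow> 'w \<Rightarrow> real^'m) \<Rightarrow> (real \<Rightarrow> real \<Rightarrow> 'w \<Rightarrow> real^'m) \<Rightarrow> (real \<Rightarrow> 'w \<Rightarrow> real^'m) \<Rightarrow> real \<Rightarrow> bool" where
  "forward_equation A B D \<alpha> \<beta> \<xi> t \<longleftrightarrow> (\<exists>P Q R I\<^sub>1 I\<^sub>2 I\<^sub>3.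
      cond_exp_process M (\<lambda>_. F t) 0 t \<xi> P \<and>
      cond_exp_process M F 0 t (\<lambda>s w. transpose (B s t w) *v \<xi> s w) Q \<and>
      cond_exp_process M F t T (\<lambda>_. \<xi> t) R \<and>
      has_ito_integral M F W 0 t Q I\<^sub>1 \<and>
      has_ito_integral M F W 0 T (\<beta> t) I\<^sub>2 \<and>
      has_ito_integral M F W t T (\<lambda>s w. transpose (D t s w) *v R s w) I\<^sub>3 \<and>
      (AE w in M. \<xi> t w = \<alpha> t w + (LINT s:{0..t}|lborel. transpose (A s t w) *v P s w)
         + I\<^sub>1 w + I\<^sub>2 w + I\<^sub>3 w))"

text \<open>
  The core of both identities.  The test variable is \<open>V + I\<close>, where \<open>V = v\<^sub>0 + \<integral>\<^sub>0\<^sup>t g dW\<close> is known at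
  time \<open>t\<close> and \<open>I = \<integral>\<^sub>t\<^sup>T g dW\<close> lies in its future, so that \<open>V + I = v\<^sub>0 + \<integral>\<^sub>0\<^sup>T g dW\<close>.  It is paired with
  the five terms of the equation for \<open>\<xi>\<close>: what is known at time \<open>t\<close> only sees \<open>V\<close>, and each Ito
  integral only sees the part of \<open>g\<close> over its own interval.
\<close>

lemma duality_at:
  fixes \<xi> \<alpha> g :: "real \<Rightarrow> 'w \<Rightarrow> real^'m" and \<beta> :: "real \<Rightarrow> real \<Rightarrow> 'w \<Rightarrow> real^'m"
    and A B D :: "real \<Rightarrow> real \<Rightarrow> 'w \<Rightarrow> real^'m^'m"
  assumes t: "0 \<le> t" "t \<le> T" and \<xi>: "\<xi> \<in> C_L2 M F T"
    and A: "bounded_coefficient M T A" "AE s in leb 0 t. A s t \<in> borel_measurable (F t)"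
    and B: "bounded_coefficient M T B"
    and D: "bounded_coefficient M T D" "AE s in leb t T. D t s \<in> borel_measurable (F s)"
    and \<alpha>: "\<alpha> t \<in> borel_measurable (F t)" "sq_integrable M (\<alpha> t)"
    and \<xi>_eq: "forward_equation A B D \<alpha> \<beta> \<xi> t"
    and V: "V \<in> borel_measurable (F t)" "sq_integrable M V"
    and g: "sq_integrable (time_scenario 0 T) (\<lambda>(s, w). g s w)" "adapted F T g"
    and v\<^sub>0: "v\<^sub>0 \<in> borel_measurable (F 0)"
    and I\<^sub>0: "has_ito_integral M F W 0 t g I\<^sub>0" "AE w in M. V w = v\<^sub>0 w + I\<^sub>0 w"
    and I: "has_ito_integral M F W t T g I"
  shows "(LINT w|M. \<xi> t w \<bullet> (V w + I w)) = (LINT w|M. \<alpha> t w \<bullet> V w)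
    + (LINT s|leb 0 t. LINT w|M. \<xi> s w \<bullet> (A s t w *v V w + B s t w *v g s w))
    + (LINT s|leb 0 T. LINT w|M. \<beta> t s w \<bullet> g s w)
    + (LINT s|leb t T. LINT w|M. \<xi> t w \<bullet> (D t s w *v g s w))"
proof -
  obtain P Q R I\<^sub>1 I\<^sub>2 I\<^sub>3 where
    P: "cond_exp_process M (\<lambda>_. F t) 0 t \<xi> P"
    and Q: "cond_exp_process M F 0 t (\<lambda>s w. transpose (B s t w) *v \<xi> s w) Q"
    and R: "cond_exp_process M F t T (\<lambda>_. \<xi> t) R"
    and I\<^sub>1: "has_ito_integral M F W 0 t Q I\<^sub>1"
    and I\<^sub>2: "has_ito_integral M F W 0 T (\<beta> t) I\<^sub>2"
    and I\<^sub>3: "has_ito_integral M F W t T (\<lambda>s w. transpose (D t s w) *v R s w) I\<^sub>3"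
    and eq: "AE w in M. \<xi> t w = \<alpha> t w + (LINT s:{0..t}|lborel. transpose (A s t w) *v P s w)
         + I\<^sub>1 w + I\<^sub>2 w + I\<^sub>3 w"
    using \<xi>_eq unfolding forward_equation_def by blast
  have \<xi>t: "sq_integrable M (\<xi> t)" using C_L2D(1)[OF \<xi>] t by simp
  note sI\<^sub>0 = has_ito_integral_sq_integrable(2)[OF order_refl t(2) I\<^sub>0(1)]
  note sI\<^sub>1 = has_ito_integral_sq_integrable(2)[OF order_refl t(2) I\<^sub>1]
  note sI\<^sub>2 = has_ito_integral_sq_integrable(2)[OF order_refl order_refl I\<^sub>2]
  note sI\<^sub>3 = has_ito_integral_sq_integrable(2)[OF t(1) order_refl I\<^sub>3]
  note sI = has_ito_integral_sq_integrable(2)[OF t(1) order_refl I]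
  have sv\<^sub>0: "sq_integrable M v\<^sub>0"
  proof (rule sq_integrable_cong_AE)
    show "AE w in M. v\<^sub>0 w = V w - I\<^sub>0 w" using I\<^sub>0(2) by eventually_elim simp
    show "v\<^sub>0 \<in> borel_measurable M" using measurable_F_M[OF v\<^sub>0] T_pos by simp
    show "sq_integrable M (\<lambda>w. V w - I\<^sub>0 w)" by (rule sq_integrable_diff[OF V(2) sI\<^sub>0])
  qed
  let ?U = "\<lambda>w. V w + I w" and ?d = "\<lambda>w. (LINT s|leb 0 t. transpose (A s t w) *v P s w)"
  have U: "sq_integrable M ?U" by (rule sq_integrable_add[OF V(2) sI])
  note orth = ito_integral_orthogonal_past[OF t(1) order_refl I]
  note drift = drift_pairing[OF t \<xi> A P V I]
  note before = cond_exp_before_pairing[OF t \<xi> B Q I\<^sub>1 I\<^sub>0(1) g(2)]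
  have plus: "(LINT w|M. X w \<bullet> ?U w) = (LINT w|M. X w \<bullet> V w) + (LINT w|M. X w \<bullet> I w)"
    if "sq_integrable M X" for X
    unfolding inner_add_right
    by (rule Bochner_Integration.integral_add[OF sq_integrable_inner[OF that V(2)] sq_integrable_inner[OF that sI]])
  have split: "(LINT w|M. X w \<bullet> V w) = (LINT w|M. X w \<bullet> v\<^sub>0 w) + (LINT w|M. X w \<bullet> I\<^sub>0 w)"
    if X: "sq_integrable M X" for X
  proof -
    have "(LINT w|M. X w \<bullet> V w) = (LINT w|M. X w \<bullet> v\<^sub>0 w + X w \<bullet> I\<^sub>0 w)"
      using I\<^sub>0(2) sq_integrable_measurable[OF X] sq_integrable_measurable[OF sv\<^sub>0]
        sq_integrable_measurable[OF sI\<^sub>0] sq_integrable_measurable[OF V(2)]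
      by (intro integral_cong_AE) (auto simp: inner_add_right)
    then show ?thesis
      using Bochner_Integration.integral_add[OF sq_integrable_inner[OF X sv\<^sub>0] sq_integrable_inner[OF X sI\<^sub>0]] by simp
  qed
  have \<alpha>U: "(LINT w|M. \<alpha> t w \<bullet> ?U w) = (LINT w|M. \<alpha> t w \<bullet> V w)"
    using plus[OF \<alpha>(2)] orth[OF \<alpha>] by simp
  have past\<^sub>0: "(LINT w|M. X w \<bullet> v\<^sub>0 w) = 0" if "has_ito_integral M F W 0 b f X" "b \<le> T" for f X b
    using ito_integral_orthogonal_past[OF order_refl that(2,1) v\<^sub>0 sv\<^sub>0] by (simp add: inner_commute)
  have 1: "(LINT w|M. I\<^sub>1 w \<bullet> ?U w) = (LINT s|leb 0 t. LINT w|M. \<xi> s w \<bullet> (B s t w *v g s w))"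
    unfolding plus[OF sI\<^sub>1] split[OF sI\<^sub>1] past\<^sub>0[OF I\<^sub>1 t(2)] before(1)
      ito_integral_adjacent_orthogonal[OF t I\<^sub>1 I] by simp
  have 2: "(LINT w|M. I\<^sub>2 w \<bullet> ?U w) = (LINT s|leb 0 T. LINT w|M. \<beta> t s w \<bullet> g s w)"
    unfolding plus[OF sI\<^sub>2] split[OF sI\<^sub>2] past\<^sub>0[OF I\<^sub>2 order_refl]
    using ito_isometry_split[OF t I\<^sub>2 I\<^sub>0(1) I g(1)] by simp
  have 3: "(LINT w|M. I\<^sub>3 w \<bullet> ?U w) = (LINT s|leb t T. LINT w|M. \<xi> t w \<bullet> (D t s w *v g s w))"
    unfolding plus[OF sI\<^sub>3] cond_exp_after_pairing[where \<xi>=\<xi> and D=D and t=t, OF t \<xi>t D R I\<^sub>3 I g(2)]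
    using ito_integral_orthogonal_past[OF t(1) order_refl I\<^sub>3 V] by (simp add: inner_commute)
  note i\<alpha> = sq_integrable_inner[OF \<alpha>(2) U] and i1 = sq_integrable_inner[OF sI\<^sub>1 U]
    and i2 = sq_integrable_inner[OF sI\<^sub>2 U] and i3 = sq_integrable_inner[OF sI\<^sub>3 U]
  have "(LINT w|M. \<xi> t w \<bullet> ?U w)
    = (LINT w|M. \<alpha> t w \<bullet> ?U w + ?d w \<bullet> ?U w + I\<^sub>1 w \<bullet> ?U w + I\<^sub>2 w \<bullet> ?U w + I\<^sub>3 w \<bullet> ?U w)"
  proof (rule integral_cong_AE)
    show "(\<lambda>w. \<xi> t w \<bullet> ?U w) \<in> borel_measurable M"
      using sq_integrable_inner[OF \<xi>t U] by (rule borel_measurable_integrable)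
    show "(\<lambda>w. \<alpha> t w \<bullet> ?U w + ?d w \<bullet> ?U w + I\<^sub>1 w \<bullet> ?U w + I\<^sub>2 w \<bullet> ?U w + I\<^sub>3 w \<bullet> ?U w)
      \<in> borel_measurable M"
      by (intro borel_measurable_add borel_measurable_integrable i\<alpha> i1 i2 i3 drift(1))
    show "AE w in M. \<xi> t w \<bullet> ?U w
      = \<alpha> t w \<bullet> ?U w + ?d w \<bullet> ?U w + I\<^sub>1 w \<bullet> ?U w + I\<^sub>2 w \<bullet> ?U w + I\<^sub>3 w \<bullet> ?U w"
      using eq by eventually_elim (simp add: set_integral_leb inner_add_left)
  qed
  also have "\<dots> = (LINT w|M. \<alpha> t w \<bullet> ?U w) + (LINT w|M. ?d w \<bullet> ?U w)
      + (LINT w|M. I\<^sub>1 w \<bullet> ?U w) + (LINT w|M. I\<^sub>2 w \<bullet> ?U w) + (LINT w|M. I\<^sub>3 w \<bullet> ?U w)"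
    using i\<alpha> i1 i2 i3 drift(1) by simp
  also have "\<dots> = (LINT w|M. \<alpha> t w \<bullet> V w)
      + ((LINT s|leb 0 t. LINT w|M. \<xi> s w \<bullet> (A s t w *v V w))
        + (LINT s|leb 0 t. LINT w|M. \<xi> s w \<bullet> (B s t w *v g s w)))
      + (LINT s|leb 0 T. LINT w|M. \<beta> t s w \<bullet> g s w)
      + (LINT s|leb t T. LINT w|M. \<xi> t w \<bullet> (D t s w *v g s w))"
    unfolding \<alpha>U 1 2 3 drift(2) by simp
  also have "(LINT s|leb 0 t. LINT w|M. \<xi> s w \<bullet> (A s t w *v V w))
        + (LINT s|leb 0 t. LINT w|M. \<xi> s w \<bullet> (B s t w *v g s w))
    = (LINT s|leb 0 t. LINT w|M. \<xi> s w \<bullet> (A s t w *v V w + B s t w *v g s w))"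
  proof -
    have tT: "t \<in> {0..T}" using t by simp
    note g0 = has_ito_integral_sq_integrable(1)[OF order_refl t(2) I\<^sub>0(1)]
    note AV = sq_integrable_coefficient_pair(1)[OF A(1) tT order_refl t(2) sq_integrable_lift[OF finite_measure_leb V(2)]]
    note Bg = sq_integrable_coefficient_pair(1)[OF B tT order_refl t(2) g0]
    have \<xi>0: "sq_integrable (time_scenario 0 t) (\<lambda>(s, w). \<xi> s w)"
      by (rule sq_integrable_leb_subinterval[OF prob_space_axioms C_L2D(3)[OF \<xi>] order_refl t(2)])
    show ?thesis by (rule integral_time_expectation_add[OF \<xi>0 AV Bg, symmetric])
  qed
  finally show ?thesis .
qed

end

section \<open>Triple integrals in two times and the scenario\<close>

context prob_space
begin

lemma pair_sigma_finite_leb2: "pair_sigma_finite (leb 0 T) (time_scenario 0 T)"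
  by (intro pair_sigma_finite.intro sigma_finite_leb finite_measure.axioms(1)[OF finite_measure_leb_pair])

lemma measurable_swap_times:
  "(\<lambda>(t, s, w). (s, t, w)) \<in> measurable (L1 \<Otimes>\<^sub>M L2 \<Otimes>\<^sub>M N) (L2 \<Otimes>\<^sub>M L1 \<Otimes>\<^sub>M N)"
  by measurable

text \<open>
  Exchanging the two times preserves the product measure.  This moves the exchange past
  integrability and integrals without any measurability of inner integrals.
\<close>

lemma distr_swap_times:
  "distr (time2_scenario T) (time2_scenario T) (\<lambda>(t, s, w). (s, t, w))
    = time2_scenario T" (is "distr ?N ?N ?sw = ?N")
proof (rule measure_eqI)
  interpret L: sigma_finite_measure "leb 0 T" by (rule sigma_finite_leb)
  interpret LL: pair_sigma_finite "leb 0 T" "leb 0 T"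
    by (intro pair_sigma_finite.intro sigma_finite_leb)
  interpret LM: sigma_finite_measure "time_scenario 0 T"
    by (rule finite_measure.axioms(1)[OF finite_measure_leb_pair])
  have sw: "?sw \<in> measurable ?N ?N" by (rule measurable_swap_times)
  fix X assume "X \<in> sets (distr ?N ?N ?sw)"
  then have X[measurable]: "X \<in> sets ?N" by simp
  have i: "indicator X \<in> borel_measurable ?N" by measurable
  have i': "(\<lambda>p. indicator X (?sw p) :: ennreal) \<in> borel_measurable ?N"
    by (rule measurable_compose[OF sw i])
  have f3: "(\<integral>\<^sup>+p. f p \<partial>?N) = (\<integral>\<^sup>+t. \<integral>\<^sup>+s. \<integral>\<^sup>+w. f (t, s, w) \<partial>M \<partial>leb 0 T \<partial>leb 0 T)"
    if [measurable]: "f \<in> borel_measurable ?N" for f :: "_ \<Rightarrow> ennreal"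
  proof -
    have "(\<integral>\<^sup>+p. f p \<partial>?N) = (\<integral>\<^sup>+t. \<integral>\<^sup>+q. f (t, q) \<partial>(time_scenario 0 T) \<partial>leb 0 T)"
      by (rule LM.nn_integral_fst[symmetric]) measurable
    also have "\<dots> = (\<integral>\<^sup>+t. \<integral>\<^sup>+s. \<integral>\<^sup>+w. f (t, s, w) \<partial>M \<partial>leb 0 T \<partial>leb 0 T)"
      by (intro nn_integral_cong nn_integral_fst[symmetric]) measurable
    finally show ?thesis .
  qed
  have m: "(\<lambda>(t, s). \<integral>\<^sup>+w. indicator X (s, t, w) \<partial>M) \<in> borel_measurable (leb 0 T \<Otimes>\<^sub>M leb 0 T)"
    by measurable
  have "emeasure (distr ?N ?N ?sw) X = (\<integral>\<^sup>+p. indicator X p \<partial>distr ?N ?N ?sw)" by simp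
  also have "\<dots> = (\<integral>\<^sup>+p. indicator X (?sw p) \<partial>?N)" by (rule nn_integral_distr[OF sw]) (simp add: i)
  also have "\<dots> = (\<integral>\<^sup>+t. \<integral>\<^sup>+s. \<integral>\<^sup>+w. indicator X (s, t, w) \<partial>M \<partial>leb 0 T \<partial>leb 0 T)"
    using f3[OF i'] by simp
  also have "\<dots> = (\<integral>\<^sup>+t. \<integral>\<^sup>+s. \<integral>\<^sup>+w. indicator X (t, s, w) \<partial>M \<partial>leb 0 T \<partial>leb 0 T)"
    by (rule LL.Fubini'[OF m, symmetric])
  also have "\<dots> = emeasure ?N X" using f3[OF i] by simp
  finally show "emeasure (distr ?N ?N ?sw) X = emeasure ?N X" .
qed simp

lemma swap_times:
  fixes f :: "real \<Rightarrow> real \<Rightarrow> 'a \<Rightarrow> 'b::{banach, second_countable_topology}"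
  assumes f: "(\<lambda>(t, s, w). f t s w) \<in> borel_measurable (time2_scenario T)"
  shows "(\<lambda>(t, s, w). f s t w) \<in> borel_measurable (time2_scenario T)"
    "integrable (time2_scenario T) (\<lambda>(t, s, w). f s t w)
      \<longleftrightarrow> integrable (time2_scenario T) (\<lambda>(t, s, w). f t s w)"
    "(LINT (t, s, w)|(time2_scenario T). f s t w)
      = (LINT (t, s, w)|(time2_scenario T). f t s w)"
proof -
  note sw = measurable_swap_times[of "leb 0 T" "leb 0 T" M]
  have eq: "(\<lambda>p. (\<lambda>(t, s, w). f t s w) ((\<lambda>(t, s, w). (s, t, w)) p)) = (\<lambda>(t, s, w). f s t w)"
    by auto
  show "(\<lambda>(t, s, w). f s t w) \<in> borel_measurable (time2_scenario T)"
    using measurable_compose[OF sw f] unfolding eq .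
  show "integrable (time2_scenario T) (\<lambda>(t, s, w). f s t w)
      \<longleftrightarrow> integrable (time2_scenario T) (\<lambda>(t, s, w). f t s w)"
    using integrable_distr_eq[OF sw f] unfolding eq distr_swap_times by simp
  show "(LINT (t, s, w)|(time2_scenario T). f s t w)
      = (LINT (t, s, w)|(time2_scenario T). f t s w)"
    using integral_distr[OF sw f] unfolding eq distr_swap_times by simp
qed

lemma sq_integrable_swap_times:
  assumes "sq_integrable (time2_scenario T) (\<lambda>(t, s, w). f t s w)"
  shows "sq_integrable (time2_scenario T) (\<lambda>(t, s, w). f s t w)"
proof -
  note m = sq_integrable_measurable[OF assms]
  have i: "integrable (time2_scenario T) (\<lambda>(t, s, w). (norm (f t s w))\<^sup>2)"
    using assms by (simp add: sq_integrable_def case_prod_unfold)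
  from swap_times(2)[OF borel_measurable_integrable[OF i]] i
  have "integrable (time2_scenario T) (\<lambda>(t, s, w). (norm (f s t w))\<^sup>2)" by simp
  with swap_times(1)[OF m] show ?thesis by (simp add: sq_integrable_def case_prod_unfold)
qed

lemma integral_triple:
  fixes f :: "real \<Rightarrow> real \<Rightarrow> 'a \<Rightarrow> real"
  assumes f: "integrable (time2_scenario T) (\<lambda>(t, s, w). f t s w)"
  shows "integrable (leb 0 T) (\<lambda>t. LINT s|leb 0 T. LINT w|M. f t s w)"
    "(LINT t|leb 0 T. LINT s|leb 0 T. LINT w|M. f t s w)
      = (LINT (t, s, w)|(time2_scenario T). f t s w)"
    "(LINT w|M. LINT t|leb 0 T. LINT s|leb 0 T. f t s w)
      = (LINT t|leb 0 T. LINT s|leb 0 T. LINT w|M. f t s w)"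
proof -
  interpret P: pair_sigma_finite "leb 0 T" M by (rule pair_sigma_finite_leb)
  interpret Q: pair_sigma_finite "leb 0 T" "time_scenario 0 T" by (rule pair_sigma_finite_leb2)
  have assoc: "(\<lambda>p. (fst (fst p), snd (fst p), snd p))
      \<in> measurable ((leb 0 T \<Otimes>\<^sub>M leb 0 T) \<Otimes>\<^sub>M M) (time2_scenario T)"
    by measurable
  have [measurable]: "(\<lambda>p. f (fst (fst p)) (snd (fst p)) (snd p)) \<in> borel_measurable ((leb 0 T \<Otimes>\<^sub>M leb 0 T) \<Otimes>\<^sub>M M)"
    using measurable_compose[OF assoc borel_measurable_integrable[OF f]] by simp
  have m: "(\<lambda>t. LINT s|leb 0 T. LINT w|M. f t s w) \<in> borel_measurable (leb 0 T)"
    by measurable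
  have "AE t in leb 0 T. (LINT q|(time_scenario 0 T). (case (t, q) of (t, s, w) \<Rightarrow> f t s w))
    = (LINT s|leb 0 T. LINT w|M. f t s w)"
    using Q.AE_integrable_fst'[OF f]
  proof eventually_elim
    case (elim t)
    from P.integral_fst'[OF elim] show ?case by simp
  qed
  then have eq: "AE t in leb 0 T. (LINT s|leb 0 T. LINT w|M. f t s w)
    = (LINT q|(time_scenario 0 T). (case (t, q) of (t, s, w) \<Rightarrow> f t s w))"
    by eventually_elim simp
  note i = Q.integrable_fst'[OF f]
  show "integrable (leb 0 T) (\<lambda>t. LINT s|leb 0 T. LINT w|M. f t s w)"
    using integrable_cong_AE[OF m borel_measurable_integrable[OF i] eq] i by simp
  have "(LINT t|leb 0 T. LINT s|leb 0 T. LINT w|M. f t s w)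
    = (LINT t|leb 0 T. LINT q|(time_scenario 0 T). (case (t, q) of (t, s, w) \<Rightarrow> f t s w))"
    by (rule integral_cong_AE[OF m borel_measurable_integrable[OF i] eq])
  also have "\<dots> = (LINT (t, s, w)|(time2_scenario T). f t s w)"
    by (rule Q.integral_fst'[OF f])
  finally show main: "(LINT t|leb 0 T. LINT s|leb 0 T. LINT w|M. f t s w)
      = (LINT (t, s, w)|(time2_scenario T). f t s w)" .
  have fs: "integrable (time2_scenario T) (\<lambda>(s, t, w). f t s w)"
    using swap_times(2)[OF borel_measurable_integrable[OF f]] f by simp
  then have fs': "integrable (time2_scenario T) (\<lambda>(s, q). f (fst q) s (snd q))"
    by (simp add: case_prod_unfold)
  have j: "integrable (time_scenario 0 T) (\<lambda>(t, w). LINT s|leb 0 T. f t s w)"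
    using Q.integrable_snd[OF fs'] by (simp add: case_prod_unfold)
  have "(LINT w|M. LINT t|leb 0 T. LINT s|leb 0 T. f t s w)
    = (LINT (t, w)|(time_scenario 0 T). LINT s|leb 0 T. f t s w)"
    by (rule P.integral_snd[OF j])
  also have "\<dots> = (LINT (s, t, w)|(time2_scenario T). f t s w)"
    using Q.integral_snd[OF fs'] by (simp add: case_prod_unfold)
  also have "\<dots> = (LINT (t, s, w)|(time2_scenario T). f t s w)"
    by (rule swap_times(3)[OF borel_measurable_integrable[OF f]])
  finally show "(LINT w|M. LINT t|leb 0 T. LINT s|leb 0 T. f t s w)
      = (LINT t|leb 0 T. LINT s|leb 0 T. LINT w|M. f t s w)"
    using main by simp
qed

lemma integral_leb_upper:
  fixes f :: "real \<Rightarrow> real"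
  assumes "0 \<le> t"
  shows "(LINT s|leb t T. f s) = (LINT s|leb 0 T. indicat_real {t..} s * f s)"
  unfolding set_integral_leb[symmetric] set_lebesgue_integral_def
  by (intro Bochner_Integration.integral_cong) (use assms in \<open>auto simp: indicator_def\<close>)

lemma integral_leb_lower:
  fixes f :: "real \<Rightarrow> real"
  assumes "t \<le> T"
  shows "(LINT s|leb 0 t. f s) = (LINT s|leb 0 T. indicat_real {..t} s * f s)"
  unfolding set_integral_leb[symmetric] set_lebesgue_integral_def
  by (intro Bochner_Integration.integral_cong) (use assms in \<open>auto simp: indicator_def\<close>)

text \<open>
  Fubini on the triangle \<open>t \<le> s\<close>: the integral over \<open>s \<in> [t,T]\<close> in the backward equation becomes
  the integral over \<open>s \<in> [0,t]\<close> in the forward equation.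
\<close>

lemma integral_triangle_swap:
  fixes J :: "real \<Rightarrow> real \<Rightarrow> 'a \<Rightarrow> real"
  assumes J: "integrable (time2_scenario T) (\<lambda>(t, s, w). J t s w)"
  shows "integrable (leb 0 T) (\<lambda>t. LINT s|leb t T. LINT w|M. J t s w)"
    "integrable (leb 0 T) (\<lambda>t. LINT s|leb 0 t. LINT w|M. J s t w)"
    "(LINT t|leb 0 T. LINT s|leb t T. LINT w|M. J t s w)
      = (LINT t|leb 0 T. LINT s|leb 0 t. LINT w|M. J s t w)"
proof -
  define f where "f t s w = indicat_real {t..} s * J t s w" for t s w
  have fst3: "fst \<in> borel_measurable (time2_scenario T)"
    by (rule measurable_compose[OF measurable_fst]) (simp add: measurable_restrict_space1)
  have snd3: "(\<lambda>p. fst (snd p)) \<in> borel_measurable (time2_scenario T)"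
    by (rule measurable_compose[OF measurable_snd], rule measurable_compose[OF measurable_fst])
       (simp add: measurable_restrict_space1)
  have fi: "integrable (time2_scenario T) (\<lambda>(t, s, w). f t s w)"
  proof (rule Bochner_Integration.integrable_bound[OF J])
    note [measurable] = fst3 snd3 borel_measurable_integrable[OF J]
    have "(\<lambda>p. (if fst p \<le> fst (snd p) then 1 else 0) * (case p of (t, s, w) \<Rightarrow> J t s w))
        \<in> borel_measurable (time2_scenario T)"
      by measurable
    also have "(\<lambda>p. (if fst p \<le> fst (snd p) then 1 else 0) * (case p of (t, s, w) \<Rightarrow> J t s w))
      = (\<lambda>(t, s, w). f t s w)"
      by (auto simp: f_def indicator_def)
    finally show "(\<lambda>(t, s, w). f t s w) \<in> borel_measurable (time2_scenario T)" .
  qed (auto simp: f_def indicator_def)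
  have fs: "integrable (time2_scenario T) (\<lambda>(t, s, w). f s t w)"
    using swap_times(2)[OF borel_measurable_integrable[OF fi]] fi by simp
  have e1: "(LINT s|leb t T. LINT w|M. J t s w) = (LINT s|leb 0 T. LINT w|M. f t s w)" if "t \<in> space (leb 0 T)" for t
    unfolding f_def using that by (subst integral_leb_upper) auto
  have ind: "indicat_real {..t} s = indicat_real {s..} t" for s t :: real
    by (simp add: indicator_def)
  have e2: "(LINT s|leb 0 t. LINT w|M. J s t w) = (LINT s|leb 0 T. LINT w|M. f s t w)" if "t \<in> space (leb 0 T)" for t
    unfolding f_def using that by (subst integral_leb_lower) (auto simp: ind)
  show "integrable (leb 0 T) (\<lambda>t. LINT s|leb t T. LINT w|M. J t s w)"
    using integral_triple(1)[OF fi]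
    by (rule Bochner_Integration.integrable_cong[THEN iffD2, rotated 2]) (auto intro: e1)
  show "integrable (leb 0 T) (\<lambda>t. LINT s|leb 0 t. LINT w|M. J s t w)"
    using integral_triple(1)[OF fs]
    by (rule Bochner_Integration.integrable_cong[THEN iffD2, rotated 2]) (auto intro: e2)
  have "(LINT t|leb 0 T. LINT s|leb t T. LINT w|M. J t s w)
    = (LINT t|leb 0 T. LINT s|leb 0 T. LINT w|M. f t s w)"
    by (intro Bochner_Integration.integral_cong refl e1)
  also have "\<dots> = (LINT t|leb 0 T. LINT s|leb 0 T. LINT w|M. f s t w)"
    unfolding integral_triple(2)[OF fi] integral_triple(2)[OF fs]
    by (rule swap_times(3)[OF borel_measurable_integrable[OF fi], symmetric])
  also have "\<dots> = (LINT t|leb 0 T. LINT s|leb 0 t. LINT w|M. J s t w)"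
    by (intro Bochner_Integration.integral_cong refl e2[symmetric])
  finally show "(LINT t|leb 0 T. LINT s|leb t T. LINT w|M. J t s w)
      = (LINT t|leb 0 T. LINT s|leb 0 t. LINT w|M. J s t w)" .
qed

lemma sq_integrable_second_time:
  assumes f: "sq_integrable (time_scenario 0 T) (\<lambda>(s, w). f s w)"
  shows "sq_integrable (time2_scenario T) (\<lambda>(t, s, w). f s w)"
proof -
  interpret LM: sigma_finite_measure "time_scenario 0 T"
    by (rule finite_measure.axioms(1)[OF finite_measure_leb_pair])
  from LM.sq_integrable_lift[OF finite_measure_leb f] show ?thesis by simp
qed

lemma sq_integrable_first_time:
  assumes "sq_integrable (time_scenario 0 T) (\<lambda>(s, w). f s w)"
  shows "sq_integrable (time2_scenario T) (\<lambda>(t, s, w). f t w)"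
  by (rule sq_integrable_swap_times[OF sq_integrable_second_time[OF assms]])

lemma AE_sq_integrable_triple_section:
  assumes f: "sq_integrable (time2_scenario T) (\<lambda>(t, s, w). f t s w)"
  shows "AE t in leb 0 T. sq_integrable (time_scenario 0 T) (\<lambda>(s, w). f t s w)"
proof -
  interpret Q: pair_sigma_finite "leb 0 T" "time_scenario 0 T" by (rule pair_sigma_finite_leb2)
  have "integrable (time2_scenario T) (\<lambda>(t, s, w). (norm (f t s w))\<^sup>2)"
    using f by (simp add: sq_integrable_def case_prod_unfold)
  from Q.AE_integrable_fst'[OF this] AE_space show ?thesis
  proof eventually_elim
    case (elim t)
    have "(\<lambda>(s, w). f t s w) \<in> borel_measurable (time_scenario 0 T)"
      using measurable_compose_Pair1[OF elim(2) sq_integrable_measurable[OF f]] by simp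
    with elim(1) show ?case by (simp add: sq_integrable_def case_prod_unfold)
  qed
qed

lemma sq_integrable_coefficient_triple:
  fixes A :: "real \<Rightarrow> real \<Rightarrow> 'a \<Rightarrow> real^'n^'k"
  assumes A: "bounded_coefficient M T A"
    and f: "sq_integrable (time2_scenario T) (\<lambda>(t, s, w). f t s w)"
  shows "sq_integrable (time2_scenario T) (\<lambda>(t, s, w). A t s w *v f t s w)"
proof -
  have m: "(\<lambda>(t, s, w). A t s w) \<in> borel_measurable (time2_scenario T)"
    using A by (simp add: bounded_coefficient_def)
  obtain K where K: "\<And>s r w. s \<in> {0..T} \<Longrightarrow> r \<in> {0..T} \<Longrightarrow> w \<in> space M \<Longrightarrow> norm (A s r w) \<le> K"
    using bounded_coefficient_bound[OF A] by blast
  have "sq_integrable (time2_scenario T)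
    (\<lambda>p. (case p of (t, s, w) \<Rightarrow> A t s w) *v (case p of (t, s, w) \<Rightarrow> f t s w))"
    by (rule sq_integrable_matrix_vector[where K=K, OF m _ f])
       (use K in \<open>auto intro!: AE_I2 simp: space_pair_measure\<close>)
  then show ?thesis by (simp add: case_prod_unfold)
qed

end

section \<open>The duality relations\<close>

context wiener_space
begin

lemma T_in: "0 \<le> T" "0 \<in> {0..T}" "T \<in> {0..T}"
  using T_pos by auto

lemma measurable_leb2_F_M:
  assumes "f \<in> measurable (leb 0 T \<Otimes>\<^sub>M leb 0 T \<Otimes>\<^sub>M F T) N"
  shows "f \<in> measurable (time2_scenario T) N"
proof -
  have "(\<lambda>p. p) \<in> measurable (time_scenario 0 T) (leb 0 T \<Otimes>\<^sub>M F T)"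
    by (rule measurable_leb_F_M) simp
  then have "(\<lambda>p. (fst p, snd p)) \<in> measurable (time2_scenario T) (leb 0 T \<Otimes>\<^sub>M leb 0 T \<Otimes>\<^sub>M F T)"
    by (intro measurable_Pair measurable_fst measurable_compose[OF measurable_snd])
  from measurable_compose[OF this assms] show ?thesis by simp
qed

lemma L2_L2_adapted_fields_sq_integrable:
  assumes "Z \<in> L2_L2_adapted_fields M F T"
  shows "sq_integrable (time2_scenario T) (\<lambda>(t, s, w). Z t s w)"
proof -
  have "(\<lambda>(t, s, w). Z t s w) \<in> borel_measurable (time2_scenario T)"
    using assms by (intro measurable_leb2_F_M) (simp add: L2_L2_adapted_fields_def)
  then show ?thesis
    using assms by (simp add: L2_L2_adapted_fields_def sq_integrable_def case_prod_unfold)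
qed

lemma C_L2_adapted_fieldsD:
  fixes Z :: "real \<Rightarrow> real \<Rightarrow> 'w \<Rightarrow> 'h::euclidean_space"
  assumes Z: "Z \<in> C_L2_adapted_fields M F T"
  shows "\<And>t. t \<in> {0..T} \<Longrightarrow> sq_integrable (time_scenario 0 T) (\<lambda>(s, w). Z t s w)"
    "\<And>t. t \<in> {0..T} \<Longrightarrow> adapted F T (Z t)"
    "sq_integrable (time2_scenario T) (\<lambda>(t, s, w). Z t s w)"
proof -
  interpret LM: finite_measure "time_scenario 0 T" by (rule finite_measure_leb_pair)
  show 1: "\<And>t. t \<in> {0..T} \<Longrightarrow> sq_integrable (time_scenario 0 T) (\<lambda>(s, w). Z t s w)"
    using Z by (intro L2_meas_sq_integrable) (auto simp: C_L2_adapted_fields_def L2_adapted_def)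
  show "\<And>t. t \<in> {0..T} \<Longrightarrow> adapted F T (Z t)"
    using Z by (auto simp: C_L2_adapted_fields_def L2_adapted_def)
  have cont: "((\<lambda>r. LINT p|(time_scenario 0 T). (norm ((case p of (s, w) \<Rightarrow> Z r s w) - (case p of (s, w) \<Rightarrow> Z t s w)))\<^sup>2)
      \<longlongrightarrow> 0) (at t within {0..T})" if "t \<in> {0..T}" for t
    using Z that by (simp add: C_L2_adapted_fields_def case_prod_unfold)
  obtain C where C: "\<And>t. t \<in> {0..T} \<Longrightarrow>
      (LINT p|(time_scenario 0 T). (norm (case p of (s, w) \<Rightarrow> Z t s w))\<^sup>2) \<le> C"
    using bounded_C_L2_norm[OF 1 cont] by blast
  have m: "(\<lambda>(t, p). (case p of (s, w) \<Rightarrow> Z t s w)) \<in> borel_measurable (time2_scenario T)"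
    using Z by (intro measurable_leb2_F_M) (simp add: C_L2_adapted_fields_def)
  show "sq_integrable (time2_scenario T) (\<lambda>(t, s, w). Z t s w)"
    by (rule LM.sq_integrable_pairI[OF finite_measure_leb m]) (use 1 C in auto)
qed

text \<open>
  This covers the ends of the time interval, where one of the integrals over \<open>[0,t]\<close> and \<open>[t,T]\<close>
  degenerates.
\<close>

lemma has_ito_integral_singleton:
  fixes f :: "real \<Rightarrow> 'w \<Rightarrow> 'h::euclidean_space"
  assumes f: "(\<lambda>(s, w). f s w) \<in> borel_measurable (time_scenario 0 T)" and t: "t \<in> {0..T}"
  shows "has_ito_integral M F W t t f (\<lambda>_. 0)"
proof -
  have m: "(\<lambda>(s, w). f s w) \<in> borel_measurable (time_scenario t t)"
    by (rule measurable_leb_pair_subinterval[OF _ _ f]) (use t in auto)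
  have m': "(\<lambda>p. ennreal ((norm (f (fst p) (snd p)))\<^sup>2)) \<in> borel_measurable (time_scenario t t)"
    using m by (simp add: case_prod_unfold)
  have "(\<integral>\<^sup>+p. ennreal ((norm (f (fst p) (snd p)))\<^sup>2) \<partial>(time_scenario t t))
    = (\<integral>\<^sup>+s. \<integral>\<^sup>+w. ennreal ((norm (f s w))\<^sup>2) \<partial>M \<partial>leb t t)"
    using nn_integral_fst[OF m'] by simp
  also have "\<dots> = (\<integral>\<^sup>+s. 0 \<partial>leb t t)"
    by (rule nn_integral_cong_AE) (rule AE_leb_singleton)
  finally have 0: "(\<integral>\<^sup>+p. ennreal ((norm (f (fst p) (snd p)))\<^sup>2) \<partial>(time_scenario t t)) = 0" by simp
  show ?thesis
    unfolding has_ito_integral_def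
    by (intro conjI exI[of _ "\<lambda>_. 0"] exI[of _ "\<lambda>_ _. t"] exI[of _ "\<lambda>_ _ _. 0"])
       (use m 0 in \<open>auto simp: simple_data_def simple_process_def simple_ito_def case_prod_unfold\<close>)
qed

text \<open>
  Adaptedness is only known at almost every first time, but the second identity uses the
  coefficients at the single first time \<open>0\<close>.  Times with adaptedness accumulate at \<open>0\<close>, and by
  continuity the coefficient at \<open>0\<close> is an almost sure limit of adapted ones.
\<close>

lemma coefficient_adapted_at_0:
  fixes D :: "real \<Rightarrow> real \<Rightarrow> 'w \<Rightarrow> 'h::euclidean_space"
  assumes ad: "AE t in leb 0 T. adapted F T (D t)"
    and cont: "AE s in leb 0 T. AE w in M. continuous_on {0..T} (\<lambda>t. D t s w)"
  shows "AE s in leb 0 T. D 0 s \<in> borel_measurable (F s)"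
proof -
  have ad': "AE t in lborel. t \<in> {0..T} \<longrightarrow> adapted F T (D t)"
    using ad by (subst (asm) AE_restrict_space_iff) auto
  have "\<exists>t. 0 < t \<and> t < \<epsilon> \<and> t \<le> T \<and> adapted F T (D t)" if "\<epsilon> > 0" for \<epsilon> :: real
  proof (rule ccontr)
    assume "\<not> ?thesis"
    then have "AE t in lborel. t \<notin> {0<..<min \<epsilon> T}"
      using ad' by (auto elim!: eventually_mono)
    then have "{0<..<min \<epsilon> T} \<in> null_sets lborel"
      by (rule Measure_Space.AE_iff_null_sets[THEN iffD2, rotated]) simp
    then have "emeasure lborel {0<..<min \<epsilon> T} = 0" by (rule null_setsD1)
    then show False using that T_pos by (auto simp: min_def split: if_splits)
  qed
  from this[of "inverse (real (Suc _))"] have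
    "\<forall>n. \<exists>t. 0 < t \<and> t < inverse (real (Suc n)) \<and> t \<le> T \<and> adapted F T (D t)" by simp
  then obtain t where t: "\<And>n. 0 < t n" "\<And>n. t n < inverse (real (Suc n))" "\<And>n. t n \<le> T"
    "\<And>n. adapted F T (D (t n))" by metis
  have lim: "t \<longlonglongrightarrow> 0"
    by (rule real_tendsto_sandwich[OF _ _ tendsto_const LIMSEQ_inverse_real_of_nat])
       (use t(1,2) in \<open>auto intro: less_imp_le always_eventually\<close>)
  show ?thesis
    using cont AE_space
  proof eventually_elim
    case (elim s)
    then have s: "0 \<le> s" "s \<le> T" by auto
    have m: "(\<lambda>w. lim (\<lambda>n. D (t n) s w)) \<in> borel_measurable (F s)"
      by (rule borel_measurable_lim_metric) (rule adaptedD[OF t(4) s])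
    show ?case
    proof (rule F_measurable_cong_AE[OF m])
      show "AE w in M. D 0 s w = lim (\<lambda>n. D (t n) s w)"
        using elim(1)
      proof eventually_elim
        case (elim w)
        have "(\<lambda>n. D (t n) s w) \<longlonglongrightarrow> D 0 s w"
          by (rule continuous_on_tendsto_compose[OF elim lim])
             (use t T_pos in \<open>auto intro!: always_eventually less_imp_le\<close>)
        then show ?case by (simp add: limI)
      qed
    qed simp
  qed
qed

text \<open>
  The local duality is used at \<open>t = T\<close> with \<open>\<Theta> = \<mu>(0) + \<integral>\<^sub>0\<^sup>T \<nu> dW\<close> as test variable, and at almost
  every \<open>t\<close> with \<open>Y(t) + \<integral>\<^sub>t\<^sup>T Z(t,s) dW(s)\<close>, where the M-solution property supplies
  \<open>Y(t) = E Y(t) + \<integral>\<^sub>0\<^sup>t Z(t,s) dW(s)\<close>.  By the backward equation the latter test variable is \<open>\<psi>(t)\<close>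
  plus terms with \<open>\<Theta>\<close>, \<open>\<nu>\<close> and a time integral.  The terms with \<open>D\<close> cancel at each \<open>t\<close>, those with
  \<open>A\<close> and \<open>B\<close> cancel after integration in \<open>t\<close> by Fubini on the triangle, and the terms with \<open>\<Theta>\<close> and
  \<open>\<nu>\<close> are what the duality at \<open>T\<close> produces.
\<close>

lemma duality_terminal_and_free_term:
  fixes A B D :: "real \<Rightarrow> real \<Rightarrow> 'w \<Rightarrow> real^'m^'m"
    and \<Theta> :: "'w \<Rightarrow> real^'m"
    and \<psi> \<alpha> \<xi> Y \<mu> \<nu> :: "real \<Rightarrow> 'w \<Rightarrow> real^'m"
    and \<beta> Z :: "real \<Rightarrow> real \<Rightarrow> 'w \<Rightarrow> real^'m"
  assumes coeffs: "bounded_coefficient M T A" "bounded_coefficient M T B" "bounded_coefficient M T D"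
    and A_adapted: "AE t in leb 0 T. adapted F T (A t)"
    and D_adapted: "AE t in leb 0 T. adapted F T (D t)"
    and \<Theta>: "\<Theta> \<in> L2_rv M (F T)"
    and \<psi>: "\<psi> \<in> L2_meas M F T"
    and \<alpha>: "\<alpha> \<in> C_L2_adapted M F T"
    and \<beta>: "\<beta> \<in> C_L2_adapted_fields M F T"
    and \<xi>: "\<xi> \<in> C_L2 M F T"
    and \<xi>_eq: "\<forall>t\<in>{0..T}. forward_equation A B D \<alpha> \<beta> \<xi> t"
    and Y: "Y \<in> L2_adapted M F T"
    and Z: "Z \<in> L2_L2_adapted_fields M F T"
    and Y_eq: "AE t in leb 0 T. \<exists>I. has_ito_integral M F W t T (Z t) I \<and>
      (AE w in M. Y t w = \<psi> t w + A t T w *v \<Theta> w + B t T w *v \<nu> t w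
         + (LINT s:{t..T}|lborel. A t s w *v Y s w + B t s w *v Z s t w + D t s w *v Z t s w)
         - I w)"
    and Y_M_solution: "AE t in leb 0 T. \<exists>I. has_ito_integral M F W 0 t (Z t) I \<and>
      (AE w in M. Y t w = (LINT w'|M. Y t w') + I w)"
    and \<mu>: "\<mu> \<in> L2_adapted M F T"
    and \<nu>: "\<nu> \<in> L2_adapted M F T"
    and \<mu>_eq: "\<forall>t\<in>{0..T}. \<exists>I. has_ito_integral M F W t T \<nu> I \<and>
      (AE w in M. \<mu> t w = \<Theta> w - I w)"
  shows "(LINT w|M. \<xi> T w \<bullet> \<Theta> w) + (LINT w|M. (LINT t:{0..T}|lborel. \<psi> t w \<bullet> \<xi> t w))
      = (LINT w|M. \<alpha> T w \<bullet> \<Theta> w) + (LINT w|M. (LINT s:{0..T}|lborel. \<beta> T s w \<bullet> \<nu> s w))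
        + (LINT w|M. (LINT t:{0..T}|lborel. Y t w \<bullet> \<alpha> t w))
        + (LINT w|M. (LINT t:{0..T}|lborel. (LINT s:{0..T}|lborel. Z t s w \<bullet> \<beta> t s w)))"
proof -
  have sT: "sq_integrable M \<Theta>" by (rule L2_rv_sq_integrable[OF \<Theta>])
  have \<Theta>F: "\<Theta> \<in> borel_measurable (F T)" using \<Theta> by (simp add: L2_rv_def)
  have s\<psi>: "sq_integrable (time_scenario 0 T) (\<lambda>(t, w). \<psi> t w)" by (rule L2_meas_sq_integrable[OF \<psi>])
  have sY: "sq_integrable (time_scenario 0 T) (\<lambda>(t, w). Y t w)" and Y_ad: "adapted F T Y"
    using Y by (auto simp: L2_adapted_def intro: L2_meas_sq_integrable)
  have s\<nu>: "sq_integrable (time_scenario 0 T) (\<lambda>(t, w). \<nu> t w)" and \<nu>_ad: "adapted F T \<nu>"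
    using \<nu> by (auto simp: L2_adapted_def intro: L2_meas_sq_integrable)
  have \<mu>_ad: "adapted F T \<mu>" using \<mu> by (simp add: L2_adapted_def)
  have \<alpha>C: "\<alpha> \<in> C_L2 M F T" and \<alpha>_ad: "adapted F T \<alpha>" using \<alpha> by (auto simp: C_L2_adapted_def)
  note s\<alpha> = C_L2D(3)[OF \<alpha>C] and s\<xi> = C_L2D(3)[OF \<xi>]
  note sZ = L2_L2_adapted_fields_sq_integrable[OF Z]
  have Z_ad: "AE t in leb 0 T. adapted F T (Z t)" using Z by (simp add: L2_L2_adapted_fields_def)
  note s\<beta> = C_L2_adapted_fieldsD(3)[OF \<beta>]
  note A\<Theta> = sq_integrable_coefficient_pair(1)[OF coeffs(1) T_in(3) order_refl order_refl
      sq_integrable_lift[OF finite_measure_leb sT]]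
  note B\<nu> = sq_integrable_coefficient_pair(1)[OF coeffs(2) T_in(3) order_refl order_refl s\<nu>]
  have A_meas: "AE s in leb 0 t. A s t \<in> borel_measurable (F t)" if "0 \<le> t" "t \<le> T" for t
    using AE_leb_subinterval[OF A_adapted order_refl that(2)]
    by eventually_elim (rule adaptedD[OF _ that])

  define u where "u t s w = A t s w *v Y s w + B t s w *v Z s t w" for t s w
  define J where "J t s w = \<xi> t w \<bullet> u t s w" for t s w
  have su: "sq_integrable (time2_scenario T) (\<lambda>(t, s, w). u t s w)"
    using sq_integrable_add[OF sq_integrable_coefficient_triple[OF coeffs(1) sq_integrable_second_time[OF sY]]
        sq_integrable_coefficient_triple[OF coeffs(2) sq_integrable_swap_times[OF sZ]]]
    by (simp add: u_def case_prod_unfold)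
  have sDZ: "sq_integrable (time2_scenario T) (\<lambda>(t, s, w). D t s w *v Z t s w)"
    by (rule sq_integrable_coefficient_triple[OF coeffs(3) sZ])
  have iJ: "integrable (time2_scenario T) (\<lambda>(t, s, w). J t s w)"
    using sq_integrable_inner[OF sq_integrable_first_time[OF s\<xi>] su] by (simp add: J_def case_prod_unfold)
  have i\<beta>Z: "integrable (time2_scenario T) (\<lambda>(t, s, w). \<beta> t s w \<bullet> Z t s w)"
    using sq_integrable_inner[OF s\<beta> sZ] by (simp add: case_prod_unfold)

  let ?p = "\<lambda>t. LINT w|M. \<xi> t w \<bullet> \<psi> t w"
  let ?q = "\<lambda>t. LINT w|M. \<xi> t w \<bullet> (A t T w *v \<Theta> w + B t T w *v \<nu> t w)"
  let ?y = "\<lambda>t. LINT w|M. \<alpha> t w \<bullet> Y t w"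
  let ?z = "\<lambda>t. LINT s|leb 0 T. LINT w|M. \<beta> t s w \<bullet> Z t s w"
  let ?a = "\<lambda>t. LINT s|leb t T. LINT w|M. J t s w"
  let ?b = "\<lambda>t. LINT s|leb 0 t. LINT w|M. J s t w"
  let ?d = "\<lambda>t. LINT s|leb t T. LINT w|M. \<xi> t w \<bullet> (D t s w *v Z t s w)"
  have sq: "sq_integrable (time_scenario 0 T) (\<lambda>(t, w). A t T w *v \<Theta> w + B t T w *v \<nu> t w)"
    using sq_integrable_add[OF A\<Theta> B\<nu>] by (simp add: case_prod_unfold)

  \<comment> \<open>The duality at almost every time; the contribution \<open>?d t\<close> of \<open>D\<close> has already cancelled.\<close>
  have at_t: "AE t in leb 0 T. ?p t + ?q t + ?a t = ?y t + ?b t + ?z t"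
    using Y_eq Y_M_solution Z_ad D_adapted AE_sq_integrable_section[OF sY]
      AE_sq_integrable_section[OF s\<psi>] AE_sq_integrable_section[OF sq]
      AE_sq_integrable_triple_section[OF su] AE_sq_integrable_triple_section[OF sDZ]
      AE_sq_integrable_triple_section[OF sZ] AE_space
  proof eventually_elim
    case (elim t)
    then have t: "0 \<le> t" "t \<le> T" "t \<in> {0..T}" by auto
    from elim(1) obtain I where I: "has_ito_integral M F W t T (Z t) I"
      and eqY: "AE w in M. Y t w = \<psi> t w + A t T w *v \<Theta> w + B t T w *v \<nu> t w
         + (LINT s:{t..T}|lborel. A t s w *v Y s w + B t s w *v Z s t w + D t s w *v Z t s w)
         - I w" by blast
    from elim(2) obtain I\<^sub>0 where I\<^sub>0: "has_ito_integral M F W 0 t (Z t) I\<^sub>0"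
      and eqY\<^sub>0: "AE w in M. Y t w = (LINT w'|M. Y t w') + I\<^sub>0 w" by blast
    have D_meas: "AE s in leb t T. D t s \<in> borel_measurable (F s)"
      using adaptedD[OF elim(4)] t AE_space by (intro AE_I2) auto
    have \<xi>t: "sq_integrable M (\<xi> t)" and \<alpha>t: "sq_integrable M (\<alpha> t)"
      using C_L2D(1)[OF \<xi>] C_L2D(1)[OF \<alpha>C] t by auto
    have const: "(\<lambda>_. LINT w'|M. Y t w') \<in> borel_measurable (F 0)" by simp
    note \<xi>_eq_t = \<xi>_eq[rule_format, OF t(3)]
    note dual = duality_at[where \<xi>=\<xi> and \<alpha>=\<alpha> and \<beta>=\<beta> and A=A and B=B and D=D and t=t and V="Y t" and g="Z t", OF t(1,2) \<xi> coeffs(1) A_meas[OF t(1,2)] coeffs(2,3) D_meas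
        adaptedD[OF \<alpha>_ad t(1,2)] \<alpha>t \<xi>_eq_t adaptedD[OF Y_ad t(1,2)] elim(5)
        elim(10) elim(3) const I\<^sub>0 eqY\<^sub>0 I]
    note sI = has_ito_integral_sq_integrable(2)[OF t(1) order_refl I]
    have YI: "sq_integrable M (\<lambda>w. Y t w + I w)" by (rule sq_integrable_add[OF elim(5) sI])

    have ut: "sq_integrable (time_scenario t T) (\<lambda>(s, w). u t s w)"
      by (rule sq_integrable_leb_subinterval[OF prob_space_axioms elim(8) t(1) order_refl])
    have DZt: "sq_integrable (time_scenario t T) (\<lambda>(s, w). D t s w *v Z t s w)"
      by (rule sq_integrable_leb_subinterval[OF prob_space_axioms elim(9) t(1) order_refl])
    have ab: "sq_integrable M (\<lambda>w. \<psi> t w + (A t T w *v \<Theta> w + B t T w *v \<nu> t w))"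
      by (rule sq_integrable_add[OF elim(6,7)])
    have eqY': "AE w in M. Y t w = (\<psi> t w + (A t T w *v \<Theta> w + B t T w *v \<nu> t w))
        + (LINT s|leb t T. u t s w + D t s w *v Z t s w) - I w"
      using eqY by eventually_elim (simp add: set_integral_leb u_def)
    have "(LINT w|M. \<xi> t w \<bullet> (Y t w + I w)) = ?p t + ?q t + ?a t + ?d t"
      unfolding backward_pairing[OF \<xi>t ab YI ut DZt eqY'] inner_add_right[of _ "\<psi> t _"] J_def
      using sq_integrable_inner[OF \<xi>t elim(6)] sq_integrable_inner[OF \<xi>t elim(7)] by simp
    then show ?case
      using dual by (simp add: J_def u_def)
  qed

  have ip: "integrable (leb 0 T) ?p" by (rule integrable_time_expectation(1)[OF s\<xi> s\<psi>])
  have iq: "integrable (leb 0 T) ?q" by (rule integrable_time_expectation(1)[OF s\<xi> sq])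
  have iy: "integrable (leb 0 T) ?y" by (rule integrable_time_expectation(1)[OF s\<alpha> sY])
  have iz: "integrable (leb 0 T) ?z" by (rule integral_triple(1)[OF i\<beta>Z])
  note ia = integral_triangle_swap(1)[OF iJ] and ib = integral_triangle_swap(2)[OF iJ]
  have "(LINT t|leb 0 T. ?p t + ?q t + ?a t) = (LINT t|leb 0 T. ?y t + ?b t + ?z t)"
    by (intro integral_cong_AE at_t borel_measurable_add borel_measurable_integrable ip iq ia iy ib iz)
  then have int: "(LINT t|leb 0 T. ?p t) + (LINT t|leb 0 T. ?q t) = (LINT t|leb 0 T. ?y t) + (LINT t|leb 0 T. ?z t)"
    using ip iq ia iy ib iz integral_triangle_swap(3)[OF iJ] by simp

  \<comment> \<open>The future \<open>[T,T]\<close> is a null set of times, so adaptedness of \<open>D(T,\<cdot>)\<close> there is vacuous.\<close>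
  have at_T: "(LINT w|M. \<xi> T w \<bullet> \<Theta> w) = (LINT w|M. \<alpha> T w \<bullet> \<Theta> w)
      + (LINT t|leb 0 T. ?q t) + (LINT s|leb 0 T. LINT w|M. \<beta> T s w \<bullet> \<nu> s w)"
  proof -
    from \<mu>_eq T_in obtain I\<^sub>0 where I\<^sub>0: "has_ito_integral M F W 0 T \<nu> I\<^sub>0"
      and eq\<^sub>0: "AE w in M. \<mu> 0 w = \<Theta> w - I\<^sub>0 w" by blast
    from eq\<^sub>0 have eq: "AE w in M. \<Theta> w = \<mu> 0 w + I\<^sub>0 w" by eventually_elim simp
    have I: "has_ito_integral M F W T T \<nu> (\<lambda>_. 0)"
      by (rule has_ito_integral_singleton[OF sq_integrable_measurable[OF s\<nu>] T_in(3)])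
    have \<alpha>T: "sq_integrable M (\<alpha> T)" using C_L2D(1)[OF \<alpha>C] T_in by auto
    show ?thesis
      using duality_at[where \<xi>=\<xi> and \<alpha>=\<alpha> and \<beta>=\<beta> and A=A and B=B and D=D and t=T and V=\<Theta> and g=\<nu> and v\<^sub>0="\<mu> 0", OF T_in(1) order_refl \<xi> coeffs(1) A_meas[OF T_in(1) order_refl] coeffs(2,3)
          AE_leb_singleton adaptedD[OF \<alpha>_ad T_in(1) order_refl] \<alpha>T \<xi>_eq[rule_format, OF T_in(3)]
          \<Theta>F sT s\<nu> \<nu>_ad adaptedD[OF \<mu>_ad order_refl T_in(1)] I\<^sub>0 eq I]
      unfolding integral_leb_singleton by simp
  qed
  have s\<beta>T: "sq_integrable (time_scenario 0 T) (\<lambda>(s, w). \<beta> T s w)"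
    by (rule C_L2_adapted_fieldsD(1)[OF \<beta> T_in(3)])
  show ?thesis
    using at_T int
    unfolding set_integral_leb integrable_time_expectation(3)[OF s\<beta>T s\<nu>]
      inner_commute[of "\<psi> _ _"] integrable_time_expectation(3)[OF s\<xi> s\<psi>]
      inner_commute[of "Y _ _"] integrable_time_expectation(3)[OF s\<alpha> sY]
      inner_commute[of "Z _ _ _"] integral_triple(3)[OF i\<beta>Z]
    by simp
qed

text \<open>
  The local duality at \<open>t = 0\<close> with test variable \<open>Y'(0) + \<integral>\<^sub>0\<^sup>T Z'(0,s) dW(s)\<close>, which the backward
  equation expresses through the terms with \<open>A'\<close> and \<open>D\<close> and \<open>\<psi>\<close>; the terms with \<open>D\<close> cancel.
\<close>

lemma duality_initial:
  fixes A B D A' :: "real \<Rightarrow> real \<Rightarrow> 'w \<Rightarrow> real^'m^'m"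
    and \<psi>' \<alpha> \<xi> Y' P :: "real \<Rightarrow> 'w \<Rightarrow> real^'m"
    and \<beta> Z' :: "real \<Rightarrow> real \<Rightarrow> 'w \<Rightarrow> real^'m"
  assumes coeffs: "bounded_coefficient M T A" "bounded_coefficient M T B"
      "bounded_coefficient M T D" "bounded_coefficient M T A'"
    and D_adapted: "AE s in leb 0 T. D 0 s \<in> borel_measurable (F s)"
    and A'_adapted: "AE s in leb 0 T. A' 0 s \<in> borel_measurable (F s)"
    and \<psi>': "\<psi>' \<in> C_L2 M F T"
    and \<alpha>: "\<alpha> \<in> C_L2_adapted M F T"
    and \<beta>: "\<beta> \<in> C_L2_adapted_fields M F T"
    and \<xi>: "\<xi> \<in> C_L2 M F T"
    and \<xi>_eq: "forward_equation A B D \<alpha> \<beta> \<xi> 0"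
    and Y': "Y' \<in> C_L2_adapted M F T"
    and Z': "Z' \<in> C_L2_adapted_fields M F T"
    and Y'_eq: "\<exists>I. has_ito_integral M F W 0 T (Z' 0) I \<and>
      (AE w in M. Y' 0 w = \<psi>' 0 w
         + (LINT s:{0..T}|lborel. A' 0 s w *v Y' s w + D 0 s w *v Z' 0 s w) - I w)"
    and P: "cond_exp_process M F 0 T (\<lambda>_. \<xi> 0) P"
  shows "AE w\<^sub>0 in M.
      (LINT w|M. \<xi> 0 w \<bullet> \<psi>' 0 w)
        + (LINT w|M. (LINT s:{0..T}|lborel. P s w \<bullet> (A' 0 s w *v Y' s w)))
      = Y' 0 w\<^sub>0 \<bullet> \<alpha> 0 w\<^sub>0 + (LINT w|M. (LINT s:{0..T}|lborel. Z' 0 s w \<bullet> \<beta> 0 s w))"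
proof -
  have \<alpha>C: "\<alpha> \<in> C_L2 M F T" and \<alpha>_ad: "adapted F T \<alpha>" using \<alpha> by (auto simp: C_L2_adapted_def)
  have Y'C: "Y' \<in> C_L2 M F T" and Y'_ad: "adapted F T Y'" using Y' by (auto simp: C_L2_adapted_def)
  note s\<xi> = C_L2D(1)[OF \<xi> T_in(2)] and s\<alpha> = C_L2D(1)[OF \<alpha>C T_in(2)]
    and sY' = C_L2D(1)[OF Y'C T_in(2)] and s\<psi>' = C_L2D(1)[OF \<psi>' T_in(2)]
  note sZ' = C_L2_adapted_fieldsD(1)[OF Z' T_in(2)] and Z'_ad = C_L2_adapted_fieldsD(2)[OF Z' T_in(2)]
  note s\<beta> = C_L2_adapted_fieldsD(1)[OF \<beta> T_in(2)]
  have \<alpha>F: "\<alpha> 0 \<in> borel_measurable (F 0)" and Y'F: "Y' 0 \<in> borel_measurable (F 0)"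
    using adaptedD[OF \<alpha>_ad] adaptedD[OF Y'_ad] T_in by auto
  from Y'_eq obtain I where I: "has_ito_integral M F W 0 T (Z' 0) I"
    and eq: "AE w in M. Y' 0 w = \<psi>' 0 w
         + (LINT s:{0..T}|lborel. A' 0 s w *v Y' s w + D 0 s w *v Z' 0 s w) - I w" by blast
  have I\<^sub>0: "has_ito_integral M F W 0 0 (Z' 0) (\<lambda>_. 0)"
    by (rule has_ito_integral_singleton[OF sq_integrable_measurable[OF sZ'] T_in(2)])
  have triv: "AE w in M. Y' 0 w = Y' 0 w + 0" by simp
  note dual = duality_at[where \<xi>=\<xi> and \<alpha>=\<alpha> and \<beta>=\<beta> and A=A and B=B and D=D and t=0 and V="Y' 0" and g="Z' 0" and v\<^sub>0="Y' 0", OF order_refl T_in(1) \<xi> coeffs(1) AE_leb_singleton coeffs(2,3) D_adapted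
      \<alpha>F s\<alpha> \<xi>_eq Y'F sY' sZ' Z'_ad Y'F I\<^sub>0 triv I, unfolded integral_leb_singleton]

  note sAY = sq_integrable_coefficient_pair(2)[OF coeffs(4) T_in(2) order_refl order_refl C_L2D(3)[OF Y'C]]
  note sDZ = sq_integrable_coefficient_pair(2)[OF coeffs(3) T_in(2) order_refl order_refl sZ']
  let ?a = "LINT s|leb 0 T. LINT w|M. \<xi> 0 w \<bullet> (A' 0 s w *v Y' s w)"
  have main: "(LINT w|M. \<xi> 0 w \<bullet> \<psi>' 0 w) + ?a = (LINT w|M. \<alpha> 0 w \<bullet> Y' 0 w)
      + (LINT s|leb 0 T. LINT w|M. \<beta> 0 s w \<bullet> Z' 0 s w)"
    using dual backward_pairing[OF s\<xi> s\<psi>' sq_integrable_add[OF sY'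
        has_ito_integral_sq_integrable(2)[OF order_refl order_refl I]] sAY sDZ eq[unfolded set_integral_leb]]
    by simp

  have sP: "sq_integrable (time_scenario 0 T) (\<lambda>(s, w). P s w)"
    by (rule cond_exp_process_sq_integrable[OF P _ s\<xi> order_refl]) (simp add: subalgebra_F)
  have "AE s in leb 0 T. (LINT w|M. P s w \<bullet> (A' 0 s w *v Y' s w)) = (LINT w|M. \<xi> 0 w \<bullet> (A' 0 s w *v Y' s w))"
    using A'_adapted AE_sq_integrable_section[OF sAY] AE_space
  proof eventually_elim
    case (elim s)
    then have s: "s \<in> {0..T}" "0 \<le> s" "s \<le> T" by auto
    note [measurable] = elim(1) adaptedD[OF Y'_ad s(2,3)]
    have "(\<lambda>w. A' 0 s w *v Y' s w) \<in> borel_measurable (F s)" by measurable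
    from cond_exp_process_inner[OF P s(1) subalgebra_F[OF s(3)] s\<xi> this elim(2)] show ?case .
  qed
  then have PA: "(LINT s|leb 0 T. LINT w|M. P s w \<bullet> (A' 0 s w *v Y' s w)) = ?a"
    by (intro integral_cong_AE borel_measurable_integrable
        integrable_time_expectation(1)[OF sP sAY]
        integrable_time_expectation(1)[OF sq_integrable_lift[OF finite_measure_leb s\<xi>] sAY])

  have "(\<lambda>w. Y' 0 w \<bullet> \<alpha> 0 w) \<in> borel_measurable (F 0)"
    using \<alpha>F Y'F by (rule borel_measurable_inner[rotated])
  from F_0_trivial[OF this sq_integrable_inner[OF sY' s\<alpha>]]
  have "AE w\<^sub>0 in M. Y' 0 w\<^sub>0 \<bullet> \<alpha> 0 w\<^sub>0 = (LINT w|M. \<alpha> 0 w \<bullet> Y' 0 w)"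
    by eventually_elim (simp add: inner_commute)
  then show ?thesis
    unfolding set_integral_leb integrable_time_expectation(3)[OF sP sAY] PA
      inner_commute[of "Z' _ _ _"] integrable_time_expectation(3)[OF s\<beta> sZ'] main
    by eventually_elim simp
qed

end

theorem lemma4p2:
  fixes M :: "'w measure"
    and T :: real
    and W :: "real \<Rightarrow> 'w \<Rightarrow> real"
    and F :: "real \<Rightarrow> 'w measure"
    and A B D A' :: "real \<Rightarrow> real \<Rightarrow> 'w \<Rightarrow> real^'m^'m"
    and \<Theta> :: "'w \<Rightarrow> real^'m"
    and \<psi> \<psi>' \<alpha> \<xi> Y \<mu> \<nu> Y' :: "real \<Rightarrow> 'w \<Rightarrow> real^'m"
    and \<beta> Z Z' :: "real \<Rightarrow> real \<Rightarrow> 'w \<Rightarrow> real^'m"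
  assumes T_pos: "T > 0"
    and prob: "prob_space M" and complete: "complete_measure M"
    and wiener: "wiener_process M T W"
    and filtration: "F = augmented_filtration M W"
    and coeffs: "bounded_coefficient M T A" "bounded_coefficient M T B"
      "bounded_coefficient M T D" "bounded_coefficient M T A'"
    and coeffs_adapted: "AE t in leb 0 T.
      adapted F T (A t) \<and> adapted F T (B t) \<and> adapted F T (D t) \<and> adapted F T (A' t)"
    and coeffs_cont: "AE s in leb 0 T. AE \<omega> in M.
      continuous_on {0..T} (\<lambda>t. A s t \<omega>) \<and> continuous_on {0..T} (\<lambda>t. B s t \<omega>) \<and>
      continuous_on {0..T} (\<lambda>t. D t s \<omega>) \<and> continuous_on {0..T} (\<lambda>t. A' t s \<omega>)"
    and \<Theta>: "\<Theta> \<in> L2_rv M (F T)"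
    and \<psi>: "\<psi> \<in> L2_meas M F T"
    and \<psi>': "\<psi>' \<in> C_L2 M F T"
    and \<alpha>: "\<alpha> \<in> C_L2_adapted M F T"
    and \<beta>: "\<beta> \<in> C_L2_adapted_fields M F T"
    and \<xi>: "\<xi> \<in> C_L2 M F T"
    and \<xi>_eq: "\<forall>t\<in>{0..T}. \<exists>P Q R I\<^sub>1 I\<^sub>2 I\<^sub>3.
      cond_exp_process M (\<lambda>_. F t) 0 t \<xi> P \<and>
      cond_exp_process M F 0 t (\<lambda>s \<omega>. transpose (B s t \<omega>) *v \<xi> s \<omega>) Q \<and>
      cond_exp_process M F t T (\<lambda>_. \<xi> t) R \<and>
      has_ito_integral M F W 0 t Q I\<^sub>1 \<and>
      has_ito_integral M F W 0 T (\<beta> t) I\<^sub>2 \<and>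
      has_ito_integral M F W t T (\<lambda>s \<omega>. transpose (D t s \<omega>) *v R s \<omega>) I\<^sub>3 \<and>
      (AE \<omega> in M. \<xi> t \<omega> = \<alpha> t \<omega> + (LINT s:{0..t}|lborel. transpose (A s t \<omega>) *v P s \<omega>)
         + I\<^sub>1 \<omega> + I\<^sub>2 \<omega> + I\<^sub>3 \<omega>)"
    and Y: "Y \<in> L2_adapted M F T"
    and Z: "Z \<in> L2_L2_adapted_fields M F T"
    and Y_eq: "AE t in leb 0 T. \<exists>I. has_ito_integral M F W t T (Z t) I \<and>
      (AE \<omega> in M. Y t \<omega> = \<psi> t \<omega> + A t T \<omega> *v \<Theta> \<omega> + B t T \<omega> *v \<nu> t \<omega>
         + (LINT s:{t..T}|lborel. A t s \<omega> *v Y s \<omega> + B t s \<omega> *v Z s t \<omega> + D t s \<omega> *v Z t s \<omega>)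
         - I \<omega>)"
    and Y_M_solution: "AE t in leb 0 T. \<exists>I. has_ito_integral M F W 0 t (Z t) I \<and>
      (AE \<omega> in M. Y t \<omega> = (LINT \<omega>'|M. Y t \<omega>') + I \<omega>)"
    and \<mu>: "\<mu> \<in> L2_adapted M F T"
    and \<nu>: "\<nu> \<in> L2_adapted M F T"
    and \<mu>_eq: "\<forall>t\<in>{0..T}. \<exists>I. has_ito_integral M F W t T \<nu> I \<and>
      (AE \<omega> in M. \<mu> t \<omega> = \<Theta> \<omega> - I \<omega>)"
    and Y': "Y' \<in> C_L2_adapted M F T"
    and Z': "Z' \<in> C_L2_adapted_fields M F T"
    and Y'_eq: "\<forall>t\<in>{0..T}. \<exists>I. has_ito_integral M F W t T (Z' t) I \<and>
      (AE \<omega> in M. Y' t \<omega> = \<psi>' t \<omega>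
         + (LINT s:{t..T}|lborel. A' t s \<omega> *v Y' s \<omega> + D t s \<omega> *v Z' t s \<omega>) - I \<omega>)"
    and Y'_C_solution: "\<forall>t\<in>{0..T}. \<exists>V\<in>L2_cont_paths M F T. \<forall>r\<in>{0..T}.
      \<exists>I. has_ito_integral M F W r T (Z' t) I \<and>
        (AE \<omega> in M. V r \<omega> = \<psi>' t \<omega>
           + (LINT s:{r..T}|lborel. A' t s \<omega> *v Y' s \<omega> + D t s \<omega> *v Z' t s \<omega>) - I \<omega>)"
  shows "((LINT \<omega>|M. \<xi> T \<omega> \<bullet> \<Theta> \<omega>) + (LINT \<omega>|M. (LINT t:{0..T}|lborel. \<psi> t \<omega> \<bullet> \<xi> t \<omega>))
      = (LINT \<omega>|M. \<alpha> T \<omega> \<bullet> \<Theta> \<omega>) + (LINT \<omega>|M. (LINT s:{0..T}|lborel. \<beta> T s \<omega> \<bullet> \<nu> s \<omega>))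
        + (LINT \<omega>|M. (LINT t:{0..T}|lborel. Y t \<omega> \<bullet> \<alpha> t \<omega>))
        + (LINT \<omega>|M. (LINT t:{0..T}|lborel. (LINT s:{0..T}|lborel. Z t s \<omega> \<bullet> \<beta> t s \<omega>)))) \<and>
    (\<forall>P. cond_exp_process M F 0 T (\<lambda>_. \<xi> 0) P \<longrightarrow>
      (AE \<omega>\<^sub>0 in M.
        (LINT \<omega>|M. \<xi> 0 \<omega> \<bullet> \<psi>' 0 \<omega>)
          + (LINT \<omega>|M. (LINT s:{0..T}|lborel. P s \<omega> \<bullet> (A' 0 s \<omega> *v Y' s \<omega>)))
        = Y' 0 \<omega>\<^sub>0 \<bullet> \<alpha> 0 \<omega>\<^sub>0 + (LINT \<omega>|M. (LINT s:{0..T}|lborel. Z' 0 s \<omega> \<bullet> \<beta> 0 s \<omega>))))"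
proof -
  interpret wiener_space M T W F
    by (intro wiener_space.intro wiener_space_axioms.intro prob complete T_pos wiener filtration)
  have A_adapted: "AE t in leb 0 T. adapted F T (A t)"
    and D_adapted: "AE t in leb 0 T. adapted F T (D t)"
    and A'_adapted: "AE t in leb 0 T. adapted F T (A' t)"
    using coeffs_adapted by (auto elim: eventually_mono)
  have D_cont: "AE s in leb 0 T. AE \<omega> in M. continuous_on {0..T} (\<lambda>t. D t s \<omega>)"
    using coeffs_cont by eventually_elim (auto elim: eventually_mono)
  have A'_cont: "AE s in leb 0 T. AE \<omega> in M. continuous_on {0..T} (\<lambda>t. A' t s \<omega>)"
    using coeffs_cont by eventually_elim (auto elim: eventually_mono)
  have fe: "\<forall>t\<in>{0..T}. forward_equation A B D \<alpha> \<beta> \<xi> t"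
    using \<xi>_eq unfolding forward_equation_def .
  show ?thesis
    by (intro conjI allI impI
        duality_terminal_and_free_term[OF coeffs(1-3) A_adapted D_adapted \<Theta> \<psi> \<alpha> \<beta> \<xi> fe Y Z Y_eq
          Y_M_solution \<mu> \<nu> \<mu>_eq]
        duality_initial[OF coeffs coefficient_adapted_at_0[OF D_adapted D_cont]
          coefficient_adapted_at_0[OF A'_adapted A'_cont] \<psi>' \<alpha> \<beta> \<xi> bspec[OF fe T_in(2)] Y' Z'
          bspec[OF Y'_eq T_in(2)]])
qed

end
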